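(* Let $G$ be a finite simple unmixed König graph without isolated vertices. The following are equivalent: (a) $G$ is Cohen–Macaulay; (b) $I_c(G)$ is linearly presented; (c) $\mathcal{G}_{I_c(G)}$ is connected; (d) $G$ has no duplicated vertices; (e) every induced $4$-cycle of $G$ has an edge without the (P) property; (f) $G$ has a unique perfect matching.
   Context: $G$ has vertices $t_1,\dots,t_s$, $S=K[t_1,\dots,t_s]$, $K$ a field. $G$ is unmixed if all minimal vertex covers (inclusion-minimal vertex sets meeting every edge) have the same size $\alpha_0(G)$. $G$ is König if it has a matching with $\alpha_0(G)$ edges. $G$ is Cohen–Macaulay if $S/I(G)$ is Cohen–Macaulay, where $I(G)=(t_it_j:\{t_i,t_j\}\in E(G))$. $I_c(G)$ is generated by $\prod_{t_i\in C}t_i$ over minimal vertex covers $C$; a monomial ideal minimally generated by $u_1,\dots,u_r$ is linearly presented if the $u_i$ have the same degree and the kernel of $S^r\to S$, $e_i\mapsto u_i$, is generated by vectors with linear-form entries. $\mathcal{G}_{I_c(G)}$ has the minimal vertex covers as vertices, $\{C_i,C_j\}$ ($i\ne j$) an edge iff $|C_i\cup C_j|=|C_i|+1$. Distinct vertices $t,t'$ are duplicated if $N_G(t)=N_G(t')$. An edge $e=\{t_1,t_2\}$ has the (P) property if for all edges $\{t_1,t_1'\}$, $\{t_2,t_2'\}$ distinct from $e$, $\{t_1',t_2'\}\in E(G)$. *)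

theory Defs
  imports Main "HOL-Library.Poly_Mapping" "HOL-Library.Extended_Nat"
begin

text \<open>A finite simple graph: vertex set UNIV of a finite type 'v, edge set E,
  each edge a 2-element set of vertices.\<close>

definition simple_graph :: "'v set set \<Rightarrow> bool" where
  "simple_graph E \<longleftrightarrow> (\<forall>e\<in>E. card e = 2)"

definition no_isolated_vertices :: "'v set set \<Rightarrow> bool" where
  "no_isolated_vertices E \<longleftrightarrow> (\<forall>v. \<exists>e\<in>E. v \<in> e)"

definition vertex_cover :: "'v set set \<Rightarrow> 'v set \<Rightarrow> bool" where
  "vertex_cover E C \<longleftrightarrow> (\<forall>e\<in>E. e \<inter> C \<noteq> {})"

definition min_vertex_cover :: "'v set set \<Rightarrow> 'v set \<Rightarrow> bool" where
  "min_vertex_cover E C \<longleftrightarrow> vertex_cover E C \<and> (\<forall>D. D \<subset> C \<longrightarrow> \<not> vertex_cover E D)"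

definition unmixed :: "'v set set \<Rightarrow> bool" where
  "unmixed E \<longleftrightarrow> (\<forall>C D. min_vertex_cover E C \<longrightarrow> min_vertex_cover E D \<longrightarrow> card C = card D)"

definition alpha0 :: "'v set set \<Rightarrow> nat" where
  "alpha0 E = (LEAST n. \<exists>C. vertex_cover E C \<and> card C = n)"

definition matching :: "'v set set \<Rightarrow> 'v set set \<Rightarrow> bool" where
  "matching E M \<longleftrightarrow> M \<subseteq> E \<and> (\<forall>e\<in>M. \<forall>f\<in>M. e \<noteq> f \<longrightarrow> e \<inter> f = {})"

definition Koenig :: "'v set set \<Rightarrow> bool" where
  "Koenig E \<longleftrightarrow> (\<exists>M. matching E M \<and> card M = alpha0 E)"

definition perfect_matching :: "'v set set \<Rightarrow> 'v set set \<Rightarrow> bool" where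
  "perfect_matching E M \<longleftrightarrow> matching E M \<and> \<Union>M = UNIV"

definition nbhd :: "'v set set \<Rightarrow> 'v \<Rightarrow> 'v set" where
  "nbhd E t = {u. {t, u} \<in> E}"

definition has_duplicated_vertices :: "'v set set \<Rightarrow> bool" where
  "has_duplicated_vertices E \<longleftrightarrow> (\<exists>t t'. t \<noteq> t' \<and> nbhd E t = nbhd E t')"

definition P_property :: "'v set set \<Rightarrow> 'v \<Rightarrow> 'v \<Rightarrow> bool" where
  "P_property E x y \<longleftrightarrow>
     (\<forall>x' y'. {x, x'} \<in> E \<longrightarrow> {y, y'} \<in> E \<longrightarrow> {x, x'} \<noteq> {x, y} \<longrightarrow> {y, y'} \<noteq> {x, y}
        \<longrightarrow> {x', y'} \<in> E)"

definition induced_C4 :: "'v set set \<Rightarrow> 'v \<Rightarrow> 'v \<Rightarrow> 'v \<Rightarrow> 'v \<Rightarrow> bool" where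
  "induced_C4 E a b c d \<longleftrightarrow> distinct [a, b, c, d] \<and>
     {a, b} \<in> E \<and> {b, c} \<in> E \<and> {c, d} \<in> E \<and> {d, a} \<in> E \<and>
     {a, c} \<notin> E \<and> {b, d} \<notin> E"

definition C4_condition :: "'v set set \<Rightarrow> bool" where
  "C4_condition E \<longleftrightarrow> (\<forall>a b c d. induced_C4 E a b c d \<longrightarrow>
     (\<not> P_property E a b \<or> \<not> P_property E b c \<or> \<not> P_property E c d \<or> \<not> P_property E d a))"

definition cover_graph_adj :: "'v set set \<Rightarrow> 'v set \<Rightarrow> 'v set \<Rightarrow> bool" where
  "cover_graph_adj E C D \<longleftrightarrow> min_vertex_cover E C \<and> min_vertex_cover E D \<and> C \<noteq> D \<and>
     card (C \<union> D) = card C + 1"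

definition cover_graph_connected :: "'v set set \<Rightarrow> bool" where
  "cover_graph_connected E \<longleftrightarrow>
     (\<forall>C D. min_vertex_cover E C \<longrightarrow> min_vertex_cover E D \<longrightarrow>
        (\<lambda>X Y. cover_graph_adj E X Y \<or> cover_graph_adj E Y X)\<^sup>*\<^sup>* C D)"

type_synonym ('v, 'k) mpoly = "('v \<Rightarrow>\<^sub>0 nat) \<Rightarrow>\<^sub>0 'k"

definition var :: "'v \<Rightarrow> ('v, 'k::field) mpoly" where
  "var v = Poly_Mapping.single (Poly_Mapping.single v 1) 1"

definition monom_of :: "'v set \<Rightarrow> ('v, 'k::field) mpoly" where
  "monom_of C = (\<Prod>v\<in>C. var v)"

definition ideal_gen :: "('v, 'k::field) mpoly set \<Rightarrow> ('v, 'k) mpoly set" where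
  "ideal_gen A = {p. \<exists>F c. finite F \<and> F \<subseteq> A \<and> p = (\<Sum>a\<in>F. c a * a)}"

definition is_ideal :: "('v, 'k::field) mpoly set \<Rightarrow> bool" where
  "is_ideal J \<longleftrightarrow> 0 \<in> J \<and> (\<forall>a\<in>J. \<forall>b\<in>J. a + b \<in> J) \<and> (\<forall>a\<in>J. \<forall>r. r * a \<in> J)"

definition prime_ideal :: "('v, 'k::field) mpoly set \<Rightarrow> bool" where
  "prime_ideal P \<longleftrightarrow> is_ideal P \<and> 1 \<notin> P \<and> (\<forall>a b. a * b \<in> P \<longrightarrow> a \<in> P \<or> b \<in> P)"

definition edge_ideal :: "'v set set \<Rightarrow> ('v, 'k::field) mpoly set" where
  "edge_ideal E = ideal_gen {monom_of e | e. e \<in> E}"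

definition max_ideal :: "('v, 'k::field) mpoly set" where
  "max_ideal = ideal_gen (range var)"

definition krull_dim_quot :: "('v, 'k::field) mpoly set \<Rightarrow> enat" where
  "krull_dim_quot J = Sup {enat (length ps - 1) | ps. ps \<noteq> [] \<and> sorted_wrt (\<subset>) ps \<and>
      (\<forall>P\<in>set ps. prime_ideal P \<and> J \<subseteq> P)}"

definition regular_seq :: "('v, 'k::field) mpoly set \<Rightarrow> ('v, 'k) mpoly list \<Rightarrow> bool" where
  "regular_seq J fs \<longleftrightarrow> set fs \<subseteq> max_ideal \<and>
     1 \<notin> ideal_gen (J \<union> set fs) \<and>
     (\<forall>i < length fs. \<forall>g. fs ! i * g \<in> ideal_gen (J \<union> set (take i fs)) \<longrightarrow>
                             g \<in> ideal_gen (J \<union> set (take i fs)))"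

definition depth_quot :: "('v, 'k::field) mpoly set \<Rightarrow> enat" where
  "depth_quot J = Sup {enat (length fs) | fs. regular_seq J fs}"

definition Cohen_Macaulay_quot :: "('v, 'k::field) mpoly set \<Rightarrow> bool" where
  "Cohen_Macaulay_quot J \<longleftrightarrow> depth_quot J = krull_dim_quot J"

definition Cohen_Macaulay_graph :: "'k::field itself \<Rightarrow> 'v set set \<Rightarrow> bool" where
  "Cohen_Macaulay_graph TYPE('k) E \<longleftrightarrow> Cohen_Macaulay_quot (edge_ideal E :: ('v, 'k) mpoly set)"

text \<open>Linear presentation of I_c(G). The minimal generators of I_c(G) are the
  monomials t_C, C a minimal vertex cover; vectors of S^r are indexed by the
  minimal vertex covers (functions vanishing elsewhere).\<close>
definition linear_form :: "('v::finite, 'k::field) mpoly \<Rightarrow> bool" where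
  "linear_form p \<longleftrightarrow> (\<forall>m\<in>Poly_Mapping.keys p. (\<Sum>v\<in>UNIV. Poly_Mapping.lookup m v) = 1)"

definition syzygies :: "'v set set \<Rightarrow> ('v set \<Rightarrow> ('v, 'k::field) mpoly) set" where
  "syzygies E = {w. (\<forall>C. \<not> min_vertex_cover E C \<longrightarrow> w C = 0) \<and>
      (\<Sum>C\<in>{C. min_vertex_cover E C}. w C * monom_of C) = 0}"

definition module_span :: "('i \<Rightarrow> ('v, 'k::field) mpoly) set \<Rightarrow> ('i \<Rightarrow> ('v, 'k) mpoly) set" where
  "module_span W = {w. \<exists>F c. finite F \<and> F \<subseteq> W \<and> w = (\<lambda>i. \<Sum>x\<in>F. c x * x i)}"

definition linearly_presented_cover_ideal :: "'k::field itself \<Rightarrow> ('v::finite) set set \<Rightarrow> bool" where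
  "linearly_presented_cover_ideal TYPE('k) E \<longleftrightarrow>
     (\<forall>C D. min_vertex_cover E C \<longrightarrow> min_vertex_cover E D \<longrightarrow> card C = card D) \<and>
     (syzygies E :: ('v set \<Rightarrow> ('v, 'k) mpoly) set) \<subseteq>
        module_span {w \<in> syzygies E. \<forall>C. linear_form (w C)}"

end

theory Submission
  imports Defs "HOL-Library.FuncSet"
begin

text \<open>
  Unmixedness forces every minimal vertex cover to meet each edge of a Koenig matching exactly once,
  so such a matching \<open>m\<close> is perfect and all its edges have the (P) property. In terms of
  neighbourhoods, \<open>x ~ x'\<close> implies \<open>N(m x) \<subseteq> N(x')\<close>, and each of the other conditions is compared
  with the absence of duplicated vertices. Without duplicates, two minimal covers \<open>C\<close> and \<open>D\<close> are joined by
  exchanges of partners that stay inside \<open>C \<union> D\<close>; this gives connectedness, and since the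
  covers on the path divide the least common multiple of the two generators, it also gives
  generation of the syzygies by linear ones.

  For the Cohen-Macaulay property let \<open>g\<close> be half the number of vertices. Chains of primes
  over \<open>I(G)\<close> have length at most \<open>g\<close> by counting monomials, and length \<open>g\<close> is attained. Without
  duplicates the differences \<open>x - m x\<close> form a regular sequence of length \<open>g\<close>: after identifying
  partners the ideal stays monomial, and the (P) property excludes monomials annihilated by
  both \<open>x\<close> and \<open>m x\<close>. If there are duplicates, there is an independent set \<open>F\<close> whose link in the
  independence complex is disconnected and \<open>|F| \<le> g - 2\<close>; an explicit Koszul
  cocycle of degree \<open>|F| + 1\<close> then shows that regular sequences have length less than \<open>g\<close>.
\<close>

section \<open>Graphs whose minimal covers are transversal to a matching\<close>

text \<open>Depth and dimension are suprema, so upper bounds over all regular sequences and all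
  chains of primes are needed. A regular sequence \<open>fs\<close> kills Koszul cohomology in all
  degrees below \<open>length fs\<close>, for any sequence \<open>q\<close> whose ideal contains
  powers of the members of \<open>fs\<close>; a single nonzero class in degree i therefore bounds
  the depth by i. The freedom in \<open>q\<close> makes small classes available: with squares of the
  variables in F and the remaining variables themselves, no boundary in a direction of F reaches a
  squarefree monomial, and only the link of F is seen. A facet F gives the bound |F|, a disconnected
  link the bound |F| + 1. The number g - 2 arises because F together with all vertices sharing the
  neighbourhood of t contains one end of every matching edge, and there are at least two such
  vertices if t has a duplicate.\<close>

lemma simple_graph_no_loop:
  assumes "simple_graph E"
  shows "{v} \<notin> E" "{v, v} \<notin> E"
  using assms by (auto simp: simple_graph_def)

lemma simple_graph_edgeE:
  assumes "simple_graph E" "e \<in> E"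
  obtains a b where "e = {a, b}" "a \<noteq> b"
  using assms unfolding simple_graph_def by (metis card_2_iff)

lemma vertex_cover_iff:
  assumes "simple_graph E"
  shows "vertex_cover E C \<longleftrightarrow> (\<forall>a b. {a, b} \<in> E \<longrightarrow> a \<in> C \<or> b \<in> C)"
proof
  assume R: "\<forall>a b. {a, b} \<in> E \<longrightarrow> a \<in> C \<or> b \<in> C"
  show "vertex_cover E C"
    unfolding vertex_cover_def
  proof
    fix e assume "e \<in> E"
    then obtain a b where "e = {a, b}" using simple_graph_edgeE[OF assms] by metis
    then show "e \<inter> C \<noteq> {}" using R \<open>e \<in> E\<close> by blast
  qed
next
  assume L: "vertex_cover E C"
  show "\<forall>a b. {a, b} \<in> E \<longrightarrow> a \<in> C \<or> b \<in> C"
  proof (intro allI impI)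
    fix a b assume "{a, b} \<in> E"
    then have "{a, b} \<inter> C \<noteq> {}" using L unfolding vertex_cover_def by (rule bspec[rotated])
    then show "a \<in> C \<or> b \<in> C" by auto
  qed
qed

lemma min_vertex_cover_subset:
  fixes E :: "('v::finite) set set"
  assumes "vertex_cover E C"
  obtains D where "D \<subseteq> C" "min_vertex_cover E D"
proof -
  have "finite C" by simp
  then have "\<exists>D\<subseteq>C. min_vertex_cover E D"
    using assms
  proof (induction C rule: finite_psubset_induct)
    case (psubset C)
    show ?case
    proof (cases "min_vertex_cover E C")
      case False
      then have "\<exists>D. D \<subset> C \<and> vertex_cover E D"
        using psubset.prems by (simp add: min_vertex_cover_def)
      then obtain D where "D \<subset> C" "vertex_cover E D" by (elim exE conjE)
      then have "\<exists>D'\<subseteq>D. min_vertex_cover E D'" by (rule psubset.IH)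
      then show ?thesis using \<open>D \<subset> C\<close> by (meson psubset_imp_subset subset_trans)
    next
      case True
      then show ?thesis by blast
    qed
  qed
  then show thesis using that by blast
qed

lemma min_vertex_cover_neighbour:
  assumes "simple_graph E" "min_vertex_cover E C" "v \<in> C"
  obtains w where "{v, w} \<in> E" "w \<notin> C"
proof -
  have "C - {v} \<subset> C" using assms(3) by blast
  then have "\<not> vertex_cover E (C - {v})" "vertex_cover E C"
    using assms(2) by (simp_all add: min_vertex_cover_def)
  then obtain a b where ab: "{a, b} \<in> E" "a \<notin> C - {v}" "b \<notin> C - {v}" "a \<in> C \<or> b \<in> C"
    unfolding vertex_cover_iff[OF assms(1)] by blast
  have "a \<noteq> b" using ab(1) simple_graph_no_loop[OF assms(1)] by auto
  show thesis
  proof (cases "a \<in> C")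
    case True
    then show thesis using ab \<open>a \<noteq> b\<close> that[of b] by auto
  next
    case False
    then show thesis using ab that[of a] by (auto simp: insert_commute)
  qed
qed

text \<open>The complement of \<open>{a, b}\<close> is a cover, because an edge missing it would be
  \<open>{a, b}\<close> itself or a loop. The case \<open>a = b\<close> provides a minimal cover
  avoiding a single vertex.\<close>

lemma min_vertex_cover_avoiding:
  fixes E :: "('v::finite) set set"
  assumes "simple_graph E" "{a, b} \<notin> E"
  obtains C where "min_vertex_cover E C" "a \<notin> C" "b \<notin> C"
proof -
  have "{b, a} \<notin> E" using assms(2) by (simp add: insert_commute)
  then have "vertex_cover E (- {a, b})"
    using assms simple_graph_no_loop[OF assms(1)] by (auto simp: vertex_cover_iff[OF assms(1)])
  then show thesis using that min_vertex_cover_subset by (metis ComplD insertCI subsetD)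
qed

text \<open>For a neighbour \<open>z\<close> of \<open>b\<close> other than \<open>a\<close>,
  property (P) of \<open>{a, b}\<close> applied to \<open>{a, d}\<close> and \<open>{b, z}\<close>
  makes \<open>d\<close> and \<open>z\<close> adjacent. With (P) of \<open>{d, a}\<close> the same
  holds with \<open>b\<close> and \<open>d\<close> interchanged, so these opposite vertices are
  duplicates.\<close>

lemma duplicated_if_C4:
  assumes "simple_graph E" "\<not> C4_condition E"
  shows "has_duplicated_vertices E"
proof -
  obtain a b c d where C: "induced_C4 E a b c d" and ab: "P_property E a b" and da: "P_property E d a"
    using assms(2) by (auto simp: C4_condition_def)
  have dist: "b \<noteq> d" "a \<noteq> b" "a \<noteq> d" and E: "{a, b} \<in> E" "{d, a} \<in> E"
    using C by (auto simp: induced_C4_def)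
  have "nbhd E b = nbhd E d"
  proof (intro equalityI subsetI)
    fix z assume "z \<in> nbhd E b"
    then have z: "{b, z} \<in> E" by (simp add: nbhd_def)
    have "{d, z} \<in> E" if "z \<noteq> a"
    proof -
      have "{a, d} \<noteq> {a, b}" "{b, z} \<noteq> {a, b}" using dist that by (auto simp: doubleton_eq_iff)
      then show ?thesis using ab z E(2) by (auto simp: P_property_def insert_commute)
    qed
    then show "z \<in> nbhd E d" using E by (auto simp: nbhd_def)
  next
    fix z assume "z \<in> nbhd E d"
    then have z: "{d, z} \<in> E" by (simp add: nbhd_def)
    have "{z, b} \<in> E" if "z \<noteq> a"
    proof -
      have "{a, b} \<noteq> {d, a}" "{d, z} \<noteq> {d, a}" using dist that by (auto simp: doubleton_eq_iff)
      then show ?thesis using da z E(1) by (auto simp: P_property_def)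
    qed
    then have "{b, z} \<in> E" using E by (cases "z = a") (simp_all add: insert_commute)
    then show "z \<in> nbhd E b" by (simp add: nbhd_def)
  qed
  then show ?thesis using dist by (auto simp: has_duplicated_vertices_def)
qed

text \<open>A perfect matching is encoded by the involution that exchanges partners.\<close>

locale P_matching =
  fixes E :: "('v::finite) set set" and m :: "'v \<Rightarrow> 'v"
  assumes simple: "simple_graph E"
    and medge: "{v, m v} \<in> E"
    and minv [simp]: "m (m v) = v"
    and P: "{x, x'} \<in> E \<Longrightarrow> {m x, y'} \<in> E \<Longrightarrow> {x', y'} \<in> E"
begin

lemma m_neq [simp]: "m v \<noteq> v" "v \<noteq> m v"
  using medge[of v] simple_graph_no_loop[OF simple] by auto

lemma m_eq_iff [simp]: "m a = m b \<longleftrightarrow> a = b"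
  by (metis minv)

lemma no_loop [simp]: "{v} \<notin> E"
  using simple_graph_no_loop[OF simple] by auto

lemma nbhd_mono: "{x, x'} \<in> E \<Longrightarrow> nbhd E (m x) \<subseteq> nbhd E x'"
  unfolding nbhd_def using P by fast

lemma P_property_m: "P_property E x (m x)"
  unfolding P_property_def using P by fast

text \<open>If a minimal cover contained both ends of a matching edge, each end would have a
  neighbour outside the cover, and (P) would join these two neighbours by an uncovered edge.\<close>

lemma min_vertex_cover_m:
  assumes "min_vertex_cover E C"
  shows "m v \<in> C \<longleftrightarrow> v \<notin> C"
proof -
  have c: "vertex_cover E C" using assms by (simp add: min_vertex_cover_def)
  have "\<not> (v \<in> C \<and> m v \<in> C)"
  proof
    assume "v \<in> C \<and> m v \<in> C"
    then obtain a b where "{v, a} \<in> E" "a \<notin> C" "{m v, b} \<in> E" "b \<notin> C"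
      using min_vertex_cover_neighbour[OF simple assms] by metis
    then show False using P[of v a b] c by (auto simp: vertex_cover_iff[OF simple])
  qed
  moreover have "v \<in> C \<or> m v \<in> C" using c medge by (auto simp: vertex_cover_iff[OF simple])
  ultimately show ?thesis by blast
qed

lemma min_vertex_coverI:
  assumes "vertex_cover E C" "\<And>v. m v \<in> C \<Longrightarrow> v \<notin> C"
  shows "min_vertex_cover E C"
  unfolding min_vertex_cover_def
proof (intro conjI allI impI assms(1) notI)
  fix D assume "D \<subset> C" "vertex_cover E D"
  then obtain v where "v \<in> C" "v \<notin> D" "m v \<in> D"
    using medge by (metis psubset_imp_ex_mem vertex_cover_iff[OF simple] DiffE)
  then show False using assms(2)[of v] \<open>D \<subset> C\<close> by auto
qed

lemma card_transversal:
  assumes "\<And>v. m v \<in> C \<longleftrightarrow> v \<notin> C"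
  shows "2 * card C = card (UNIV :: 'v set)"
proof -
  have "m ` C = - C"
  proof
    show "- C \<subseteq> m ` C" using assms by (metis ComplD image_eqI minv subsetI)
  qed (use assms in auto)
  moreover have "card (m ` C) = card C" by (rule card_image) (simp add: inj_on_def)
  ultimately show ?thesis using card_Un_disjoint[of C "- C"] by simp
qed

lemma card_min_vertex_cover:
  assumes "min_vertex_cover E C"
  shows "2 * card C = card (UNIV :: 'v set)"
  using card_transversal min_vertex_cover_m[OF assms] by blast

lemma card_min_vertex_cover_eq:
  assumes "min_vertex_cover E C" "min_vertex_cover E D"
  shows "card C = card D"
  using assms[THEN card_min_vertex_cover] by simp

text \<open>Membership in a minimal cover is decided by the neighbourhood alone, so duplicated
  vertices lie in the same minimal covers.\<close>

lemma not_in_min_vertex_cover_iff: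
  assumes "min_vertex_cover E C"
  shows "t \<notin> C \<longleftrightarrow> nbhd E t \<subseteq> C"
proof
  assume "t \<notin> C"
  then show "nbhd E t \<subseteq> C"
    using assms by (auto simp: nbhd_def min_vertex_cover_def vertex_cover_iff[OF simple])
next
  assume "nbhd E t \<subseteq> C"
  then have "m t \<in> C" using medge by (auto simp: nbhd_def)
  then show "t \<notin> C" using min_vertex_cover_m[OF assms] by simp
qed

section \<open>Duplicated vertices and connectedness of the cover graph\<close>

lemma duplicated_not_adjacent:
  assumes "nbhd E t = nbhd E t'"
  shows "{t, t'} \<notin> E"
proof
  assume "{t, t'} \<in> E"
  then have "t' \<in> nbhd E t" by (simp add: nbhd_def)
  then have "t' \<in> nbhd E t'" using assms by simp
  then show False by (simp add: nbhd_def)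
qed

text \<open>An edge of the cover graph exchanges one vertex for one other, while duplicates enter or
  leave a cover together. Hence membership of \<open>t\<close> is constant on connected components,
  yet some covers avoid \<open>t\<close> and others avoid \<open>m t\<close> and so contain
  \<open>t\<close>.\<close>

lemma no_duplicates_if_connected:
  assumes "cover_graph_connected E"
  shows "\<not> has_duplicated_vertices E"
proof
  assume "has_duplicated_vertices E"
  then obtain t t' where t: "t \<noteq> t'" "nbhd E t = nbhd E t'"
    by (auto simp: has_duplicated_vertices_def)
  have same: "t \<in> C \<longleftrightarrow> t' \<in> C" if "min_vertex_cover E C" for C
    using not_in_min_vertex_cover_iff[OF that] t by metis
  have imp: "t \<in> D" if adj: "cover_graph_adj E C D" and C: "t \<in> C" for C D
  proof (rule ccontr)
    assume "t \<notin> D"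
    have mc: "min_vertex_cover E C" "min_vertex_cover E D" and c1: "card (C \<union> D) = card C + 1"
      using adj by (auto simp: cover_graph_adj_def)
    then have "{t, t'} \<subseteq> (C \<union> D) - D" using same C \<open>t \<notin> D\<close> by blast
    moreover have "card ((C \<union> D) - D) = 1"
      using c1 card_min_vertex_cover_eq[OF mc] by (simp add: card_Diff_subset)
    ultimately have "card {t, t'} \<le> 1" by (metis card_mono finite)
    then show False using t(1) by simp
  qed
  have sym: "cover_graph_adj E D C" if "cover_graph_adj E C D" for C D
  proof -
    have "card C = card D" using that card_min_vertex_cover_eq by (auto simp: cover_graph_adj_def)
    then show ?thesis using that by (auto simp: cover_graph_adj_def Un_commute)
  qed
  obtain C where C: "min_vertex_cover E C" "t \<notin> C"
    using min_vertex_cover_avoiding[OF simple, of t t] by auto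
  obtain D where D: "min_vertex_cover E D" "m t \<notin> D"
    using min_vertex_cover_avoiding[OF simple, of "m t" "m t"] by auto
  have "(\<lambda>X Y. cover_graph_adj E X Y \<or> cover_graph_adj E Y X)\<^sup>*\<^sup>* D C"
    using assms C D by (auto simp: cover_graph_connected_def)
  then have "t \<in> C"
    using min_vertex_cover_m[OF D(1), of t] D(2)
    by (induction rule: rtranclp_induct) (use imp sym in auto)
  then show False using C by simp
qed

text \<open>Among the matching edges on which two covers differ, one whose endpoint outside the first
  cover has the largest neighbourhood can be switched.\<close>

lemma exchange_step:
  assumes nodup: "\<not> has_duplicated_vertices E"
    and C: "min_vertex_cover E C" and D: "min_vertex_cover E D" and "C \<noteq> D"
  obtains x where "x \<in> D" "x \<notin> C" "min_vertex_cover E (insert x (C - {m x}))"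
proof -
  have "D - C \<noteq> {}"
    using \<open>C \<noteq> D\<close> C D by (auto simp: min_vertex_cover_def)
  then have "Max ((\<lambda>z. card (nbhd E z)) ` (D - C)) \<in> (\<lambda>z. card (nbhd E z)) ` (D - C)"
    by (intro Max_in) auto
  then obtain x where x: "x \<in> D - C" and "card (nbhd E x) = Max ((\<lambda>z. card (nbhd E z)) ` (D - C))"
    by (metis (no_types, lifting) imageE)
  then have mx: "card (nbhd E z) \<le> card (nbhd E x)" if "z \<in> D - C" for z
    using that by simp
  let ?C = "insert x (C - {m x})"
  have covC: "vertex_cover E C" and covD: "vertex_cover E D"
    using C D by (auto simp: min_vertex_cover_def)
  \<comment> \<open>The only edges that the exchange could uncover join \<open>m x\<close> to some
    \<open>z\<close> outside \<open>C\<close>. Such a \<open>z\<close> lies in \<open>D\<close>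
    because \<open>m x\<close> does not, and its neighbourhood properly contains that of
    \<open>x\<close>, against the choice of \<open>x\<close>.\<close>
  have nadj: "z \<in> C" if "{m x, z} \<in> E" "z \<noteq> x" for z
  proof (rule ccontr)
    assume "z \<notin> C"
    have "m x \<notin> D" using x min_vertex_cover_m[OF D] by auto
    then have "z \<in> D" using covD that by (auto simp: vertex_cover_iff[OF simple])
    have "nbhd E x \<subseteq> nbhd E z" using nbhd_mono[OF that(1)] by simp
    moreover have "nbhd E x \<noteq> nbhd E z"
      using nodup that(2) by (auto simp: has_duplicated_vertices_def)
    ultimately have "card (nbhd E x) < card (nbhd E z)" by (intro psubset_card_mono) auto
    then show False using mx[of z] \<open>z \<in> D\<close> \<open>z \<notin> C\<close> by simp
  qed
  have "vertex_cover E ?C"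
    unfolding vertex_cover_iff[OF simple]
  proof (intro allI impI)
    fix a b assume ab: "{a, b} \<in> E"
    have ba: "{b, a} \<in> E" using ab by (simp add: insert_commute)
    have "a \<in> C \<or> b \<in> C" using ab covC by (auto simp: vertex_cover_iff[OF simple])
    then show "a \<in> ?C \<or> b \<in> ?C" using nadj[of a] nadj[of b] ab ba by fastforce
  qed
  moreover have "w \<notin> ?C" if "m w \<in> ?C" for w
    using that min_vertex_cover_m[OF C, of w] by auto
  ultimately have "min_vertex_cover E ?C" by (rule min_vertex_coverI)
  then show thesis using that x by blast
qed

text \<open>Each exchange brings in a vertex of \<open>D\<close> and drops one outside
  \<open>D\<close>, so \<open>D - C\<close> shrinks and nothing outside \<open>C \<union> D\<close>
  is used. The containment is recorded for the syzygies, where every cover on the path has to divide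
  a given monomial.\<close>

lemma cover_graph_path:
  assumes nodup: "\<not> has_duplicated_vertices E"
    and "min_vertex_cover E C" and D: "min_vertex_cover E D"
  shows "(\<lambda>X Y. cover_graph_adj E X Y \<and> X \<subseteq> C \<union> D \<and> Y \<subseteq> C \<union> D)\<^sup>*\<^sup>* C D"
  using assms(2)
proof (induction "card (D - C)" arbitrary: C rule: less_induct)
  case less
  show ?case
  proof (cases "C = D")
    case False
    obtain x where x: "x \<in> D" "x \<notin> C" and min: "min_vertex_cover E (insert x (C - {m x}))"
      using exchange_step[OF nodup less.prems D False] .
    let ?C = "insert x (C - {m x})"
    have mx: "m x \<in> C" "m x \<notin> D"
      using x min_vertex_cover_m[OF D] min_vertex_cover_m[OF less.prems] by auto
    have sub: "?C \<union> D \<subseteq> C \<union> D" using x by auto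
    have "D - ?C \<subset> D - C" using mx x by blast
    then have "card (D - ?C) < card (D - C)" by (intro psubset_card_mono) simp_all
    then have "(\<lambda>X Y. cover_graph_adj E X Y \<and> X \<subseteq> ?C \<union> D \<and> Y \<subseteq> ?C \<union> D)\<^sup>*\<^sup>* ?C D"
      using less.hyps min by blast
    then have path: "(\<lambda>X Y. cover_graph_adj E X Y \<and> X \<subseteq> C \<union> D \<and> Y \<subseteq> C \<union> D)\<^sup>*\<^sup>* ?C D"
      using sub by (elim rtranclp_mono[THEN predicate2D, rotated]) auto
    have "C \<union> ?C = insert x C" using mx by auto
    then have "cover_graph_adj E C ?C"
      using less.prems min x by (auto simp: cover_graph_adj_def)
    then show ?thesis
      by (intro converse_rtranclp_into_rtranclp[OF _ path]) (use sub in auto)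
  qed auto
qed

lemma cover_graph_connectedI:
  assumes "\<not> has_duplicated_vertices E"
  shows "cover_graph_connected E"
  unfolding cover_graph_connected_def
proof (intro allI impI)
  fix C D assume "min_vertex_cover E C" "min_vertex_cover E D"
  from cover_graph_path[OF assms this]
  show "(\<lambda>X Y. cover_graph_adj E X Y \<or> cover_graph_adj E Y X)\<^sup>*\<^sup>* C D"
    by (elim rtranclp_mono[THEN predicate2D, rotated]) auto
qed

lemma duplicated_m:
  assumes "nbhd E v = nbhd E t"
  shows "nbhd E (m v) = nbhd E (m t)"
proof
  have "{t, m v} \<in> E" "{v, m t} \<in> E"
    using medge[of v] medge[of t] assms by (auto simp: nbhd_def)
  then show "nbhd E (m t) \<subseteq> nbhd E (m v)" "nbhd E (m v) \<subseteq> nbhd E (m t)"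
    using nbhd_mono by auto
qed

lemma nbhd_m_neq: "nbhd E (m t) \<noteq> nbhd E t"
proof
  assume "nbhd E (m t) = nbhd E t"
  moreover have "m t \<in> nbhd E t" using medge by (simp add: nbhd_def)
  ultimately have "m t \<in> nbhd E (m t)" by simp
  then show False by (simp add: nbhd_def)
qed

text \<open>The instance \<open>x' = y'\<close> of (P), whose conclusion would be a loop: no
  matching edge lies in a triangle.\<close>

lemma not_both_adjacent: "{v, t} \<in> E \<Longrightarrow> {m v, t} \<notin> E"
  using P[of v t t] by auto

text \<open>Apart from the trivial case \<open>v = m t\<close>, two matching edges joined by two
  disjoint edges form a 4-cycle in which \<open>v\<close> and \<open>m t\<close> are opposite. Both
  the link construction and the regular sequence arrive at duplicates in this way.\<close>

lemma duplicated_if_parallel: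
  assumes "{t, v} \<in> E" "{m t, m v} \<in> E"
  shows "nbhd E v = nbhd E (m t)"
proof
  show "nbhd E (m t) \<subseteq> nbhd E v" using nbhd_mono assms(1) by blast
  have "{m v, m t} \<in> E" using assms(2) by (simp add: insert_commute)
  then show "nbhd E v \<subseteq> nbhd E (m t)" using nbhd_mono[of "m v"] by simp
qed

text \<open>The link of the independent set \<open>F\<close> in the independence complex consists of the two disjoint
  simplices spanned by the duplicates of \<open>t\<close> and the duplicates of its partner.\<close>

lemma independent_set_with_disconnected_link:
  fixes t
  defines "X \<equiv> {v. nbhd E v = nbhd E t}" and "Y \<equiv> {v. nbhd E v = nbhd E (m t)}"
  obtains F where "F \<inter> (X \<union> Y) = {}" "\<And>v. v \<notin> X \<union> Y \<Longrightarrow> m v \<in> F \<longleftrightarrow> v \<notin> F"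
    "\<And>a b. a \<in> F \<union> X \<Longrightarrow> b \<in> F \<union> X \<Longrightarrow> {a, b} \<notin> E"
    "\<And>a b. a \<in> F \<union> Y \<Longrightarrow> b \<in> F \<union> Y \<Longrightarrow> {a, b} \<notin> E"
    "\<And>a b. a \<in> X \<Longrightarrow> b \<in> Y \<Longrightarrow> {a, b} \<in> E"
    "2 * (card F + card X) = card (UNIV :: 'v set)"
proof -
  define N where "N = nbhd E t \<union> nbhd E (m t)"
  obtain C where C: "min_vertex_cover E C"
    using min_vertex_cover_avoiding[OF simple, of t t] by auto
  then have covC: "vertex_cover E C" by (simp add: min_vertex_cover_def)
  \<comment> \<open>A matching edge with exactly one end in \<open>N\<close> has to contribute the
    other end; on the edges disjoint from \<open>N\<close>, the complement of a minimal cover is an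
    independent choice.\<close>
  define F where "F = {v. v \<notin> N \<and> (m v \<in> N \<or> v \<notin> C)}"
  have mX: "m v \<in> Y \<longleftrightarrow> v \<in> X" for v
    unfolding X_def Y_def using duplicated_m[of v t] duplicated_m[of "m v" "m t"] by auto
  have mY: "m v \<in> X \<longleftrightarrow> v \<in> Y" for v
    using mX[of "m v"] by simp
  have XYd: "X \<inter> Y = {}" unfolding X_def Y_def using nbhd_m_neq by auto
  have XY: "{a, b} \<in> E" if "a \<in> X" "b \<in> Y" for a b
  proof -
    have "m t \<in> nbhd E a" using that medge[of t] by (auto simp: X_def nbhd_def)
    then have "a \<in> nbhd E (m t)" by (simp add: nbhd_def insert_commute)
    then have "a \<in> nbhd E b" using that by (simp add: Y_def)
    then show ?thesis by (simp add: nbhd_def insert_commute)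
  qed
  have t: "t \<in> X" "m t \<in> Y" by (auto simp: X_def Y_def)
  have sub: "X \<union> Y \<subseteq> N"
    using XY[OF t(1)] XY[OF _ t(2)] by (auto simp: N_def nbhd_def insert_commute[of "m t"])
  have FN: "F \<inter> N = {}" by (auto simp: F_def)
  \<comment> \<open>A matching edge with both ends in \<open>N\<close> forms a triangle with
    \<open>t\<close> or \<open>m t\<close>, or closes a 4-cycle with the edge
    \<open>{t, m t}\<close>. The first is impossible, the second makes its ends duplicates of
    \<open>t\<close> and \<open>m t\<close>.\<close>
  have one: "v \<notin> N \<or> m v \<notin> N" if "v \<notin> X \<union> Y" for v
  proof (rule ccontr)
    assume "\<not> (v \<notin> N \<or> m v \<notin> N)"
    then consider "{v, t} \<in> E" "{m v, t} \<in> E" | "{v, m t} \<in> E" "{m v, m t} \<in> E"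
      | "{t, v} \<in> E" "{m t, m v} \<in> E" | "{m t, v} \<in> E" "{t, m v} \<in> E"
      by (auto simp: N_def nbhd_def insert_commute)
    then show False
    proof cases
      case 3
      then have "v \<in> Y" using duplicated_if_parallel by (simp add: Y_def)
      then show False using that by simp
    next
      case 4
      then have "v \<in> X" using duplicated_if_parallel[of "m t" v] by (simp add: X_def)
      then show False using that by simp
    qed (use not_both_adjacent in blast)+
  qed
  have trans: "m v \<in> F \<longleftrightarrow> v \<notin> F" if "v \<notin> X \<union> Y" for v
    using one[OF that] min_vertex_cover_m[OF C, of v] by (auto simp: F_def)
  \<comment> \<open>All neighbours of the partner of a vertex of \<open>N\<close> are again in
    \<open>N\<close>, so a vertex placed in \<open>F\<close> on account of its partner has no
    neighbour in \<open>F\<close>.\<close>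
  have spread: "b \<in> N" if "{a, b} \<in> E" "m a \<in> N" for a b
  proof -
    have "t \<in> nbhd E (m a) \<or> m t \<in> nbhd E (m a)"
      using that(2) by (auto simp: N_def nbhd_def insert_commute)
    then have "t \<in> nbhd E b \<or> m t \<in> nbhd E b" using nbhd_mono[OF that(1)] by blast
    then show ?thesis by (auto simp: N_def nbhd_def insert_commute)
  qed
  have FF: "{a, b} \<notin> E" if "a \<in> F" "b \<in> F" for a b
  proof
    assume E: "{a, b} \<in> E"
    then have "m a \<notin> N" "m b \<notin> N"
      using that spread[of a b] spread[of b a] by (auto simp: F_def insert_commute)
    then show False using that E covC by (auto simp: F_def vertex_cover_iff[OF simple])
  qed
  have FXY: "{a, b} \<notin> E" "{b, a} \<notin> E" if "a \<in> F" "b \<in> X \<union> Y" for a b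
  proof -
    have "a \<notin> nbhd E b" using that by (auto simp: F_def N_def X_def Y_def)
    then show "{a, b} \<notin> E" "{b, a} \<notin> E" by (auto simp: nbhd_def insert_commute)
  qed
  have XX: "{a, b} \<notin> E" if "a \<in> X \<and> b \<in> X \<or> a \<in> Y \<and> b \<in> Y" for a b
    using that duplicated_not_adjacent[of a b] by (auto simp: X_def Y_def)
  have "m v \<in> F \<union> X \<longleftrightarrow> v \<notin> F \<union> X" for v
  proof (cases "v \<in> X \<union> Y")
    case True
    then show ?thesis using mX[of v] mY[of v] XYd FN sub by auto
  next
    case False
    then show ?thesis using mX[of v] mY[of v] trans[of v] by auto
  qed
  then have "2 * card (F \<union> X) = card (UNIV :: 'v set)" by (rule card_transversal)
  moreover have "card (F \<union> X) = card F + card X" using FN sub by (intro card_Un_disjoint) auto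
  ultimately show thesis
    using FN sub trans FF FXY XX XY by (intro that[of F]) (blast, blast, metis UnE UnI1, metis UnE UnI2, blast, simp)
qed

text \<open>Duplicates can trade their partners. The old and the new matching alternate along the
  4-cycle through \<open>t\<close>, \<open>m t\<close>, \<open>t'\<close>,
  \<open>m t'\<close>.\<close>

lemma swapped_matching:
  assumes t: "t \<noteq> t'" "nbhd E t = nbhd E t'"
  defines "n \<equiv> m(t := m t', t' := m t, m t := t', m t' := t)"
  shows "{v, n v} \<in> E" "n (n v) = v" "n t \<noteq> m t"
proof -
  have a: "{t, m t'} \<in> E" "{t', m t} \<in> E"
    using medge[of t] medge[of t'] t(2) by (auto simp: nbhd_def)
  have d: "t \<noteq> m t'" "t' \<noteq> m t"
    using duplicated_not_adjacent[OF t(2)] medge[of t'] medge[of t] by (auto simp: insert_commute)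
  show "{v, n v} \<in> E" using a medge d t by (auto simp: n_def insert_commute)
  show "n t \<noteq> m t" using t d by (simp add: n_def)
  show "n (n v) = v"
  proof -
    have "m v \<noteq> t" if "v \<noteq> m t" using that by auto
    moreover have "m v \<noteq> t'" if "v \<noteq> m t'" using that by auto
    ultimately show ?thesis using t d by (auto simp: n_def)
  qed
qed

end

section \<open>Perfect matchings as involutions, and their (P) property\<close>

lemma perfect_matching_of_involution:
  assumes "\<And>v. {v, m v} \<in> E" "\<And>v. m (m v) = v"
  shows "perfect_matching E (range (\<lambda>v. {v, m v}))"
  unfolding perfect_matching_def matching_def
proof (intro conjI ballI impI)
  fix e f assume ef: "e \<in> range (\<lambda>v. {v, m v})" "f \<in> range (\<lambda>v. {v, m v})" "e \<noteq> f"
  have eq: "g = {z, m z}" if g: "g \<in> range (\<lambda>v. {v, m v})" "z \<in> g" for g z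
  proof -
    obtain v where "g = {v, m v}" using g(1) by auto
    then show ?thesis using g(2) assms(2)[of v] by auto
  qed
  show "e \<inter> f = {}"
  proof (rule ccontr)
    assume "e \<inter> f \<noteq> {}"
    then obtain z where z: "z \<in> e" "z \<in> f" by auto
    show False using eq[OF ef(1) z(1)] eq[OF ef(2) z(2)] ef(3) by simp
  qed
qed (use assms(1) in auto)

lemma involution_of_perfect_matching:
  assumes "simple_graph E" "perfect_matching E M"
  obtains m where "\<And>v. {v, m v} \<in> E" "\<And>v. m (m v) = v" "M = range (\<lambda>v. {v, m v})"
proof -
  have M: "M \<subseteq> E" "\<Union>M = UNIV"
    using assms(2) by (auto simp: perfect_matching_def matching_def)
  have d: "e = f" if "e \<in> M" "f \<in> M" "v \<in> e" "v \<in> f" for e f v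
    using assms(2) that unfolding perfect_matching_def matching_def by (metis disjoint_iff)
  have "\<exists>w. {v, w} \<in> M" for v
  proof -
    obtain e where e: "e \<in> M" "v \<in> e" using M(2) by blast
    then obtain a b where "e = {a, b}" using M(1) simple_graph_edgeE[OF assms(1)] by blast
    then show ?thesis using e by (auto simp: insert_commute)
  qed
  then obtain m where m: "\<And>v. {v, m v} \<in> M" by metis
  have edge: "{v, m v} \<in> E" for v using m M(1) by blast
  have "m (m v) = v" for v
  proof -
    have "{v, m v} = {m v, m (m v)}" using m d by blast
    moreover have "v \<noteq> m v" using edge[of v] simple_graph_no_loop[OF assms(1)] by auto
    ultimately show ?thesis by (auto simp: doubleton_eq_iff)
  qed
  moreover have "M = range (\<lambda>v. {v, m v})"
  proof
    show "M \<subseteq> range (\<lambda>v. {v, m v})"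
    proof
      fix e assume e: "e \<in> M"
      then obtain v where "v \<in> e" using M(1) simple_graph_edgeE[OF assms(1)] by blast
      then have "e = {v, m v}" using e m d by blast
      then show "e \<in> range (\<lambda>v. {v, m v})" by blast
    qed
  qed (use m in auto)
  ultimately show thesis using that edge by blast
qed

text \<open>A minimal cover has as many elements as the Koenig matching has edges, so it meets each of
  them once and is contained in their union; but every vertex lies in a minimal cover.\<close>

lemma Koenig_perfect_matching:
  fixes E :: "('v::finite) set set"
  assumes simple: "simple_graph E" and iso: "no_isolated_vertices E" and "unmixed E" "Koenig E"
  obtains M where "perfect_matching E M"
    and "\<And>C. min_vertex_cover E C \<Longrightarrow> 2 * card C = card (UNIV :: 'v set)"
proof -
  obtain M where M: "matching E M" "card M = alpha0 E"
    using \<open>Koenig E\<close> by (auto simp: Koenig_def)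
  have ME: "M \<subseteq> E" using M(1) by (simp add: matching_def)
  have d: "e = f" if "e \<in> M" "f \<in> M" "v \<in> e" "v \<in> f" for e f v
    using M(1) that unfolding matching_def by (metis disjoint_iff)
  have "vertex_cover E UNIV"
    using simple by (auto simp: vertex_cover_iff)
  then have "\<exists>n C. vertex_cover E C \<and> card C = n" by blast
  then have "\<exists>C. vertex_cover E C \<and> card C = alpha0 E"
    unfolding alpha0_def by (rule LeastI_ex)
  then obtain C0 where C0: "vertex_cover E C0" "card C0 = alpha0 E" by blast
  obtain C1 where C1: "C1 \<subseteq> C0" "min_vertex_cover E C1"
    using min_vertex_cover_subset[OF C0(1)] by blast
  have "alpha0 E \<le> card C1"
    unfolding alpha0_def using C1(2) by (intro Least_le) (auto simp: min_vertex_cover_def)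
  then have "card C1 = alpha0 E" using C0(2) card_mono[OF _ C1(1)] by simp
  then have size: "card C = card M" if "min_vertex_cover E C" for C
    using \<open>unmixed E\<close> that C1(2) M(2) unfolding unmixed_def by metis
  have sub: "C \<subseteq> \<Union>M" if C: "min_vertex_cover E C" for C
  proof -
    have "vertex_cover E C" using C by (simp add: min_vertex_cover_def)
    then have "\<forall>e\<in>M. \<exists>v. v \<in> e \<and> v \<in> C"
      using ME unfolding vertex_cover_def by blast
    then obtain h where h: "\<And>e. e \<in> M \<Longrightarrow> h e \<in> e \<and> h e \<in> C" by metis
    have "inj_on h M" using h d by (metis inj_onI)
    then have "card (h ` M) = card C" using size[OF C] by (simp add: card_image)
    then have "h ` M = C" using h by (intro card_subset_eq) auto
    then show ?thesis using h by auto
  qed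
  have "v \<in> \<Union>M" for v
  proof -
    obtain e where e: "e \<in> E" "v \<in> e" using iso by (auto simp: no_isolated_vertices_def)
    then obtain a b where "e = {a, b}" using simple_graph_edgeE[OF simple] by blast
    then obtain w where w: "{v, w} \<in> E" using e by (auto simp: insert_commute)
    obtain C where C: "min_vertex_cover E C" "w \<notin> C"
      using min_vertex_cover_avoiding[OF simple, of w w] simple_graph_no_loop[OF simple] by auto
    then have "v \<in> C" using w by (auto simp: min_vertex_cover_def vertex_cover_iff[OF simple])
    then show ?thesis using sub[OF C(1)] by blast
  qed
  then have U: "\<Union>M = UNIV" by blast
  have "card (\<Union>M) = (\<Sum>e\<in>M. card e)"
    using d by (intro card_Union_disjoint) (auto simp: pairwise_def disjnt_def)
  also have "\<dots> = 2 * card M"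
    using simple ME by (simp add: simple_graph_def subset_iff)
  finally have "2 * card M = card (UNIV :: 'v set)" using U by simp
  then show thesis using that[of M] size M(1) U by (simp add: perfect_matching_def)
qed

text \<open>If \<open>x'\<close> and \<open>y'\<close> were not adjacent, a minimal cover
  \<open>C\<close> avoiding both would contain \<open>x\<close> and \<open>m x\<close>. Then
  \<open>m\<close> maps the complement of \<open>C\<close> injectively into \<open>C\<close> without
  hitting \<open>x\<close>, so \<open>C\<close> has more than half of the vertices.\<close>

lemma P_matchingI:
  fixes E :: "('v::finite) set set"
  assumes simple: "simple_graph E"
    and size: "\<And>C. min_vertex_cover E C \<Longrightarrow> 2 * card C = card (UNIV :: 'v set)"
    and edge: "\<And>v. {v, m v} \<in> E" and inv: "\<And>v. m (m v) = v"
  shows "P_matching E m"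
proof
  fix x x' y' assume E: "{x, x'} \<in> E" "{m x, y'} \<in> E"
  show "{x', y'} \<in> E"
  proof (rule ccontr)
    assume "{x', y'} \<notin> E"
    then obtain C where C: "min_vertex_cover E C" "x' \<notin> C" "y' \<notin> C"
      using min_vertex_cover_avoiding[OF simple] by metis
    then have cov: "vertex_cover E C" by (simp add: min_vertex_cover_def)
    then have xC: "x \<in> C" "m x \<in> C" using C E by (auto simp: vertex_cover_iff[OF simple])
    have "m ` (- C) \<subseteq> C - {x}"
    proof
      fix w assume "w \<in> m ` (- C)"
      then obtain v where v: "w = m v" "v \<notin> C" by auto
      then have "w \<in> C" using edge[of v] cov by (auto simp: vertex_cover_iff[OF simple])
      moreover have "w \<noteq> x" using v xC inv by metis
      ultimately show "w \<in> C - {x}" by simp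
    qed
    then have "card (m ` (- C)) \<le> card (C - {x})" by (intro card_mono) auto
    moreover have "card (m ` (- C)) = card (- C)" using inv by (intro card_image) (metis inj_onI)
    moreover have "card (C - {x}) < card C" using xC by (intro psubset_card_mono) auto
    moreover have "card (C \<union> - C) = card C + card (- C)" by (intro card_Un_disjoint) auto
    ultimately show False using size[OF C(1)] by simp
  qed
qed (rule simple edge inv)+

text \<open>Every perfect matching has (P), so for two of them the partners of \<open>v\<close> have
  neighbourhoods contained in each other; without duplicates the partners agree.\<close>

lemma unique_perfect_matching_iff:
  fixes E :: "('v::finite) set set"
  assumes simple: "simple_graph E"
    and size: "\<And>C. min_vertex_cover E C \<Longrightarrow> 2 * card C = card (UNIV :: 'v set)"
    and M: "perfect_matching E M"
  shows "(\<exists>!M. perfect_matching E M) \<longleftrightarrow> \<not> has_duplicated_vertices E"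
proof
  assume uniq: "\<exists>!M. perfect_matching E M"
  obtain m where m: "\<And>v. {v, m v} \<in> E" "\<And>v. m (m v) = v" "M = range (\<lambda>v. {v, m v})"
    by (rule involution_of_perfect_matching[OF simple M]) blast
  interpret P_matching E m by (rule P_matchingI[OF simple size m(1,2)])
  show "\<not> has_duplicated_vertices E"
  proof
    assume "has_duplicated_vertices E"
    then obtain t t' where t: "t \<noteq> t'" "nbhd E t = nbhd E t'"
      by (auto simp: has_duplicated_vertices_def)
    define n where "n = m(t := m t', t' := m t, m t := t', m t' := t)"
    note n = swapped_matching[OF t, folded n_def]
    have "perfect_matching E (range (\<lambda>v. {v, n v}))"
      using n by (intro perfect_matching_of_involution)
    then have "range (\<lambda>v. {v, n v}) = range (\<lambda>v. {v, m v})" using uniq M m(3) by blast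
    then obtain v where "{t, n t} = {v, m v}" by blast
    then show False using n(3) by (auto simp: doubleton_eq_iff)
  qed
next
  assume nodup: "\<not> has_duplicated_vertices E"
  have "M1 = M2" if pm: "perfect_matching E M1" "perfect_matching E M2" for M1 M2
  proof -
    obtain m where m: "\<And>v. {v, m v} \<in> E" "\<And>v. m (m v) = v" "M1 = range (\<lambda>v. {v, m v})"
      by (rule involution_of_perfect_matching[OF simple pm(1)]) blast
    obtain n where n: "\<And>v. {v, n v} \<in> E" "\<And>v. n (n v) = v" "M2 = range (\<lambda>v. {v, n v})"
      by (rule involution_of_perfect_matching[OF simple pm(2)]) blast
    interpret m: P_matching E m by (rule P_matchingI[OF simple size m(1,2)])
    interpret n: P_matching E n by (rule P_matchingI[OF simple size n(1,2)])
    have "nbhd E (m v) = nbhd E (n v)" for v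
      using m.nbhd_mono[OF n(1)] n.nbhd_mono[OF m(1)] by blast
    then have "m v = n v" for v using nodup unfolding has_duplicated_vertices_def by blast
    then have "m = n" by (rule ext)
    then show ?thesis using m n by simp
  qed
  then show "\<exists>!M. perfect_matching E M" using M by blast
qed

text \<open>Duplicates and their partners span an induced 4-cycle whose edges belong alternately to
  the given matching and to the swapped one. Both are perfect matchings, so all four edges have
  (P).\<close>

lemma C4_condition_iff:
  fixes E :: "('v::finite) set set"
  assumes simple: "simple_graph E"
    and size: "\<And>C. min_vertex_cover E C \<Longrightarrow> 2 * card C = card (UNIV :: 'v set)"
    and M: "perfect_matching E M"
  shows "C4_condition E \<longleftrightarrow> \<not> has_duplicated_vertices E"
proof
  assume C4: "C4_condition E"
  obtain m where m: "\<And>v. {v, m v} \<in> E" "\<And>v. m (m v) = v" "M = range (\<lambda>v. {v, m v})"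
    by (rule involution_of_perfect_matching[OF simple M]) blast
  interpret P_matching E m by (rule P_matchingI[OF simple size m(1,2)])
  show "\<not> has_duplicated_vertices E"
  proof
    assume "has_duplicated_vertices E"
    then obtain t t' where t: "t \<noteq> t'" "nbhd E t = nbhd E t'"
      by (auto simp: has_duplicated_vertices_def)
    define n where "n = m(t := m t', t' := m t, m t := t', m t' := t)"
    note n = swapped_matching[OF t, folded n_def]
    interpret n: P_matching E n by (rule P_matchingI[OF simple size n(1,2)])
    have nadj: "{t, t'} \<notin> E" "{m t, m t'} \<notin> E"
      using duplicated_not_adjacent t(2) duplicated_m[OF t(2)] by blast+
    have d: "t \<noteq> m t'" "t' \<noteq> m t"
      using nadj medge[of t'] medge[of t] by (auto simp: insert_commute)
    have nv: "n t = m t'" "n (m t) = t'" "n t' = m t" "n (m t') = t"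
      using t d by (auto simp: n_def)
    have "induced_C4 E t (m t) t' (m t')"
      using t d nadj n(1)[of t'] n(1)[of t] medge[of t] medge[of t']
      by (auto simp: induced_C4_def nv insert_commute)
    moreover have "P_property E t (m t)" "P_property E (m t) t'" "P_property E t' (m t')"
      "P_property E (m t') t"
      using P_property_m n.P_property_m[of "m t"] n.P_property_m[of "m t'"] nv by auto
    ultimately show False using C4 by (auto simp: C4_condition_def)
  qed
qed (use duplicated_if_C4[OF simple] in blast)

section \<open>Polynomials and monomial ideals\<close>

abbreviation lookup :: "('a \<Rightarrow>\<^sub>0 'b::zero) \<Rightarrow> 'a \<Rightarrow> 'b" where
  "lookup \<equiv> Poly_Mapping.lookup"

abbreviation keys :: "('a \<Rightarrow>\<^sub>0 'b::zero) \<Rightarrow> 'a set" where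
  "keys \<equiv> Poly_Mapping.keys"

abbreviation single :: "'a \<Rightarrow> 'b \<Rightarrow> ('a \<Rightarrow>\<^sub>0 'b::zero)" where
  "single \<equiv> Poly_Mapping.single"

lemma poly_eq_sum_single: "p = (\<Sum>m\<in>keys p. single m (lookup p m))"
proof (rule poly_mapping_eqI)
  fix k
  have "lookup (\<Sum>m\<in>keys p. single m (lookup p m)) k
      = (\<Sum>m\<in>keys p. if m = k then lookup p m else 0)"
    by (simp add: lookup_sum lookup_single when_def)
  also have "\<dots> = lookup p k" by (simp add: in_keys_iff)
  finally show "lookup p k = lookup (\<Sum>m\<in>keys p. single m (lookup p m)) k" ..
qed

lemma poly_induct [case_names zero single add]:
  fixes p :: "'a \<Rightarrow>\<^sub>0 'b::comm_monoid_add"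
  assumes "Q 0" "\<And>m c. Q (single m c)" "\<And>p q. Q p \<Longrightarrow> Q q \<Longrightarrow> Q (p + q)"
  shows "Q p"
proof -
  have "Q (\<Sum>m\<in>A. single m (lookup p m))" if "finite A" for A
    using that by (induction A rule: finite_induct) (auto intro: assms)
  from this[of "keys p"] show ?thesis using poly_eq_sum_single[of p] by simp
qed

lemma expt_induct [case_names zero step]:
  fixes m :: "'a \<Rightarrow>\<^sub>0 nat"
  assumes "Q 0" "\<And>v m. Q m \<Longrightarrow> Q (single v 1 + m)"
  shows "Q m"
proof -
  have "Q q \<longrightarrow> Q (p + q)" for p q :: "'a \<Rightarrow>\<^sub>0 nat"
  proof (induction p arbitrary: q rule: poly_induct)
    case (single v n)
    show ?case
    proof (induction n)
      case (Suc k)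
      have "single v (Suc k) + q = single v 1 + (single v k + q)"
        by (simp add: add.assoc[symmetric] flip: single_add)
      then show ?case using Suc assms(2)[of "single v k + q" v] by simp
    qed simp
  next
    case (add p1 p2)
    then show ?case by (simp add: add.assoc)
  qed simp
  from this[of 0 m] show ?thesis using assms(1) by simp
qed

lemma lookup_mult_keys:
  fixes p q :: "'a::comm_monoid_add \<Rightarrow>\<^sub>0 'b::comm_semiring_0"
  shows "lookup (p * q) k
    = (\<Sum>m\<in>keys p. \<Sum>n\<in>keys q. if m + n = k then lookup p m * lookup q n else 0)"
proof -
  have "p * q = (\<Sum>m\<in>keys p. \<Sum>n\<in>keys q. single m (lookup p m) * single n (lookup q n))"
    by (subst (1) poly_eq_sum_single[of p], subst (1) poly_eq_sum_single[of q])
      (simp add: sum_product)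
  then show ?thesis
    by (simp add: lookup_sum mult_single lookup_single when_def cong: if_cong)
qed

lemma lookup_single_mult:
  fixes p :: "'a::cancel_comm_monoid_add \<Rightarrow>\<^sub>0 'b::comm_semiring_0"
  shows "lookup (single a c * p) (a + n) = c * lookup p n"
proof (cases "c = 0")
  case False
  have "lookup (single a c * p) (a + n) = (\<Sum>m\<in>keys p. if m = n then c * lookup p m else 0)"
    using False by (simp add: lookup_mult_keys cong: if_cong)
  then show ?thesis by (auto simp: in_keys_iff)
qed simp

lemma lookup_single_mult_0:
  fixes p :: "'a::comm_monoid_add \<Rightarrow>\<^sub>0 'b::comm_semiring_0"
  assumes "\<And>m. a + m \<noteq> n"
  shows "lookup (single a c * p) n = 0"
  using assms by (auto simp: lookup_mult_keys intro!: sum.neutral)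

lemma lookup_const_mult:
  fixes p :: "'a::cancel_comm_monoid_add \<Rightarrow>\<^sub>0 'b::comm_semiring_0"
  shows "lookup (single 0 c * p) n = c * lookup p n"
  using lookup_single_mult[of 0 c p n] by simp

lemma ideal_zero: "is_ideal J \<Longrightarrow> 0 \<in> J"
  and ideal_add: "is_ideal J \<Longrightarrow> a \<in> J \<Longrightarrow> b \<in> J \<Longrightarrow> a + b \<in> J"
  and ideal_mult: "is_ideal J \<Longrightarrow> a \<in> J \<Longrightarrow> r * a \<in> J"
  by (auto simp: is_ideal_def)

lemma ideal_mult_right: "is_ideal J \<Longrightarrow> a \<in> J \<Longrightarrow> a * r \<in> J"
  using ideal_mult by (metis mult.commute)

lemma ideal_uminus: "is_ideal J \<Longrightarrow> a \<in> J \<Longrightarrow> - a \<in> J"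
  using ideal_mult[of J a "- 1"] by simp

lemma ideal_diff: "is_ideal J \<Longrightarrow> a \<in> J \<Longrightarrow> b \<in> J \<Longrightarrow> a - b \<in> J"
  using ideal_add[of J a "- b"] ideal_uminus[of J b] by simp

lemma ideal_sum: "is_ideal J \<Longrightarrow> (\<And>x. x \<in> A \<Longrightarrow> f x \<in> J) \<Longrightarrow> sum f A \<in> J"
  by (induction A rule: infinite_finite_induct) (auto intro: ideal_zero ideal_add)

lemma ideal_gen_least:
  assumes "is_ideal J" "A \<subseteq> J"
  shows "ideal_gen A \<subseteq> J"
  using assms by (auto simp: ideal_gen_def intro!: ideal_sum ideal_mult)

lemma ideal_gen_superset: "A \<subseteq> ideal_gen A"
proof
  fix a assume "a \<in> A"
  then have "finite {a} \<and> {a} \<subseteq> A \<and> a = (\<Sum>b\<in>{a}. 1 * b)" by simp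
  then show "a \<in> ideal_gen A"
    unfolding ideal_gen_def by (intro CollectI exI[of _ "{a}"] exI[of _ "\<lambda>_. 1"])
qed

lemma is_ideal_ideal_gen: "is_ideal (ideal_gen A)"
  unfolding is_ideal_def
proof (intro conjI ballI allI)
  show "0 \<in> ideal_gen A" unfolding ideal_gen_def by (intro CollectI exI[of _ "{}"]) simp
next
  fix a b assume "a \<in> ideal_gen A" "b \<in> ideal_gen A"
  then obtain F c G d where F: "finite F" "F \<subseteq> A" "a = (\<Sum>x\<in>F. c x * x)"
    and G: "finite G" "G \<subseteq> A" "b = (\<Sum>x\<in>G. d x * x)"
    unfolding ideal_gen_def by blast
  have "a = (\<Sum>x\<in>F \<union> G. (if x \<in> F then c x else 0) * x)"
    unfolding F(3) using F G by (intro sum.mono_neutral_cong_left) auto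
  moreover have "b = (\<Sum>x\<in>F \<union> G. (if x \<in> G then d x else 0) * x)"
    unfolding G(3) using F G by (intro sum.mono_neutral_cong_left) auto
  ultimately have "a + b
      = (\<Sum>x\<in>F \<union> G. ((if x \<in> F then c x else 0) + (if x \<in> G then d x else 0)) * x)"
    by (simp only: distrib_right sum.distrib)
  moreover have "finite (F \<union> G)" "F \<union> G \<subseteq> A" using F G by auto
  ultimately show "a + b \<in> ideal_gen A" unfolding ideal_gen_def
    by (intro CollectI exI[of _ "F \<union> G"] exI conjI)
next
  fix a r assume "a \<in> ideal_gen A"
  then obtain F c where F: "finite F" "F \<subseteq> A" "a = (\<Sum>x\<in>F. c x * x)"
    unfolding ideal_gen_def by blast
  then have "r * a = (\<Sum>x\<in>F. (r * c x) * x)" by (simp add: sum_distrib_left mult.assoc)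
  then show "r * a \<in> ideal_gen A" unfolding ideal_gen_def using F(1,2)
    by (intro CollectI exI[of _ F] exI conjI)
qed

lemma ideal_gen_mono: "A \<subseteq> B \<Longrightarrow> ideal_gen A \<subseteq> ideal_gen B"
  using ideal_gen_least[OF is_ideal_ideal_gen] ideal_gen_superset by (metis subset_trans)

lemma ideal_gen_of_ideal: "is_ideal J \<Longrightarrow> ideal_gen J = J"
  using ideal_gen_least[of J J] ideal_gen_superset[of J] by auto

lemma in_ideal_gen: "a \<in> A \<Longrightarrow> a \<in> ideal_gen A"
  using ideal_gen_superset by blast

lemma ideal_gen_Un_ideal_gen: "ideal_gen (ideal_gen A \<union> B) = ideal_gen (A \<union> B)"
proof
  show "ideal_gen (ideal_gen A \<union> B) \<subseteq> ideal_gen (A \<union> B)"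
    using ideal_gen_mono[of A "A \<union> B"] ideal_gen_superset[of "A \<union> B"]
    by (intro ideal_gen_least is_ideal_ideal_gen) auto
  show "ideal_gen (A \<union> B) \<subseteq> ideal_gen (ideal_gen A \<union> B)"
    using ideal_gen_superset[of A] by (intro ideal_gen_mono) auto
qed

lemma ideal_gen_insert:
  assumes "is_ideal J" "p \<in> ideal_gen (insert f J)"
  obtains r j where "p = r * f + j" "j \<in> J"
proof -
  have "is_ideal {p. \<exists>r. \<exists>j\<in>J. p = r * f + j}"
    unfolding is_ideal_def
  proof (intro conjI ballI allI)
    show "0 \<in> {p. \<exists>r. \<exists>j\<in>J. p = r * f + j}"
      using ideal_zero[OF assms(1)] by (auto intro!: exI[of _ 0] bexI[of _ 0])
  next
    fix a b assume "a \<in> {p. \<exists>r. \<exists>j\<in>J. p = r * f + j}" "b \<in> {p. \<exists>r. \<exists>j\<in>J. p = r * f + j}"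
    then obtain r j s k where "a = r * f + j" "j \<in> J" "b = s * f + k" "k \<in> J" by blast
    then have "a + b = (r + s) * f + (j + k)" "j + k \<in> J"
      using ideal_add[OF assms(1)] by (auto simp: algebra_simps)
    then show "a + b \<in> {p. \<exists>r. \<exists>j\<in>J. p = r * f + j}" by blast
  next
    fix a q assume "a \<in> {p. \<exists>r. \<exists>j\<in>J. p = r * f + j}"
    then obtain r j where "a = r * f + j" "j \<in> J" by blast
    then have "q * a = (q * r) * f + q * j" "q * j \<in> J"
      using ideal_mult[OF assms(1)] by (auto simp: algebra_simps)
    then show "q * a \<in> {p. \<exists>r. \<exists>j\<in>J. p = r * f + j}" by blast
  qed
  moreover have "insert f J \<subseteq> {p. \<exists>r. \<exists>j\<in>J. p = r * f + j}"
    using ideal_zero[OF assms(1)] by (auto intro: exI[of _ 1] exI[of _ 0])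
  ultimately show thesis using ideal_gen_least assms(2) that by blast
qed

text \<open>Exponent sets of monomial ideals. Membership in such an ideal is a condition on
  \<open>keys\<close>, tested term by term, and coefficients at exponents outside the set are
  invariants modulo the ideal.\<close>

definition upclosed :: "('v \<Rightarrow>\<^sub>0 nat) set \<Rightarrow> bool" where
  "upclosed U \<longleftrightarrow> (\<forall>m\<in>U. \<forall>n. n + m \<in> U)"

lemma is_ideal_upclosed:
  assumes "upclosed U"
  shows "is_ideal {p :: ('v, 'k::field) mpoly. keys p \<subseteq> U}"
  unfolding is_ideal_def
proof (intro conjI ballI allI)
  fix a b :: "('v, 'k) mpoly" assume "a \<in> {p. keys p \<subseteq> U}" "b \<in> {p. keys p \<subseteq> U}"
  then show "a + b \<in> {p. keys p \<subseteq> U}" using Poly_Mapping.keys_add[of a b] by blast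
next
  fix a r :: "('v, 'k) mpoly" assume a: "a \<in> {p. keys p \<subseteq> U}"
  have "keys (r * a) \<subseteq> {m + n |m n. m \<in> keys r \<and> n \<in> keys a}" by (rule keys_mult)
  then show "r * a \<in> {p. keys p \<subseteq> U}" using a assms by (fastforce simp: upclosed_def)
qed simp

definition expt :: "'v set \<Rightarrow> 'v \<Rightarrow>\<^sub>0 nat" where
  "expt C = (\<Sum>v\<in>C. single v 1)"

lemma lookup_expt: "finite C \<Longrightarrow> lookup (expt C) v = (if v \<in> C then 1 else 0)"
  by (simp add: expt_def lookup_sum lookup_single when_def)

lemma keys_expt: "finite C \<Longrightarrow> keys (expt C) = C"
  by (auto simp: in_keys_iff lookup_expt split: if_splits)

lemma monom_of_eq: "finite C \<Longrightarrow> monom_of C = single (expt C) 1"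
  by (induction C rule: finite_induct) (simp_all add: monom_of_def expt_def var_def mult_single)

lemma expt_decomp:
  assumes "finite C" "C \<subseteq> keys m"
  shows "expt C + (m - expt C) = m"
proof (rule poly_mapping_eqI)
  fix v
  have "1 \<le> lookup m v" if "v \<in> C"
    using that assms(2) by (metis in_keys_iff less_one not_le subsetD)
  then show "lookup (expt C + (m - expt C)) v = lookup m v"
    using assms(1) by (auto simp: lookup_add lookup_minus lookup_expt)
qed

lemma keys_plus_nat: "keys (m + n) = keys m \<union> keys n" for m n :: "'v \<Rightarrow>\<^sub>0 nat"
  by (auto simp: in_keys_iff lookup_add)

text \<open>Exponents whose support is not a face of the independence complex; the edge ideal is the
  Stanley-Reisner ideal of this complex.\<close>

definition nonface :: "'v set set \<Rightarrow> ('v \<Rightarrow>\<^sub>0 nat) set" where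
  "nonface E = {m. \<exists>e\<in>E. e \<subseteq> keys m}"

lemma upclosed_nonface: "upclosed (nonface E)"
  by (auto simp: upclosed_def nonface_def keys_plus_nat)

lemma single_in_ideal:
  assumes "is_ideal J" "single m 1 \<in> J"
  shows "single (n + m) c \<in> J"
  using ideal_mult[OF assms, of "single n c"] by (simp add: mult_single)

lemma poly_in_ideal:
  assumes "is_ideal J" "\<And>m. m \<in> keys p \<Longrightarrow> single m (lookup p m) \<in> J"
  shows "p \<in> J"
  by (subst poly_eq_sum_single) (rule ideal_sum[OF assms])

lemma in_edge_ideal_iff:
  fixes p :: "('v::finite, 'k::field) mpoly"
  shows "p \<in> edge_ideal E \<longleftrightarrow> keys p \<subseteq> nonface E"
proof
  have "{monom_of e | e. e \<in> E} \<subseteq> {p :: ('v, 'k) mpoly. keys p \<subseteq> nonface E}"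
  proof clarify
    fix e m assume "e \<in> E" "m \<in> keys (monom_of e :: ('v, 'k) mpoly)"
    then have "e \<in> E" "e \<subseteq> keys m" by (simp_all add: monom_of_eq keys_expt)
    then show "m \<in> nonface E" unfolding nonface_def by blast
  qed
  then show "p \<in> edge_ideal E \<Longrightarrow> keys p \<subseteq> nonface E"
    using ideal_gen_least[OF is_ideal_upclosed[OF upclosed_nonface]] unfolding edge_ideal_def by blast
next
  assume sub: "keys p \<subseteq> nonface E"
  have id: "is_ideal (edge_ideal E :: ('v, 'k) mpoly set)"
    unfolding edge_ideal_def by (rule is_ideal_ideal_gen)
  show "p \<in> edge_ideal E"
  proof (rule poly_in_ideal[OF id])
    fix m assume "m \<in> keys p"
    then obtain e where e: "e \<in> E" "e \<subseteq> keys m" using sub by (auto simp: nonface_def)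
    have "monom_of e \<in> (edge_ideal E :: ('v, 'k) mpoly set)"
      unfolding edge_ideal_def using e by (intro in_ideal_gen) blast
    then have "single (expt e) 1 \<in> (edge_ideal E :: ('v, 'k) mpoly set)" by (simp add: monom_of_eq)
    then have "single ((m - expt e) + expt e) (lookup p m) \<in> edge_ideal E"
      by (rule single_in_ideal[OF id])
    moreover have "(m - expt e) + expt e = m"
      using expt_decomp[OF _ e(2)] by (simp add: add.commute)
    ultimately show "single m (lookup p m) \<in> edge_ideal E" by simp
  qed
qed

lemma is_ideal_edge_ideal: "is_ideal (edge_ideal E)"
  unfolding edge_ideal_def by (rule is_ideal_ideal_gen)

lemma one_notin_max_ideal: "1 \<notin> (max_ideal :: ('v, 'k::field) mpoly set)"
proof
  have "range var \<subseteq> {p :: ('v, 'k) mpoly. keys p \<subseteq> - {0}}"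
    by (auto simp: var_def) (metis lookup_single_eq lookup_zero nat.distinct(1))
  moreover have "upclosed (- {0 :: 'v \<Rightarrow>\<^sub>0 nat})"
    by (auto simp: upclosed_def poly_mapping_eq_iff fun_eq_iff lookup_add) blast
  ultimately have "max_ideal \<subseteq> {p :: ('v, 'k) mpoly. keys p \<subseteq> - {0}}"
    unfolding max_ideal_def by (intro ideal_gen_least is_ideal_upclosed)
  moreover assume "1 \<in> (max_ideal :: ('v, 'k) mpoly set)"
  ultimately show False by auto
qed

section \<open>Koszul cohomology\<close>

text \<open>The terms for \<open>(v, w)\<close> and \<open>(w, v)\<close> cancel in pairs.
  Concluding from S = - S would fail in characteristic 2.\<close>

lemma antisymmetric_sum_zero:
  fixes h :: "'a \<Rightarrow> 'a \<Rightarrow> 'b::comm_ring_1"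
  assumes "finite A" "\<And>v w. v \<in> A \<Longrightarrow> w \<in> A \<Longrightarrow> v \<noteq> w \<Longrightarrow> h v w = - h w v"
  shows "(\<Sum>v\<in>A. \<Sum>w\<in>A - {v}. h v w) = 0"
  using assms
proof (induction A rule: finite_induct)
  case (insert x A)
  have "insert x A - {v} = insert x (A - {v})" if "v \<in> A" for v using that insert.hyps by auto
  then have "(\<Sum>v\<in>A. \<Sum>w\<in>insert x A - {v}. h v w) = (\<Sum>v\<in>A. h v x + (\<Sum>w\<in>A - {v}. h v w))"
    using insert.hyps by (intro sum.cong) auto
  moreover have "(\<Sum>w\<in>insert x A - {x}. h x w) = (\<Sum>w\<in>A. - h w x)"
  proof (intro sum.cong)
    show "h x w = - h w x" if "w \<in> A" for w
      using insert.prems[of x w] insert.hyps that by auto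
  qed (use insert.hyps in auto)
  moreover have "(\<Sum>v\<in>A. \<Sum>w\<in>A - {v}. h v w) = 0"
    using insert.IH insert.prems by blast
  ultimately show ?case
    using insert.hyps by (simp add: sum.distrib sum_negf)
qed simp

text \<open>Cochains of the Koszul complex of \<open>q\<close> are functions on sets of vertices; the injection \<open>ord\<close>
  only serves to fix the signs.\<close>

locale koszul =
  fixes ord :: "'v::finite \<Rightarrow> nat" and q :: "'v \<Rightarrow> ('v, 'k::field) mpoly"
  assumes inj: "inj ord"
begin

definition sg :: "'v \<Rightarrow> 'v set \<Rightarrow> ('v, 'k) mpoly" where
  "sg v A = (- 1) ^ card {u \<in> A. ord u < ord v}"

definition d :: "('v set \<Rightarrow> ('v, 'k) mpoly) \<Rightarrow> 'v set \<Rightarrow> ('v, 'k) mpoly" where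
  "d \<omega> A = (\<Sum>v\<in>A. sg v A * q v * \<omega> (A - {v}))"

text \<open>Contraction with the basis vector dual to \<open>v\<close>, in the exterior algebra on
  the vertices; \<open>d\<close> is exterior multiplication by the element with coordinates
  \<open>q v\<close>. All degrees are stored in one function.\<close>

definition contr :: "'v \<Rightarrow> ('v set \<Rightarrow> ('v, 'k) mpoly) \<Rightarrow> 'v set \<Rightarrow> ('v, 'k) mpoly" where
  "contr v \<omega> A = (if v \<in> A then 0 else sg v A * \<omega> (insert v A))"

lemma sg_sq [simp]: "sg v A * sg v A = 1"
  by (simp add: sg_def flip: power_add mult_2)

lemma sg_insert_self [simp]: "sg v (insert v A) = sg v A"
proof -
  have "{u \<in> insert v A. ord u < ord v} = {u \<in> A. ord u < ord v}" by auto
  then show ?thesis by (simp add: sg_def)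
qed

lemma sg_insert:
  assumes "w \<notin> A"
  shows "sg v (insert w A) = (if ord w < ord v then - sg v A else sg v A)"
proof -
  have "{u \<in> insert w A. ord u < ord v}
      = (if ord w < ord v then insert w {u \<in> A. ord u < ord v} else {u \<in> A. ord u < ord v})"
    by auto
  then show ?thesis using assms by (simp add: sg_def)
qed

lemma sg_swap:
  assumes "v \<noteq> w" "v \<notin> B" "w \<notin> B"
  shows "sg v (insert w B) * sg w B = - (sg w (insert v B) * sg v B)"
proof -
  have "ord v \<noteq> ord w" using assms(1) inj by (auto dest: injD)
  then show ?thesis using assms by (cases "ord v < ord w") (auto simp: sg_insert)
qed

lemma d_d: "d (d \<omega>) A = 0"
proof -
  define h where "h v w = sg v A * q v * (sg w (A - {v}) * q w * \<omega> (A - {v} - {w}))" for v w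
  have "d (d \<omega>) A = (\<Sum>v\<in>A. \<Sum>w\<in>A - {v}. h v w)"
    by (simp add: d_def h_def sum_distrib_left)
  also have "\<dots> = 0"
  proof (rule antisymmetric_sum_zero)
    fix v w assume vw: "v \<in> A" "w \<in> A" "v \<noteq> w"
    define B where "B = A - {v} - {w}"
    have B: "v \<notin> B" "w \<notin> B" "A - {v} - {w} = B" "A - {w} - {v} = B"
      "A - {v} = insert w B" "A - {w} = insert v B" "A = insert v (insert w B)"
      using vw by (auto simp: B_def)
    have A: "sg v A = sg v (insert w B)" unfolding B(7) by simp
    have A': "sg w A = sg w (insert v B)" unfolding B(7) insert_commute[of v w] by simp
    have "h v w = (sg v (insert w B) * sg w B) * (q v * q w * \<omega> B)"
      unfolding h_def B(3) unfolding A unfolding B(5) by (simp add: algebra_simps)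
    also have "\<dots> = - ((sg w (insert v B) * sg v B) * (q v * q w * \<omega> B))"
      unfolding sg_swap[OF vw(3) B(1,2)] by simp
    also have "\<dots> = - h w v"
      unfolding h_def B(4) unfolding A' unfolding B(6) by (simp add: algebra_simps)
    finally show "h v w = - h w v" .
  qed simp
  finally show ?thesis .
qed

text \<open>The homotopy formula: contraction by \<open>v\<close> makes \<open>q v\<close> act as
  zero on Koszul cohomology.\<close>

lemma d_contr: "d (contr v \<omega>) A + contr v (d \<omega>) A = q v * \<omega> A"
proof (cases "v \<in> A")
  case True
  have "d (contr v \<omega>) A = (\<Sum>w\<in>A. if w = v then q v * \<omega> A else 0)"
    unfolding d_def
  proof (intro sum.cong refl)
    fix w assume "w \<in> A"
    have "sg v A * q v * (sg v (A - {v}) * \<omega> A) = q v * \<omega> A"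
      using sg_insert_self[of v "A - {v}"] True sg_sq[of v A]
      by (simp add: insert_absorb algebra_simps)
    then show "sg w A * q w * contr v \<omega> (A - {w}) = (if w = v then q v * \<omega> A else 0)"
      using True by (auto simp: contr_def insert_absorb)
  qed
  then show ?thesis using True by (simp add: contr_def)
next
  case False
  have "contr v (d \<omega>) A = sg v A * (sg v A * q v * \<omega> A
      + (\<Sum>w\<in>A. sg w (insert v A) * q w * \<omega> (insert v A - {w})))"
    using False by (simp add: contr_def d_def)
  also have "\<dots> = q v * \<omega> A + (\<Sum>w\<in>A. sg v A * sg w (insert v A) * q w * \<omega> (insert v A - {w}))"
    using sg_sq[of v A]
    by (simp add: distrib_left sum_distrib_left mult.assoc[symmetric])
  also have "(\<Sum>w\<in>A. sg v A * sg w (insert v A) * q w * \<omega> (insert v A - {w})) = - d (contr v \<omega>) A"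
    unfolding d_def sum_negf[symmetric]
  proof (intro sum.cong refl)
    fix w assume w: "w \<in> A"
    define B where "B = A - {w}"
    have B: "v \<notin> B" "w \<notin> B" "v \<noteq> w" "A = insert w B" "insert v A - {w} = insert v B"
      using w False by (auto simp: B_def)
    have "sg w (insert v A) = sg w (insert v B)"
      unfolding B(4) insert_commute[of v w] by simp
    moreover have "sg w B = sg w A" unfolding B(4) by simp
    ultimately have "sg v A * sg w (insert v A) = - (sg w A * sg v B)"
    proof -
      \<comment> \<open>Signs are their own inverses, so it suffices to see that this product of
        signs is - 1, which comes from \<open>sg_swap\<close>.\<close>
      have "sg v A * sg w (insert v A) * (sg w A * sg v B)
          = (sg v (insert w B) * sg w B) * (sg w (insert v B) * sg v B)"
        using \<open>sg w B = sg w A\<close> \<open>sg w (insert v A) = _\<close> unfolding B(4) by (simp add: algebra_simps)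
      also have "\<dots> = - ((sg w (insert v B) * sg v B) * (sg w (insert v B) * sg v B))"
        unfolding sg_swap[OF B(3,1,2)] by simp
      also have "\<dots> = - ((sg w (insert v B) * sg w (insert v B)) * (sg v B * sg v B))"
        by (simp only: mult.assoc mult.left_commute)
      also have "\<dots> = - 1" by simp
      finally have "sg v A * sg w (insert v A) * (sg w A * sg v B) = - 1" .
      then have "sg v A * sg w (insert v A) * (sg w A * sg v B) * (sg w A * sg v B)
          = - (sg w A * sg v B)" by simp
      moreover have "sg v A * sg w (insert v A) * (sg w A * sg v B) * (sg w A * sg v B)
          = sg v A * sg w (insert v A) * ((sg w A * sg w A) * (sg v B * sg v B))"
        by (simp only: mult.assoc mult.left_commute)
      ultimately show ?thesis by simp
    qed
    then show "sg v A * sg w (insert v A) * q w * \<omega> (insert v A - {w})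
        = - (sg w A * q w * contr v \<omega> (A - {w}))"
      using B by (simp add: contr_def B_def[symmetric] algebra_simps)
  qed
  finally show ?thesis by simp
qed

lemma d_mult: "d (\<lambda>A. f * \<omega> A) A = f * d \<omega> A"
  by (simp add: d_def sum_distrib_left algebra_simps)

lemma d_add: "d (\<lambda>A. \<omega> A + \<eta> A) A = d \<omega> A + d \<eta> A"
  by (simp add: d_def sum.distrib algebra_simps)

lemma d_sum: "d (\<lambda>A. \<Sum>x\<in>S. \<omega> x A) A = (\<Sum>x\<in>S. d (\<omega> x) A)"
  unfolding d_def by (simp add: sum_distrib_left) (rule sum.swap)

lemma d_cong:
  assumes "\<And>v. v \<in> A \<Longrightarrow> \<omega> (A - {v}) = \<eta> (A - {v})"
  shows "d \<omega> A = d \<eta> A"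
  using assms by (simp add: d_def)

lemma d_in_ideal:
  assumes "is_ideal J" "\<And>v. v \<in> A \<Longrightarrow> \<omega> (A - {v}) \<in> J"
  shows "d \<omega> A \<in> J"
  unfolding d_def using assms by (intro ideal_sum ideal_mult) auto

lemma d_empty [simp]: "d \<omega> {} = 0"
  by (simp add: d_def)

text \<open>Cohomology with coefficients in S/J is expressed by congruences modulo \<open>J\<close>
  between polynomial cochains, so no quotient ring is formed. In degree 0 a coboundary is just a
  value in \<open>J\<close>, since \<open>d\<close> vanishes on the empty set.\<close>

definition cocycle :: "('v, 'k) mpoly set \<Rightarrow> nat \<Rightarrow> ('v set \<Rightarrow> ('v, 'k) mpoly) \<Rightarrow> bool" where
  "cocycle J i \<omega> \<longleftrightarrow> (\<forall>A. card A = Suc i \<longrightarrow> d \<omega> A \<in> J)"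

definition coboundary :: "('v, 'k) mpoly set \<Rightarrow> nat \<Rightarrow> ('v set \<Rightarrow> ('v, 'k) mpoly) \<Rightarrow> bool" where
  "coboundary J i \<omega> \<longleftrightarrow> (\<exists>\<eta>. \<forall>A. card A = i \<longrightarrow> \<omega> A - d \<eta> A \<in> J)"

lemma ideal_gen_range_q:
  assumes "p \<in> ideal_gen (range q)"
  obtains c where "p = (\<Sum>v\<in>UNIV. c v * q v)"
proof -
  have "is_ideal {p. \<exists>c. p = (\<Sum>v\<in>UNIV. c v * q v)}"
    unfolding is_ideal_def
  proof (intro conjI ballI allI)
    show "0 \<in> {p. \<exists>c. p = (\<Sum>v\<in>UNIV. c v * q v)}" by (auto intro: exI[of _ "\<lambda>_. 0"])
  next
    fix a b assume "a \<in> {p. \<exists>c. p = (\<Sum>v\<in>UNIV. c v * q v)}" "b \<in> {p. \<exists>c. p = (\<Sum>v\<in>UNIV. c v * q v)}"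
    then obtain c e where "a = (\<Sum>v\<in>UNIV. c v * q v)" "b = (\<Sum>v\<in>UNIV. e v * q v)" by blast
    then have "a + b = (\<Sum>v\<in>UNIV. (c v + e v) * q v)" by (simp add: distrib_right sum.distrib)
    then show "a + b \<in> {p. \<exists>c. p = (\<Sum>v\<in>UNIV. c v * q v)}" by (auto intro: exI[of _ "\<lambda>v. c v + e v"])
  next
    fix a r assume "a \<in> {p. \<exists>c. p = (\<Sum>v\<in>UNIV. c v * q v)}"
    then obtain c where "a = (\<Sum>v\<in>UNIV. c v * q v)" by blast
    then have "r * a = (\<Sum>v\<in>UNIV. (r * c v) * q v)" by (simp add: sum_distrib_left mult.assoc)
    then show "r * a \<in> {p. \<exists>c. p = (\<Sum>v\<in>UNIV. c v * q v)}" by (auto intro: exI[of _ "\<lambda>v. r * c v"])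
  qed
  moreover have "range q \<subseteq> {p. \<exists>c. p = (\<Sum>v\<in>UNIV. c v * q v)}"
  proof clarify
    fix x
    have "(\<Sum>v\<in>UNIV. (if v = x then 1 else 0) * q v) = (\<Sum>v\<in>UNIV. if v = x then q v else 0)"
      by (intro sum.cong) auto
    then have "q x = (\<Sum>v\<in>UNIV. (if v = x then 1 else 0) * q v)" by simp
    then show "\<exists>c. q x = (\<Sum>v\<in>UNIV. c v * q v)" by (intro exI[of _ "\<lambda>v. if v = x then 1 else 0"])
  qed
  ultimately have "ideal_gen (range q) \<subseteq> {p. \<exists>c. p = (\<Sum>v\<in>UNIV. c v * q v)}" by (rule ideal_gen_least)
  then show thesis using assms that by blast
qed

text \<open>Writing \<open>p\<close> as a combination of the \<open>q v\<close>, the same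
  combination of contractions is a homotopy for multiplication by \<open>p\<close>; on a cocycle the
  terms \<open>contr v (d \<omega>)\<close> fall into \<open>J\<close>.\<close>

lemma coboundary_multiple:
  assumes J: "is_ideal J" and p: "p \<in> ideal_gen (range q)" and "cocycle J i \<omega>"
  shows "coboundary J i (\<lambda>A. p * \<omega> A)"
proof -
  obtain c where c: "p = (\<Sum>v\<in>UNIV. c v * q v)" using ideal_gen_range_q[OF p] .
  define \<eta> where "\<eta> = (\<lambda>A. \<Sum>v\<in>UNIV. c v * contr v \<omega> A)"
  have "p * \<omega> A - d \<eta> A \<in> J" if "card A = i" for A
  proof -
    have "contr v (d \<omega>) A \<in> J" for v
    proof (cases "v \<in> A")
      case False
      then have "d \<omega> (insert v A) \<in> J" using assms(3) that by (simp add: cocycle_def)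
      then show ?thesis using J by (simp add: contr_def ideal_zero ideal_mult)
    qed (simp add: contr_def ideal_zero[OF J])
    then have "(\<Sum>v\<in>UNIV. c v * contr v (d \<omega>) A) \<in> J" by (intro ideal_sum ideal_mult J)
    moreover have "p * \<omega> A - d \<eta> A = (\<Sum>v\<in>UNIV. c v * contr v (d \<omega>) A)"
    proof -
      have "p * \<omega> A = (\<Sum>v\<in>UNIV. c v * (q v * \<omega> A))" by (simp add: c sum_distrib_right mult.assoc)
      also have "\<dots> = (\<Sum>v\<in>UNIV. c v * d (contr v \<omega>) A) + (\<Sum>v\<in>UNIV. c v * contr v (d \<omega>) A)"
        by (simp only: d_contr[symmetric] distrib_left sum.distrib)
      also have "(\<Sum>v\<in>UNIV. c v * d (contr v \<omega>) A) = d \<eta> A"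
        unfolding \<eta>_def d_sum d_mult ..
      finally show ?thesis by simp
    qed
    ultimately show ?thesis by simp
  qed
  then show ?thesis unfolding coboundary_def by blast
qed

text \<open>Regularity of \<open>f\<close> makes multiplication by \<open>f\<close> injective on the \<open>i\<close>-th cohomology once the
  preceding cohomology of the quotient by \<open>f\<close> vanishes; a power of \<open>f\<close> acts as zero on it.\<close>

lemma koszul_vanishing:
  assumes "is_ideal J"
    and "\<And>i g. i < length fs \<Longrightarrow> fs ! i * g \<in> ideal_gen (J \<union> set (take i fs))
           \<Longrightarrow> g \<in> ideal_gen (J \<union> set (take i fs))"
    and "\<And>f. f \<in> set fs \<Longrightarrow> \<exists>N. f ^ N \<in> ideal_gen (range q)"
    and "i < length fs" "cocycle J i \<omega>"
  shows "coboundary J i \<omega>"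
  using assms
proof (induction fs arbitrary: J i \<omega>)
  case (Cons f fs)
  note J = Cons.prems(1)
  have reg: "g \<in> J" if "f * g \<in> J" for g
    using Cons.prems(2)[of 0 g] that ideal_gen_of_ideal[OF J] by simp
  define J' where "J' = ideal_gen (insert f J)"
  have J': "is_ideal J'" unfolding J'_def by (rule is_ideal_ideal_gen)
  have JJ': "J \<subseteq> J'" "f \<in> J'" unfolding J'_def using ideal_gen_superset[of "insert f J"] by auto
  have reg': "g \<in> ideal_gen (J' \<union> set (take k fs))"
    if "k < length fs" "fs ! k * g \<in> ideal_gen (J' \<union> set (take k fs))" for k g
  proof -
    have "ideal_gen (J' \<union> set (take k fs)) = ideal_gen (J \<union> set (take (Suc k) (f # fs)))"
      unfolding J'_def ideal_gen_Un_ideal_gen by (simp add: Un_commute insert_commute)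
    then show ?thesis using Cons.prems(2)[of "Suc k" g] that by simp
  qed
  have inj: "coboundary J i \<theta>" if "cocycle J i \<theta>" "coboundary J i (\<lambda>A. f * \<theta> A)" for \<theta>
  proof -
    obtain \<eta> where \<eta>: "\<And>A. card A = i \<Longrightarrow> f * \<theta> A - d \<eta> A \<in> J"
      using \<open>coboundary J i (\<lambda>A. f * \<theta> A)\<close> by (auto simp: coboundary_def)
    show ?thesis
    proof (cases i)
      case 0
      have "\<theta> {} \<in> J" using \<eta>[of "{}"] reg 0 by simp
      then show ?thesis using 0 by (auto simp: coboundary_def)
    next
      case (Suc j)
      \<comment> \<open>The connecting homomorphism: \<open>d \<eta>\<close> equals
        \<open>f * \<theta>\<close> modulo \<open>J\<close>, so modulo \<open>f\<close> the cochain
        \<open>\<eta>\<close> is a cocycle one degree lower, where the induction hypothesis for the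
        shorter sequence applies.\<close>
      have "cocycle J' j \<eta>"
        unfolding cocycle_def
      proof (intro allI impI)
        fix A :: "'v set" assume "card A = Suc j"
        then have "f * \<theta> A - d \<eta> A \<in> J'" using \<eta> Suc JJ' by blast
        moreover have "f * \<theta> A \<in> J'" using JJ' ideal_mult_right[OF J'] by blast
        moreover have "d \<eta> A = f * \<theta> A - (f * \<theta> A - d \<eta> A)" by simp
        ultimately show "d \<eta> A \<in> J'" using ideal_diff[OF J'] by metis
      qed
      moreover have "\<exists>N. g ^ N \<in> ideal_gen (range q)" if "g \<in> set fs" for g
        using Cons.prems(3) that by simp
      moreover have "j < length fs" using Cons.prems(4) Suc by simp
      ultimately have "coboundary J' j \<eta>" using Cons.IH[OF J' reg'] by blast
      then obtain u where u: "\<And>A. card A = j \<Longrightarrow> \<eta> A - d u A \<in> J'"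
        by (auto simp: coboundary_def)
      have "\<exists>r z. card A = j \<longrightarrow> \<eta> A - d u A = r * f + z \<and> z \<in> J" for A
        using ideal_gen_insert[OF J] u[of A] unfolding J'_def by metis
      then obtain r z where rz: "\<And>A. card A = j \<Longrightarrow> \<eta> A - d u A = r A * f + z A \<and> z A \<in> J"
        by metis
      \<comment> \<open>Modulo \<open>J\<close> the cochain \<open>\<eta>\<close> is
        \<open>d u + f * r\<close>. Applying \<open>d\<close> removes \<open>u\<close>, and
        regularity of \<open>f\<close> cancels the factor in the congruence of
        \<open>f * \<theta>\<close> and \<open>f * d r\<close>.\<close>
      have "\<theta> A - d r A \<in> J" if A: "card A = i" for A
      proof (rule reg)
        have cj: "card (A - {v}) = j" if "v \<in> A" for v using A Suc that by simp
        have "d \<eta> A = d (\<lambda>A. (d u A + f * r A) + z A) A"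
          using rz[OF cj] by (intro d_cong) (simp add: algebra_simps)
        also have "\<dots> = f * d r A + d z A" by (simp add: d_add d_d d_mult)
        finally have "f * (\<theta> A - d r A) = (f * \<theta> A - d \<eta> A) + d z A" by (simp add: algebra_simps)
        moreover have "d z A \<in> J" using rz cj by (intro d_in_ideal[OF J]) blast
        ultimately show "f * (\<theta> A - d r A) \<in> J" using \<eta>[OF A] ideal_add[OF J] by simp
      qed
      then show ?thesis unfolding coboundary_def by blast
    qed
  qed
  have cocycle_mult: "cocycle J i (\<lambda>A. p * \<theta> A)" if "cocycle J i \<theta>" for p \<theta>
    using that ideal_mult[OF J] by (simp add: cocycle_def d_mult)
  obtain N where "f ^ N \<in> ideal_gen (range q)" using Cons.prems(3) by auto
  then have "coboundary J i (\<lambda>A. f ^ N * \<omega> A)" by (rule coboundary_multiple[OF J _ Cons.prems(5)])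
  then show ?case
  proof (induction N)
    case (Suc N)
    have "coboundary J i (\<lambda>A. f * (f ^ N * \<omega> A))" using Suc.prems by (simp add: mult.assoc)
    then show ?case using Suc.IH inj cocycle_mult[OF Cons.prems(5)] by blast
  qed simp
qed simp

end

lemma is_ideal_radical:
  assumes J: "is_ideal J"
  shows "is_ideal {p. \<exists>N. p ^ N \<in> J}"
  unfolding is_ideal_def
proof (intro conjI ballI allI)
  show "0 \<in> {p. \<exists>N. p ^ N \<in> J}" using ideal_zero[OF J] by (auto intro: exI[of _ 1])
next
  fix a b assume "a \<in> {p. \<exists>N. p ^ N \<in> J}" "b \<in> {p. \<exists>N. p ^ N \<in> J}"
  then obtain M N where M: "a ^ M \<in> J" and N: "b ^ N \<in> J" by blast
  have "(a + b) ^ (M + N) = (\<Sum>k\<le>M + N. of_nat (M + N choose k) * a ^ k * b ^ (M + N - k))"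
    by (rule binomial_ring)
  also have "\<dots> \<in> J"
  proof (rule ideal_sum[OF J])
    fix k assume "k \<in> {..M + N}"
    show "of_nat (M + N choose k) * a ^ k * b ^ (M + N - k) \<in> J"
    proof (cases "M \<le> k")
      case True
      then have "a ^ k = a ^ (k - M) * a ^ M" by (simp flip: power_add)
      then have "a ^ k \<in> J" using M ideal_mult[OF J] by simp
      then show ?thesis using ideal_mult[OF J] ideal_mult_right[OF J] by blast
    next
      case False
      then have "b ^ (M + N - k) = b ^ (M - k) * b ^ N" by (simp flip: power_add)
      then have "b ^ (M + N - k) \<in> J" using N ideal_mult[OF J] by simp
      then show ?thesis using ideal_mult[OF J] by blast
    qed
  qed
  finally show "a + b \<in> {p. \<exists>N. p ^ N \<in> J}" by blast
next
  fix a r assume "a \<in> {p. \<exists>N. p ^ N \<in> J}"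
  then obtain N where "a ^ N \<in> J" by blast
  then have "(r * a) ^ N \<in> J" using ideal_mult[OF J] by (simp add: power_mult_distrib)
  then show "r * a \<in> {p. \<exists>N. p ^ N \<in> J}" by blast
qed

section \<open>Upper bounds for the depth\<close>

text \<open>The squares isolate squarefree degrees: a boundary term in a direction
  \<open>v \<in> F\<close> is divisible by \<open>var v ^ 2\<close>, so its coefficient vanishes at
  every squarefree exponent. What survives is the cochain complex of the link of \<open>F\<close>.
  The ideal generated still contains a power of every variable.\<close>

definition half_square :: "'v set \<Rightarrow> 'v \<Rightarrow> ('v, 'k::field) mpoly" where
  "half_square F v = (if v \<in> F then var v ^ 2 else var v)"

lemma var_power2: "var v ^ 2 = single (single v 2) 1"
  by (simp add: var_def power2_eq_square mult_single numeral_2_eq_2 flip: single_add)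

lemma lookup_var_power2_mult:
  assumes "lookup n v < 2"
  shows "lookup (var v ^ 2 * p) n = 0"
  unfolding var_power2
proof (rule lookup_single_mult_0)
  fix m show "single v 2 + m \<noteq> n" using assms by (auto simp: lookup_add)
qed

lemma max_ideal_power:
  fixes f :: "('v, 'k::field) mpoly"
  assumes "f \<in> max_ideal"
  shows "\<exists>N. f ^ N \<in> ideal_gen (range (half_square F))"
proof -
  have "range var \<subseteq> {p :: ('v, 'k) mpoly. \<exists>N. p ^ N \<in> ideal_gen (range (half_square F))}"
  proof clarify
    fix v
    have "(var v :: ('v, 'k) mpoly) ^ (if v \<in> F then 2 else 1) = half_square F v"
      by (simp add: half_square_def)
    also have "\<dots> \<in> ideal_gen (range (half_square F))"
      by (intro in_ideal_gen rangeI)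
    finally show "\<exists>N. (var v :: ('v, 'k) mpoly) ^ N \<in> ideal_gen (range (half_square F))" by (rule exI)
  qed
  then have "max_ideal \<subseteq> {p :: ('v, 'k) mpoly. \<exists>N. p ^ N \<in> ideal_gen (range (half_square F))}"
    unfolding max_ideal_def by (intro ideal_gen_least is_ideal_radical is_ideal_ideal_gen)
  then show ?thesis using assms by blast
qed

lemma ex_inj_nat: "\<exists>ord :: 'v::finite \<Rightarrow> nat. inj ord"
  using finite_imp_inj_to_nat_seg[of "UNIV :: 'v set"] by auto

lemma monom_of_in_edge_ideal:
  fixes A :: "('v::finite) set"
  assumes "e \<in> E" "e \<subseteq> A"
  shows "monom_of A \<in> edge_ideal E"
  using assms by (auto simp: in_edge_ideal_iff monom_of_eq nonface_def keys_expt)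

lemma monom_of_insert: "finite A \<Longrightarrow> v \<notin> A \<Longrightarrow> monom_of (insert v A) = var v * monom_of A"
  by (simp add: monom_of_def)

lemma lookup_edge_ideal:
  fixes p :: "('v::finite, 'k::field) mpoly"
  assumes "p \<in> edge_ideal E" "\<And>e. e \<in> E \<Longrightarrow> \<not> e \<subseteq> A"
  shows "lookup p (expt A) = 0"
proof (rule ccontr)
  assume "lookup p (expt A) \<noteq> 0"
  then have "expt A \<in> nonface E" using assms(1) by (auto simp: in_edge_ideal_iff in_keys_iff)
  then show False using assms(2) by (auto simp: nonface_def keys_expt)
qed

lemma regular_seq_coboundary:
  fixes fs :: "('v::finite, 'k::field) mpoly list"
  assumes "inj ord" "regular_seq J fs" "is_ideal J" "i < length fs"
    and "koszul.cocycle ord (half_square F) J i \<omega>"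
  shows "koszul.coboundary ord (half_square F) J i \<omega>"
proof -
  interpret koszul ord "half_square F" using assms(1) by unfold_locales
  show ?thesis
  proof (rule koszul_vanishing)
    show "\<exists>N. f ^ N \<in> ideal_gen (range (half_square F))" if "f \<in> set fs" for f
      using assms(2) that by (intro max_ideal_power) (auto simp: regular_seq_def)
  qed (use assms in \<open>auto simp: regular_seq_def\<close>)
qed

text \<open>\<open>F\<close> is a facet of the independence complex. Its monomial, placed at the
  index set \<open>F\<close>, is a cocycle because any further variable completes an edge; it is no
  coboundary because the coefficient at \<open>expt F\<close> vanishes on coboundaries and on the
  edge ideal. This is the elementary form of the bound of the depth by dim S/Q for the minimal prime
  Q generated by the variables outside \<open>F\<close>.\<close>

lemma depth_le_facet:
  fixes E :: "('v::finite) set set" and fs :: "('v, 'k::field) mpoly list"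
  assumes indep: "\<And>e. e \<in> E \<Longrightarrow> \<not> e \<subseteq> F"
    and dom: "\<And>v. v \<notin> F \<Longrightarrow> \<exists>e\<in>E. e \<subseteq> insert v F"
    and fs: "regular_seq (edge_ideal E) fs"
  shows "length fs \<le> card F"
proof (rule ccontr)
  assume len: "\<not> length fs \<le> card F"
  obtain ord :: "'v \<Rightarrow> nat" where ord: "inj ord" using ex_inj_nat by blast
  interpret koszul ord "half_square F :: 'v \<Rightarrow> ('v, 'k) mpoly" using ord by unfold_locales
  note I = is_ideal_edge_ideal[of E, where 'b = 'k]
  define \<omega> :: "'v set \<Rightarrow> ('v, 'k) mpoly" where "\<omega> A = (if A = F then monom_of F else 0)" for A
  have "cocycle (edge_ideal E) (card F) \<omega>"
    unfolding cocycle_def d_def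
  proof (intro allI impI ideal_sum[OF I])
    fix A :: "'v set" and v assume "v \<in> A"
    show "sg v A * half_square F v * \<omega> (A - {v}) \<in> edge_ideal E"
    proof (cases "A - {v} = F")
      case True
      then have v: "v \<notin> F" by auto
      then obtain e where "e \<in> E" "e \<subseteq> insert v F" using dom by blast
      then have "var v * monom_of F \<in> (edge_ideal E :: ('v, 'k) mpoly set)"
        using monom_of_in_edge_ideal monom_of_insert[OF _ v] by (metis finite)
      then have "sg v A * (var v * monom_of F) \<in> edge_ideal E" by (rule ideal_mult[OF I])
      then show ?thesis using True v by (simp add: \<omega>_def half_square_def mult.assoc)
    qed (simp add: \<omega>_def ideal_zero[OF I])
  qed
  then have "coboundary (edge_ideal E) (card F) \<omega>"
    using regular_seq_coboundary[OF ord fs I] len by simp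
  then obtain \<eta> where "\<omega> F - d \<eta> F \<in> edge_ideal E" by (auto simp: coboundary_def)
  then have "lookup (\<omega> F - d \<eta> F) (expt F) = 0" using indep by (rule lookup_edge_ideal)
  moreover have "lookup (d \<eta> F) (expt F) = 0"
  proof -
    have "lookup (sg v F * half_square F v * \<eta> (F - {v})) (expt F) = 0" if "v \<in> F" for v
    proof -
      have "sg v F * half_square F v * \<eta> (F - {v}) = var v ^ 2 * (sg v F * \<eta> (F - {v}))"
        using that by (simp add: half_square_def algebra_simps)
      then show ?thesis by (simp add: lookup_var_power2_mult lookup_expt)
    qed
    then show ?thesis by (simp add: d_def lookup_sum)
  qed
  ultimately show False by (simp add: \<omega>_def monom_of_eq lookup_minus)
qed

text \<open>The cocycle below represents the local cohomology class of the link of \<open>F\<close>, which is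
  disconnected, in degree \<open>- F\<close>.\<close>

lemma depth_le_disconnected_link:
  fixes E :: "('v::finite) set set" and fs :: "('v, 'k::field) mpoly list"
  assumes FX: "F \<inter> X = {}" and FY: "F \<inter> Y = {}"
    and "x \<in> X" "y \<in> Y"
    and indep_x: "\<And>e. e \<in> E \<Longrightarrow> \<not> e \<subseteq> insert x F"
    and indep_y: "\<And>e. e \<in> E \<Longrightarrow> \<not> e \<subseteq> insert y F"
    and XY: "\<And>a b. a \<in> X \<Longrightarrow> b \<in> Y \<Longrightarrow> {a, b} \<in> E" and "X \<inter> Y = {}"
    and dom: "\<And>v. v \<notin> F \<union> X \<union> Y \<Longrightarrow> \<exists>e\<in>E. e \<subseteq> insert v F"
    and fs: "regular_seq (edge_ideal E) fs"
  shows "length fs \<le> Suc (card F)"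
proof (rule ccontr)
  assume len: "\<not> length fs \<le> Suc (card F)"
  obtain ord :: "'v \<Rightarrow> nat" where ord: "inj ord" using ex_inj_nat by blast
  interpret koszul ord "half_square F :: 'v \<Rightarrow> ('v, 'k) mpoly" using ord by unfold_locales
  note I = is_ideal_edge_ideal[of E, where 'b = 'k]
  \<comment> \<open>The indicator of the component \<open>Y\<close> of the link: the value at
    \<open>F\<close> plus one vertex is nonzero only for a vertex of \<open>Y\<close>. The sign is
    the one with which this vertex enters \<open>d\<close>, so that admitting all vertices outside
    \<open>F\<close> would give the coboundary of the monomial of \<open>F\<close> placed at
    \<open>F\<close>.\<close>
  define \<omega> :: "'v set \<Rightarrow> ('v, 'k) mpoly" where
    "\<omega> A = (if F \<subseteq> A \<and> (\<exists>v\<in>Y. A - F = {v}) then sg (the_elem (A - F)) F * monom_of A else 0)" for A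
  have \<omega>_insert: "\<omega> (insert v F) = (if v \<in> Y then sg v F * monom_of (insert v F) else 0)"
    if "v \<notin> F" for v
  proof -
    have "insert v F - F = {v}" using that by auto
    then show ?thesis by (auto simp: \<omega>_def)
  qed
  have \<omega>_0: "\<omega> A = 0" if "\<not> F \<subseteq> A" for A using that by (simp add: \<omega>_def)
  have edge: "monom_of (insert v (insert w F)) \<in> (edge_ideal E :: ('v, 'k) mpoly set)"
    if vw: "w \<in> Y" "v \<notin> Y" "v \<notin> F" for v w
  proof (cases "v \<in> X")
    case True
    then show ?thesis using XY[OF True vw(1)] by (intro monom_of_in_edge_ideal) auto
  next
    case False
    then obtain e where "e \<in> E" "e \<subseteq> insert v F" using dom[of v] vw by auto
    then show ?thesis by (intro monom_of_in_edge_ideal) auto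
  qed
  have "cocycle (edge_ideal E) (Suc (card F)) \<omega>"
    unfolding cocycle_def
  proof (intro allI impI)
    fix A :: "'v set" assume card: "card A = Suc (Suc (card F))"
    show "d \<omega> A \<in> edge_ideal E"
    proof (cases "F \<subseteq> A")
      case False
      have "\<omega> (A - {v}) = 0" for v using False by (intro \<omega>_0) auto
      then have "d \<omega> A = 0" by (simp add: d_def)
      then show ?thesis by (simp add: ideal_zero[OF I])
    next
      case True
      then have "card (A - F) = 2" using card by (simp add: card_Diff_subset)
      then obtain v w where vw: "A - F = {v, w}" "v \<noteq> w" by (meson card_2_iff)
      then have A: "A = insert v (insert w F)" "v \<notin> F" "w \<notin> F" using True by auto
      have Av: "A - {v} = insert w F" and Aw: "A - {w} = insert v F" using A vw(2) by auto
      let ?M = "monom_of A :: ('v, 'k) mpoly"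
      have Mv: "?M = var v * monom_of (insert w F)" unfolding A(1)
        using A vw(2) by (intro monom_of_insert) auto
      have Mw: "?M = var w * monom_of (insert v F)" unfolding A(1) insert_commute[of v w]
        using A vw(2) by (intro monom_of_insert) auto
      have "d \<omega> A = (\<Sum>u\<in>{v, w}. sg u A * half_square F u * \<omega> (A - {u}))"
        unfolding d_def
      proof (rule sum.mono_neutral_right)
        show "\<forall>u\<in>A - {v, w}. sg u A * half_square F u * \<omega> (A - {u}) = 0"
        proof
          fix u assume "u \<in> A - {v, w}"
          then have "\<not> F \<subseteq> A - {u}" using A by auto
          then show "sg u A * half_square F u * \<omega> (A - {u}) = 0" by (simp add: \<omega>_0)
        qed
      qed (use A in auto)
      also have "\<dots> = sg v A * var v * \<omega> (insert w F) + sg w A * var w * \<omega> (insert v F)"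
        using vw(2) A(2,3) by (simp add: Av Aw half_square_def)
      also have "\<dots> = (if w \<in> Y then sg v A * sg w F * ?M else 0)
          + (if v \<in> Y then sg w A * sg v F * ?M else 0)"
      proof -
        have "sg v A * var v * \<omega> (insert w F) = (if w \<in> Y then sg v A * sg w F * ?M else 0)"
          unfolding \<omega>_insert[OF A(3)] Mv by (simp add: algebra_simps)
        moreover have "sg w A * var w * \<omega> (insert v F) = (if v \<in> Y then sg w A * sg v F * ?M else 0)"
          unfolding \<omega>_insert[OF A(2)] Mw by (simp add: algebra_simps)
        ultimately show ?thesis by simp
      qed
      also have "\<dots> \<in> edge_ideal E"
      proof -
        \<comment> \<open>Two vertices of \<open>Y\<close> cancel by \<open>sg_swap\<close>. If just
          one is in \<open>Y\<close>, the other lies in \<open>X\<close> and is joined to it, or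
          lies outside the link and completes an edge with \<open>F\<close>.\<close>
        consider "v \<in> Y" "w \<in> Y" | "v \<notin> Y" "w \<notin> Y" | "v \<in> Y \<longleftrightarrow> w \<notin> Y" by blast
        then show ?thesis
        proof cases
          case 1
          have "sg v A = sg v (insert w F)" unfolding A(1) by simp
          moreover have "sg w A = sg w (insert v F)" unfolding A(1) insert_commute[of v w] by simp
          ultimately have "sg v A * sg w F = - (sg w A * sg v F)" using sg_swap[OF vw(2) A(2,3)] by simp
          then show ?thesis using 1 by (simp add: ideal_zero[OF I])
        next
          case 3
          then have "?M \<in> edge_ideal E"
            using edge[of w v] edge[of v w] A by (auto simp: insert_commute)
          then show ?thesis by (auto intro!: ideal_add[OF I] ideal_zero[OF I] ideal_mult[OF I])
        qed (simp add: ideal_zero[OF I])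
      qed
      finally show ?thesis .
    qed
  qed
  then have "coboundary (edge_ideal E) (Suc (card F)) \<omega>"
    using regular_seq_coboundary[OF ord fs I] len by simp
  then obtain \<eta> where \<eta>: "\<And>A. card A = Suc (card F) \<Longrightarrow> \<omega> A - d \<eta> A \<in> edge_ideal E"
    by (auto simp: coboundary_def)
  \<comment> \<open>Coefficients are compared at the squarefree exponent of
    \<open>insert v F\<close>, where the directions in \<open>F\<close> drop out. The vertex
    \<open>y\<close> of \<open>Y\<close> forces the coefficient of \<open>\<eta> F\<close> at
    \<open>expt F\<close> to be 1 and the vertex \<open>x\<close> of \<open>X\<close> forces it to
    be 0.\<close>
  have key: "lookup (\<eta> F) (expt F) = (if v \<in> Y then 1 else 0)"
    if v: "v \<notin> F" and indep: "\<And>e. e \<in> E \<Longrightarrow> \<not> e \<subseteq> insert v F" for v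
  proof -
    let ?A = "insert v F" and ?n = "expt (insert v F)"
    define R where "R = (\<Sum>u\<in>F. sg u ?A * half_square F u * \<eta> (?A - {u}))"
    have "d \<eta> ?A = sg v F * (var v * \<eta> F) + R"
      using v by (simp add: d_def R_def half_square_def mult.assoc)
    moreover have "\<omega> ?A = sg v F * (if v \<in> Y then monom_of ?A else 0)"
      using \<omega>_insert[OF v] by simp
    ultimately have "sg v F * (\<omega> ?A - d \<eta> ?A)
        = (sg v F * sg v F) * ((if v \<in> Y then monom_of ?A else 0) - var v * \<eta> F) - sg v F * R"
      by (simp only: algebra_simps)
    then have eq: "sg v F * (\<omega> ?A - d \<eta> ?A) = (if v \<in> Y then monom_of ?A else 0) - var v * \<eta> F - sg v F * R"
      by simp
    have "sg v F * (\<omega> ?A - d \<eta> ?A) \<in> edge_ideal E" using \<eta>[of ?A] v by (intro ideal_mult[OF I]) simp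
    then have 1: "lookup (sg v F * (\<omega> ?A - d \<eta> ?A)) ?n = 0" using indep by (rule lookup_edge_ideal)
    have 2: "lookup (sg v F * R) ?n = 0"
    proof -
      have "lookup (sg v F * (sg u ?A * half_square F u * \<eta> (?A - {u}))) ?n = 0" if "u \<in> F" for u
      proof -
        have "sg v F * (sg u ?A * half_square F u * \<eta> (?A - {u}))
            = var u ^ 2 * (sg v F * sg u ?A * \<eta> (?A - {u}))"
          using that by (simp add: half_square_def algebra_simps)
        then show ?thesis by (simp add: lookup_var_power2_mult lookup_expt)
      qed
      then show ?thesis by (simp add: R_def sum_distrib_left lookup_sum)
    qed
    have n: "?n = single v 1 + expt F" using v by (simp add: expt_def)
    have "lookup (var v * \<eta> F) ?n = lookup (\<eta> F) (expt F)"
      unfolding n var_def by (simp add: lookup_single_mult)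
    then show ?thesis using 1 2 unfolding eq by (auto simp: lookup_minus monom_of_eq)
  qed
  have "x \<notin> Y" "x \<notin> F" "y \<notin> F"
    using \<open>X \<inter> Y = {}\<close> FX FY \<open>x \<in> X\<close> \<open>y \<in> Y\<close> by blast+
  then show False
    using key[of x, OF _ indep_x] key[of y, OF _ indep_y] \<open>y \<in> Y\<close> by simp
qed

section \<open>A regular sequence of matching differences\<close>

text \<open>Associated primes of a monomial ideal are generated by variables and are annihilators of
  monomials, so a difference of two variables is a zero divisor only if both variables kill a common
  monomial outside the ideal. The hypothesis \<open>no_socle\<close> excludes this; the proof is an
  elementary comparison of coefficients.\<close>

lemma var_minus_var_nonzerodivisor:
  fixes g :: "('v, 'k::field) mpoly"
  assumes U: "upclosed U" and "x \<noteq> y"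
    and no_socle: "\<And>u. u \<notin> U \<Longrightarrow> single x 1 + u \<in> U \<Longrightarrow> single y 1 + u \<notin> U"
    and prod: "keys ((var x - var y) * g) \<subseteq> U"
  shows "keys g \<subseteq> U"
proof (rule ccontr)
  have lookup_prod: "lookup (var x * g) n = lookup (var y * g) n" if "n \<notin> U" for n
  proof -
    have "lookup ((var x - var y) * g) n = 0" using prod that by (auto simp: in_keys_iff)
    then show ?thesis by (simp add: left_diff_distrib lookup_minus)
  qed
  have up: "n \<notin> U" if "r + n \<notin> U" for n r using U that by (auto simp: upclosed_def)
  have step: "\<exists>n. single b 1 + n = single a 1 + k \<and> n \<in> keys g"
    if "lookup (var a * g) (single a 1 + k) = lookup (var b * g) (single a 1 + k)" "k \<in> keys g" for a b k
  proof (rule ccontr)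
    assume no: "\<not> ?thesis"
    have "lookup (var b * g) (single a 1 + k) = 0"
    proof (cases "\<exists>n. single b 1 + n = single a 1 + k")
      case True
      then obtain n where n: "single b 1 + n = single a 1 + k" by blast
      then have "lookup g n = 0" using no by (auto simp: in_keys_iff)
      then show ?thesis unfolding n[symmetric] var_def lookup_single_mult by simp
    next
      case False
      then show ?thesis unfolding var_def by (intro lookup_single_mult_0) blast
    qed
    moreover have "lookup (var a * g) (single a 1 + k) = lookup g k"
      unfolding var_def lookup_single_mult by simp
    ultimately show False using that by (simp add: in_keys_iff)
  qed
  assume "\<not> keys g \<subseteq> U"
  then have ne: "(\<lambda>k. lookup k x) ` (keys g - U) \<noteq> {}" by auto
  have fin: "finite ((\<lambda>k. lookup k x) ` (keys g - U))" by simp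
  obtain k where k: "k \<in> keys g - U" and "lookup k x = Max ((\<lambda>k. lookup k x) ` (keys g - U))"
    using Max_in[OF fin ne] by (metis (no_types, lifting) imageE)
  then have max: "lookup n x \<le> lookup k x" if "n \<in> keys g - U" for n
    using that fin by simp
  \<comment> \<open>Otherwise the coefficient there would have to be cancelled by a term of
    \<open>g\<close> outside \<open>U\<close> with a larger exponent of \<open>x\<close>.\<close>
  have kx: "single x 1 + k \<in> U"
  proof (rule ccontr)
    assume nU: "single x 1 + k \<notin> U"
    then obtain n where n: "single y 1 + n = single x 1 + k" "n \<in> keys g"
      using step[of x k y] lookup_prod[of "single x 1 + k"] k by auto
    then have "n \<notin> U" using up[of "single y 1" n] nU by simp
    moreover have "lookup n x = Suc (lookup k x)"
      using arg_cong[OF n(1), of "\<lambda>e. lookup e x"] \<open>x \<noteq> y\<close> by (simp add: lookup_add lookup_single)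
    ultimately show False using max[of n] n(2) by simp
  qed
  have ky: "single y j + k \<notin> U" for j
  proof (induction j)
    case (Suc j)
    have "single x 1 + (single y j + k) \<in> U"
    proof -
      have "single y j + (single x 1 + k) \<in> U" using U kx unfolding upclosed_def by blast
      then show ?thesis by (simp only: add.left_commute)
    qed
    then have "single y 1 + (single y j + k) \<notin> U" using no_socle Suc by blast
    moreover have "single y 1 + (single y j + k) = single y (Suc j) + k"
      by (simp add: add.assoc[symmetric] flip: single_add)
    ultimately show ?case by simp
  qed (use k in simp)
  \<comment> \<open>For every \<open>j\<close>, trading \<open>j\<close> factors \<open>x\<close> of
    \<open>k\<close> for factors \<open>y\<close> yields another term of \<open>g\<close>; this is
    impossible once \<open>j\<close> exceeds the exponent of \<open>x\<close> in
    \<open>k\<close>.\<close>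
  have "\<exists>n\<in>keys g. single x j + n = single y j + k" for j
  proof (induction j)
    case (Suc j)
    then obtain n where n: "n \<in> keys g" "single x j + n = single y j + k" by blast
    have eq: "single x j + (single y 1 + n) = single y (Suc j) + k"
    proof -
      have "single x j + (single y 1 + n) = single y 1 + (single x j + n)" by (rule add.left_commute)
      also have "\<dots> = single y 1 + (single y j + k)" by (simp only: n(2))
      finally show ?thesis by (simp add: add.assoc[symmetric] flip: single_add)
    qed
    then have "single y 1 + n \<notin> U" using up[of "single x j"] ky[of "Suc j"] by metis
    then obtain n' where n': "single x 1 + n' = single y 1 + n" "n' \<in> keys g"
      using step[of y n x] lookup_prod[of "single y 1 + n"] n(1) by auto
    have "single x (Suc j) + n' = single x j + (single x 1 + n')"
      by (simp add: add.assoc[symmetric] flip: single_add)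
    then show ?case using n' eq by auto
  qed (use k in auto)
  then obtain n where "single x (Suc (lookup k x)) + n = single y (Suc (lookup k x)) + k" by blast
  from arg_cong[OF this, of "\<lambda>e. lookup e x"] show False
    using \<open>x \<noteq> y\<close> by (simp add: lookup_add lookup_single)
qed

section \<open>Identification of variables along a map\<close>

definition push_expt :: "('v::finite \<Rightarrow> 'v) \<Rightarrow> ('v \<Rightarrow>\<^sub>0 nat) \<Rightarrow> ('v \<Rightarrow>\<^sub>0 nat)" where
  "push_expt f m = (\<Sum>v\<in>UNIV. single (f v) (lookup m v))"

definition push :: "('v::finite \<Rightarrow> 'v) \<Rightarrow> ('v, 'k::field) mpoly \<Rightarrow> ('v, 'k) mpoly" where
  "push f p = (\<Sum>m\<in>keys p. single (push_expt f m) (lookup p m))"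

lemma push_expt_add: "push_expt f (m + n) = push_expt f m + push_expt f n"
  by (simp add: push_expt_def lookup_add single_add sum.distrib)

lemma push_expt_0 [simp]: "push_expt f 0 = 0"
  by (simp add: push_expt_def)

lemma push_expt_single [simp]: "push_expt f (single v k) = single (f v) k"
proof -
  have "push_expt f (single v k) = (\<Sum>w\<in>UNIV. if w = v then single (f w) k else 0)"
    unfolding push_expt_def by (intro sum.cong) (auto simp: lookup_single when_def)
  then show ?thesis by simp
qed

lemma push_add: "push f (p + q) = push f p + push f q"
  unfolding push_def by (rule setsum_keys_plus_distrib) (simp_all add: single_add)

lemma push_0 [simp]: "push f 0 = 0"
  by (simp add: push_def)

lemma push_single [simp]: "push f (single m c) = single (push_expt f m) c"
  by (simp add: push_def)

lemma push_mult: "push f (p * q) = push f p * push f q"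
proof (induction p rule: poly_induct)
  case (single m c)
  show ?case
    by (induction q rule: poly_induct)
      (simp_all add: mult_single push_expt_add distrib_left push_add)
qed (simp_all add: distrib_right push_add)

lemma push_var [simp]: "push f (var v) = var (f v)"
  by (simp add: var_def)

lemma push_uminus: "push f (- p) = - push f p"
  using push_add[of f p "- p"] by (simp add: eq_neg_iff_add_eq_0 add.commute)

lemma push_diff: "push f (p - q) = push f p - push f q"
  using push_add[of f p "- q"] by (simp add: push_uminus)

lemma keys_push: "keys (push f p) \<subseteq> push_expt f ` keys p"
  unfolding push_def
  by (rule order_trans[OF Poly_Mapping.keys_sum]) auto

lemma push_congruent:
  fixes p :: "('v::finite, 'k::field) mpoly"
  assumes J: "is_ideal J" and "\<And>v. var v - var (f v) \<in> J"
  shows "p - push f p \<in> J"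
proof (induction p rule: poly_induct)
  case (single m c)
  have "single m 1 - single (push_expt f m) 1 \<in> J"
  proof (induction m rule: expt_induct)
    case (step v m)
    have "single (single v 1 + m) 1 - single (push_expt f (single v 1 + m)) 1
        = var v * (single m 1 - single (push_expt f m) 1) + single (push_expt f m) 1 * (var v - var (f v))"
      by (simp add: var_def mult_single push_expt_add right_diff_distrib add.commute)
    also have "\<dots> \<in> J" by (intro ideal_add[OF J] ideal_mult[OF J] step assms(2))
    finally show ?case .
  qed (simp add: ideal_zero[OF J])
  then have "single 0 c * (single m 1 - single (push_expt f m) 1) \<in> J" by (rule ideal_mult[OF J])
  then show ?case by (simp add: right_diff_distrib mult_single)
next
  case (add p q)
  have "p + q - push f (p + q) = (p - push f p) + (q - push f q)" by (simp add: push_add)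
  also have "\<dots> \<in> J" by (rule ideal_add[OF J add])
  finally show ?case .
qed (simp add: ideal_zero[OF J])

section \<open>Regularity of the matching differences\<close>

context P_matching
begin

text \<open>Identifying \<open>m s\<close> with \<open>s\<close> for \<open>s \<in> S\<close>
  replaces \<open>J\<close> by the monomial ideal \<open>L\<close> with exponents \<open>U\<close>:
  substitution maps \<open>J\<close> into \<open>L\<close>, \<open>L\<close> is contained in
  \<open>J\<close>, and every polynomial is congruent to its image modulo \<open>J\<close>. It
  remains to exclude monomials outside \<open>L\<close> killed by both \<open>x\<close> and
  \<open>m x\<close>.\<close>

lemma matching_difference_regular:
  fixes g :: "('v, 'k::field) mpoly"
  assumes nodup: "\<not> has_duplicated_vertices E"
    and C: "min_vertex_cover E C" and S: "S \<subseteq> C" and x: "x \<in> C" "x \<notin> S"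
  defines "J \<equiv> ideal_gen (edge_ideal E \<union> (\<lambda>s. var s - var (m s)) ` S)"
  assumes g: "(var x - var (m x)) * g \<in> J"
  shows "g \<in> J"
proof -
  have mC: "m v \<in> C \<longleftrightarrow> v \<notin> C" for v by (rule min_vertex_cover_m[OF C])
  \<comment> \<open>As \<open>S\<close> lies in the transversal \<open>C\<close>, no partner of a
    vertex of \<open>S\<close> is in \<open>S\<close>; hence \<open>f\<close> fixes
    \<open>S\<close>, and \<open>x\<close> and \<open>m x\<close> are each their own only
    preimage.\<close>
  define f where "f v = (if m v \<in> S then m v else v)" for v
  have J: "is_ideal J" unfolding J_def by (rule is_ideal_ideal_gen)
  have gens1: "edge_ideal E \<subseteq> J"
    unfolding J_def using ideal_gen_superset by (rule order_trans[OF Un_upper1])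
  have gens2: "var s - var (m s) \<in> J" if "s \<in> S" for s
    unfolding J_def using that by (intro in_ideal_gen UnI2 image_eqI[OF refl])
  have cong: "var v - var (f v) \<in> J" for v
  proof (cases "m v \<in> S")
    case True
    then have "- (var (m v) - var (m (m v))) \<in> J" using gens2 by (intro ideal_uminus[OF J])
    then show ?thesis using True by (simp add: f_def)
  qed (simp add: f_def ideal_zero[OF J])
  have fx: "f x = x" "f (m x) = m x" using x mC S by (auto simp: f_def)
  have f_eq_x: "v = x" if "f v = x" for v using that x by (auto simp: f_def split: if_splits)
  have f_eq_mx: "v = m x" if "f v = m x" for v
    using that x mC[of x] S by (auto simp: f_def split: if_splits)
  define U where "U = {n. \<exists>a b r. {a, b} \<in> E \<and> n = r + (single (f a) 1 + single (f b) (1::nat))}"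
  have U: "upclosed U"
    unfolding upclosed_def U_def by (auto simp: add.assoc[symmetric]) (metis add.assoc)
  define L where "L = {p :: ('v, 'k) mpoly. keys p \<subseteq> U}"
  have L: "is_ideal L" unfolding L_def by (rule is_ideal_upclosed[OF U])
  have "J \<subseteq> {p. push f p \<in> L}"
    unfolding J_def
  proof (rule ideal_gen_least)
    show "is_ideal {p. push f p \<in> L}"
      unfolding is_ideal_def
      using ideal_zero[OF L] ideal_add[OF L] ideal_mult[OF L] by (simp add: push_add push_mult)
    have "push f p \<in> L" if "p \<in> edge_ideal E" for p :: "('v, 'k) mpoly"
    proof -
      have "push_expt f n \<in> U" if "n \<in> nonface E" for n
      proof -
        obtain e where e: "e \<in> E" "e \<subseteq> keys n" using \<open>n \<in> nonface E\<close> by (auto simp: nonface_def)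
        obtain a b where ab: "e = {a, b}" "a \<noteq> b" using simple_graph_edgeE[OF simple e(1)] .
        have "expt e = single a 1 + single b 1" using ab by (simp add: expt_def)
        then have "n = (single a 1 + single b 1) + (n - expt e)" using expt_decomp[OF _ e(2)] by simp
        then have "push_expt f n = (single (f a) 1 + single (f b) 1) + push_expt f (n - expt e)"
          by (metis push_expt_add push_expt_single)
        then show ?thesis unfolding U_def using e(1) ab(1) by (auto simp: add.commute)
      qed
      moreover have "keys p \<subseteq> nonface E" using that by (simp add: in_edge_ideal_iff)
      ultimately show ?thesis using keys_push[of f p] unfolding L_def by blast
    qed
    moreover have "push f (var s - var (m s)) \<in> L" if "s \<in> S" for s
    proof -
      have "f s = s" "f (m s) = s" using that S mC[of s] by (auto simp: f_def)
      then show ?thesis using ideal_zero[OF L] by (simp add: push_diff)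
    qed
    ultimately show "edge_ideal E \<union> (\<lambda>s. var s - var (m s)) ` S \<subseteq> {p. push f p \<in> L}" by auto
  qed
  then have "push f ((var x - var (m x)) * g) \<in> L" using g by blast
  then have prod: "keys ((var x - var (m x)) * push f g) \<subseteq> U"
    by (simp add: push_mult push_diff fx L_def)
  \<comment> \<open>If multiplication by \<open>z\<close> moves \<open>u\<close> into
    \<open>U\<close>, the edge responsible must end in \<open>z\<close>, the only preimage of
    \<open>z\<close>, and the image of its other end divides \<open>u\<close>.\<close>
  have clear: "\<exists>b r. {z, b} \<in> E \<and> u = r + single (f b) 1"
    if z: "\<And>v. f v = z \<Longrightarrow> v = z" "f z = z" and u: "u \<notin> U" "single z 1 + u \<in> U" for z u
  proof -
    obtain a b r where ab: "{a, b} \<in> E" and eq: "single z 1 + u = r + (single (f a) 1 + single (f b) 1)"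
      using u(2) by (auto simp: U_def)
    have "f a = z \<or> f b = z"
    proof (rule ccontr)
      assume "\<not> (f a = z \<or> f b = z)"
      then have "lookup r z = Suc (lookup u z)"
        using arg_cong[OF eq, of "\<lambda>e. lookup e z"] by (simp add: lookup_add lookup_single)
      then have "r = single z 1 + (r - single z 1)"
        using expt_decomp[of "{z}" r] by (simp add: expt_def in_keys_iff)
      then have "single z 1 + u = single z 1 + ((r - single z 1) + (single (f a) 1 + single (f b) 1))"
        using eq by (metis add.assoc)
      then have "u = (r - single z 1) + (single (f a) 1 + single (f b) 1)"
        by (rule add_left_imp_eq)
      then show False using u(1) ab by (auto simp: U_def)
    qed
    then show ?thesis
    proof
      assume "f a = z"
      then have "a = z" "single z 1 + u = single z 1 + (r + single (f b) 1)"
        using z eq by (simp_all add: add.left_commute)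
      then show ?thesis using ab by (metis add_left_imp_eq)
    next
      assume "f b = z"
      then have "b = z" "single z 1 + u = single z 1 + (r + single (f a) 1)"
        using z eq by (simp_all add: ac_simps)
      then show ?thesis using ab by (metis add_left_imp_eq insert_commute)
    qed
  qed
  have "keys (push f g) \<subseteq> U"
  proof (rule var_minus_var_nonzerodivisor[OF U _ _ prod])
    fix u assume u: "u \<notin> U" "single x 1 + u \<in> U"
    show "single (m x) 1 + u \<notin> U"
    proof
      assume "single (m x) 1 + u \<in> U"
      then obtain c r' where c: "{m x, c} \<in> E" "u = r' + single (f c) 1"
        using clear[of "m x" u] f_eq_mx fx u by blast
      obtain b r where b: "{x, b} \<in> E" "u = r + single (f b) 1"
        using clear[of x u] f_eq_x fx u by blast
      have bc: "{b, c} \<in> E" using P[OF b(1) c(1)] .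
      show False
      \<comment> \<open>By (P) the witnesses \<open>b\<close> and \<open>c\<close> are adjacent. If
        their images differ, the product of the images divides \<open>u\<close>; if they coincide,
        \<open>b\<close> and \<open>c\<close> are partners and a 4-cycle makes \<open>b\<close> a
        duplicate of \<open>m x\<close>.\<close>
      proof (cases "f b = f c")
        case True
        have "b \<noteq> c" using bc by auto
        then have cb: "c = m b" using True by (auto simp: f_def split: if_splits)
        then have "nbhd E b = nbhd E (m x)" using duplicated_if_parallel b(1) c(1) by blast
        moreover have "b \<noteq> m x" using True cb fx by auto
        ultimately show False using nodup by (auto simp: has_duplicated_vertices_def)
      next
        case False
        have "lookup r (f c) = Suc (lookup r' (f c))"
          using arg_cong[OF b(2)[unfolded c(2)], of "\<lambda>e. lookup e (f c)"] False
          by (simp add: lookup_add lookup_single)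
        then have "r = single (f c) 1 + (r - single (f c) 1)"
          using expt_decomp[of "{f c}" r] by (simp add: expt_def in_keys_iff)
        then have "u = (r - single (f c) 1) + (single (f b) 1 + single (f c) 1)"
          using b(2) by (metis add.assoc add.commute)
        then show False using u(1) bc by (auto simp: U_def)
      qed
    qed
  qed simp
  have "L \<subseteq> J"
  proof
    fix p assume p: "p \<in> L"
    show "p \<in> J"
    proof (rule poly_in_ideal[OF J])
      fix n assume "n \<in> keys p"
      then obtain a b r where ab: "{a, b} \<in> E" and n: "n = r + (single (f a) 1 + single (f b) 1)"
        using p by (auto simp: L_def U_def)
      have "a \<noteq> b" using ab by auto
      then have "var a * var b = (monom_of {a, b} :: ('v, 'k) mpoly)" by (simp add: monom_of_def)
      also have "\<dots> \<in> edge_ideal E"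
        unfolding edge_ideal_def using ab by (intro in_ideal_gen) blast
      finally have 1: "var a * var b \<in> J" using gens1 by blast
      have 2: "var (f a) * var (f b)
          = var a * var b - (var a * (var b - var (f b)) + var (f b) * (var a - var (f a)))"
        by (simp add: algebra_simps)
      have "var (f a) * var (f b) \<in> J"
        unfolding 2 by (intro ideal_diff[OF J 1] ideal_add[OF J] ideal_mult[OF J] cong)
      then have "single (single (f a) 1 + single (f b) 1) 1 \<in> J" by (simp add: var_def mult_single)
      then show "single n (lookup p n) \<in> J" unfolding n by (rule single_in_ideal[OF J])
    qed
  qed
  then have "push f g \<in> J" using \<open>keys (push f g) \<subseteq> U\<close> by (auto simp: L_def)
  then have "(g - push f g) + push f g \<in> J"
    using push_congruent[OF J cong] by (intro ideal_add[OF J])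
  then show ?thesis by simp
qed

lemma matching_differences_regular_seq:
  assumes nodup: "\<not> has_duplicated_vertices E"
  obtains fs :: "('v, 'k::field) mpoly list"
  where "regular_seq (edge_ideal E) fs" "2 * length fs = card (UNIV :: 'v set)"
proof -
  obtain C where C: "min_vertex_cover E C"
    using min_vertex_cover_avoiding[OF simple, of "undefined" "undefined"] by auto
  obtain xs where xs: "set xs = C" "distinct xs" using finite_distinct_list[of C] by auto
  define h :: "'v \<Rightarrow> ('v, 'k) mpoly" where "h s = var s - var (m s)" for s
  define fs where "fs = map h xs"
  have mx: "is_ideal (max_ideal :: ('v, 'k) mpoly set)" unfolding max_ideal_def by (rule is_ideal_ideal_gen)
  have var: "var v \<in> (max_ideal :: ('v, 'k) mpoly set)" for v
    unfolding max_ideal_def by (intro in_ideal_gen) simp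
  have fs_max: "set fs \<subseteq> max_ideal"
    unfolding fs_def h_def using ideal_diff[OF mx var var] by auto
  have "edge_ideal E \<subseteq> (max_ideal :: ('v, 'k) mpoly set)"
    unfolding edge_ideal_def
  proof (rule ideal_gen_least[OF mx], clarify)
    fix e assume "e \<in> E"
    then obtain a b where "e = {a, b}" "a \<noteq> b" using simple_graph_edgeE[OF simple] by blast
    then show "monom_of e \<in> (max_ideal :: ('v, 'k) mpoly set)"
      by (simp add: monom_of_def ideal_mult[OF mx var])
  qed
  then have "ideal_gen (edge_ideal E \<union> set fs) \<subseteq> max_ideal"
    using fs_max by (intro ideal_gen_least[OF mx]) auto
  then have one: "1 \<notin> ideal_gen (edge_ideal E \<union> set fs)" using one_notin_max_ideal by blast
  have "regular_seq (edge_ideal E) fs"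
    unfolding regular_seq_def
  proof (intro conjI fs_max one allI impI)
    fix i g assume i: "i < length fs" and g: "fs ! i * g \<in> ideal_gen (edge_ideal E \<union> set (take i fs))"
    have i': "i < length xs" using i by (simp add: fs_def)
    have "set (take i fs) = h ` set (take i xs)" by (simp add: fs_def take_map)
    then have eq: "ideal_gen (edge_ideal E \<union> set (take i fs))
        = ideal_gen (edge_ideal E \<union> (\<lambda>s. var s - var (m s)) ` set (take i xs))"
      by (simp add: h_def)
    have 1: "xs ! i \<notin> set (take i xs)"
      using xs(2) i' by (auto simp: in_set_conv_nth nth_eq_iff_index_eq)
    have 2: "set (take i xs) \<subseteq> C" using xs(1) set_take_subset by metis
    have 3: "xs ! i \<in> C" using xs(1) i' by auto
    have 4: "fs ! i = var (xs ! i) - var (m (xs ! i))" using i' by (simp add: fs_def h_def)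
    show "g \<in> ideal_gen (edge_ideal E \<union> set (take i fs))"
      using g unfolding eq 4 by (rule matching_difference_regular[OF nodup C 2 3 1])
  qed
  moreover have "2 * length fs = card (UNIV :: 'v set)"
    using card_min_vertex_cover[OF C] xs distinct_card[of xs] by (simp add: fs_def)
  ultimately show thesis using that by blast
qed

end

section \<open>Krull dimension\<close>

text \<open>A substitute for a monomial order on finitely many exponents: the exponent vector is
  read as a number in base \<open>B\<close>, where \<open>B\<close> exceeds all entries that
  occur.\<close>

lemma separating_weight:
  fixes X :: "('v::finite \<Rightarrow>\<^sub>0 nat) set"
  assumes "finite X"
  obtains W :: "('v \<Rightarrow>\<^sub>0 nat) \<Rightarrow> nat" where "\<And>m n. W (m + n) = W m + W n" "inj_on W X"
proof -
  have "finite ((\<lambda>(m, v). lookup m v) ` (X \<times> UNIV))" using assms by simp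
  then obtain B where "\<forall>k\<in>(\<lambda>(m, v). lookup m v) ` (X \<times> UNIV). k < B"
    by (auto simp: finite_nat_set_iff_bounded)
  then have B: "lookup m v < B" if "m \<in> X" for m v using that by force
  have "\<exists>w. \<forall>m\<in>X. \<forall>n\<in>X. (\<Sum>v\<in>U. w v * lookup m v) = (\<Sum>v\<in>U. w v * lookup n v)
      \<longrightarrow> (\<forall>v\<in>U. lookup m v = lookup n v)" if "finite U" for U :: "'v set"
    using that
  proof (induction U rule: finite_induct)
    case (insert x U)
    then obtain w where w: "\<And>m n. m \<in> X \<Longrightarrow> n \<in> X
        \<Longrightarrow> (\<Sum>v\<in>U. w v * lookup m v) = (\<Sum>v\<in>U. w v * lookup n v) \<Longrightarrow> \<forall>v\<in>U. lookup m v = lookup n v"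
      by meson
    define w' where "w' v = (if v = x then 1 else B * w v)" for v
    have sum: "(\<Sum>v\<in>insert x U. w' v * lookup m v) = lookup m x + B * (\<Sum>v\<in>U. w v * lookup m v)" for m
    proof -
      have "(\<Sum>v\<in>U. w' v * lookup m v) = (\<Sum>v\<in>U. B * (w v * lookup m v))"
        using insert.hyps by (intro sum.cong) (auto simp: w'_def)
      then show ?thesis using insert.hyps by (simp add: w'_def sum_distrib_left)
    qed
    have "\<forall>v\<in>insert x U. lookup m v = lookup n v"
      if mn: "m \<in> X" "n \<in> X" and eq: "(\<Sum>v\<in>insert x U. w' v * lookup m v) = (\<Sum>v\<in>insert x U. w' v * lookup n v)"
      for m n
    proof -
      let ?s = "\<lambda>m. \<Sum>v\<in>U. w v * lookup m v"
      have e: "lookup m x + B * ?s m = lookup n x + B * ?s n" using eq unfolding sum .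
      have "(lookup k x + B * ?s k) mod B = lookup k x" "(lookup k x + B * ?s k) div B = ?s k"
        if "k \<in> X" for k
        using B[OF that, of x] by (simp_all add: div_mult_self2)
      then have "lookup m x = lookup n x" "?s m = ?s n" using e mn by metis+
      then show ?thesis using w[OF mn] by simp
    qed
    then show ?case by blast
  qed simp
  then obtain w where w: "\<And>m n. m \<in> X \<Longrightarrow> n \<in> X
      \<Longrightarrow> (\<Sum>v\<in>UNIV. w v * lookup m v) = (\<Sum>v\<in>UNIV. w v * lookup n v)
      \<Longrightarrow> \<forall>v\<in>UNIV. lookup m v = lookup n v"
    using finite_UNIV by meson
  show thesis
  proof (rule that)
    show "inj_on (\<lambda>m. \<Sum>v\<in>UNIV. w v * lookup m v) X"
      using w by (intro inj_onI poly_mapping_eqI) blast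
    show "(\<Sum>v\<in>UNIV. w v * lookup (m + n) v) = (\<Sum>v\<in>UNIV. w v * lookup m v) + (\<Sum>v\<in>UNIV. w v * lookup n v)"
      for m n by (simp add: lookup_add distrib_left sum.distrib)
  qed
qed

definition var_prime :: "'v set \<Rightarrow> ('v, 'k::field) mpoly set" where
  "var_prime A = {p. keys p \<subseteq> {m. keys m \<inter> A \<noteq> {}}}"

lemma is_ideal_var_prime: "is_ideal (var_prime A)"
  unfolding var_prime_def by (rule is_ideal_upclosed) (auto simp: upclosed_def keys_plus_nat)

text \<open>In each factor take the term of largest weight among those free of \<open>A\<close>. The
  product of the two arises only once in \<open>a * b\<close>: a sum free of \<open>A\<close> has
  summands free of \<open>A\<close>, and their weights cannot exceed the maxima.\<close>

lemma prime_var_prime: "prime_ideal (var_prime A :: ('v::finite, 'k::field) mpoly set)"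
  unfolding prime_ideal_def
proof (intro conjI is_ideal_var_prime allI impI)
  show "1 \<notin> (var_prime A :: ('v, 'k) mpoly set)" by (simp add: var_prime_def)
next
  fix a b :: "('v, 'k) mpoly" assume ab: "a * b \<in> var_prime A"
  show "a \<in> var_prime A \<or> b \<in> var_prime A"
  proof (rule ccontr)
    let ?part = "\<lambda>p :: ('v, 'k) mpoly. {m \<in> keys p. keys m \<inter> A = {}}"
    assume "\<not> (a \<in> var_prime A \<or> b \<in> var_prime A)"
    then have ne: "?part a \<noteq> {}" "?part b \<noteq> {}" unfolding var_prime_def by blast+
    have "finite (keys a \<union> keys b)" by simp
    then obtain W :: "('v \<Rightarrow>\<^sub>0 nat) \<Rightarrow> nat" where W: "\<And>m n. W (m + n) = W m + W n"
      and inj: "inj_on W (keys a \<union> keys b)"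
      by (rule separating_weight) (rule that)
    have "\<exists>m\<in>?part p. \<forall>n\<in>?part p. W n \<le> W m" if "?part p \<noteq> {}" for p
    proof -
      have "Max (W ` ?part p) \<in> W ` ?part p" using that by (intro Max_in) auto
      then obtain m where m: "m \<in> ?part p" "Max (W ` ?part p) = W m" by blast
      have "W n \<le> W m" if "n \<in> ?part p" for n
        unfolding m(2)[symmetric] using that by (intro Max_ge) auto
      then show ?thesis using m(1) by (intro bexI[of _ m] ballI)
    qed
    then obtain m n where m: "m \<in> ?part a" "\<And>k. k \<in> ?part a \<Longrightarrow> W k \<le> W m"
      and n: "n \<in> ?part b" "\<And>k. k \<in> ?part b \<Longrightarrow> W k \<le> W n"
      using ne by meson
    have uniq: "m' + n' = m + n \<longleftrightarrow> m' = m \<and> n' = n" if "m' \<in> keys a" "n' \<in> keys b" for m' n'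
    proof
      assume eq: "m' + n' = m + n"
      have "keys m' \<union> keys n' = keys m \<union> keys n" using arg_cong[OF eq, of keys] by (simp add: keys_plus_nat)
      then have "m' \<in> ?part a" "n' \<in> ?part b" using that m(1) n(1) by auto
      then have "W m' \<le> W m" "W n' \<le> W n" using m n by blast+
      moreover have "W m' + W n' = W m + W n" using arg_cong[OF eq, of W] by (simp add: W)
      ultimately have "W m' = W m" by linarith
      then have "m' = m" using inj that m(1) by (auto dest: inj_onD)
      then show "m' = m \<and> n' = n" using eq by simp
    qed simp
    have "lookup (a * b) (m + n)
        = (\<Sum>m'\<in>keys a. \<Sum>n'\<in>keys b. if m' + n' = m + n then lookup a m' * lookup b n' else 0)"
      by (rule lookup_mult_keys)
    also have "\<dots> = (\<Sum>m'\<in>keys a. if m' = m then (\<Sum>n'\<in>keys b. if n' = n then lookup a m * lookup b n else 0) else 0)"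
      by (intro sum.cong refl) (auto simp: uniq intro!: sum.cong sum.neutral)
    also have "\<dots> = lookup a m * lookup b n" using m(1) n(1) by (simp add: sum.delta)
    also have "\<dots> \<noteq> 0" using m(1) n(1) by (auto simp: in_keys_iff)
    finally have "m + n \<in> keys (a * b)" by (simp add: in_keys_iff)
    then have "keys (m + n) \<inter> A \<noteq> {}" using ab by (auto simp: var_prime_def)
    then show False using m(1) n(1) by (auto simp: keys_plus_nat)
  qed
qed

lemma var_in_var_prime: "var v \<in> (var_prime A :: ('v, 'k::field) mpoly set) \<longleftrightarrow> v \<in> A"
  by (simp add: var_prime_def var_def)

lemma var_prime_mono: "A \<subseteq> B \<Longrightarrow> var_prime A \<subseteq> var_prime B"
  by (auto simp: var_prime_def)

lemma krull_dim_lower: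
  fixes J :: "('v::finite, 'k::field) mpoly set"
  assumes "J \<subseteq> var_prime C"
  shows "enat (card (- C)) \<le> krull_dim_quot J"
proof -
  obtain zs where zs: "set zs = - C" "distinct zs" using finite_distinct_list[of "- C"] by auto
  define Q :: "nat \<Rightarrow> ('v, 'k) mpoly set" where "Q i = var_prime (C \<union> set (take i zs))" for i
  define ps where "ps = map Q [0..<Suc (length zs)]"
  have "Q i \<subset> Q j" if "i < j" "j \<le> length zs" for i j
  proof
    have "set (take i zs) \<subseteq> set (take j zs)" using that by (intro set_take_subset_set_take) simp
    then show "Q i \<subseteq> Q j" unfolding Q_def by (intro var_prime_mono) auto
    have "zs ! i \<in> set (take j zs)" using that by (auto simp: in_set_conv_nth)
    moreover have "zs ! i \<notin> set (take i zs)"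
      using zs(2) that by (auto simp: in_set_conv_nth nth_eq_iff_index_eq)
    moreover have "zs ! i \<notin> C" using zs(1) that by (metis ComplD less_le_trans nth_mem)
    ultimately have "var (zs ! i) \<in> Q j" "var (zs ! i) \<notin> Q i" by (simp_all add: Q_def var_in_var_prime)
    then show "Q i \<noteq> Q j" by blast
  qed
  then have "sorted_wrt (\<subset>) ps"
    by (auto simp: ps_def sorted_wrt_iff_nth_less simp del: upt_Suc)
  moreover have "prime_ideal P \<and> J \<subseteq> P" if P: "P \<in> set ps" for P
  proof -
    obtain i where i: "P = Q i" using P by (auto simp: ps_def simp del: upt_Suc)
    have "var_prime C \<subseteq> Q i" unfolding Q_def by (intro var_prime_mono) simp
    then show ?thesis using i assms prime_var_prime by (auto simp: Q_def)
  qed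
  moreover have len: "length ps - 1 = card (- C)" and "ps \<noteq> []"
    using zs distinct_card[of zs] by (simp_all add: ps_def del: upt_Suc)
  ultimately have "enat (length ps - 1) \<le> krull_dim_quot J"
    unfolding krull_dim_quot_def
    by (intro Sup_upper CollectI exI[of _ ps] conjI ballI refl) simp_all
  then show ?thesis by (simp only: len)
qed

section \<open>Chains of primes and counting of monomials\<close>

lemma ex_linear_dependence:
  fixes f :: "'a \<Rightarrow> 'b \<Rightarrow> 'k::field"
  assumes "finite B" "finite A" "card B < card A"
  shows "\<exists>c. (\<exists>a\<in>A. c a \<noteq> 0) \<and> (\<forall>b\<in>B. (\<Sum>a\<in>A. c a * f a b) = 0)"
  using assms
proof (induction B arbitrary: A f rule: finite_induct)
  case empty
  then have "A \<noteq> {}" by auto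
  then show ?case by (intro exI[of _ "\<lambda>_. 1"]) auto
next
  case (insert b B)
  show ?case
  proof (cases "\<forall>a\<in>A. f a b = 0")
    case True
    have "card B < card A" using insert by simp
    then obtain c where "\<exists>a\<in>A. c a \<noteq> 0" "\<forall>b\<in>B. (\<Sum>a\<in>A. c a * f a b) = 0"
      using insert.IH[OF insert.prems(1)] by blast
    moreover have "(\<Sum>a\<in>A. c a * f a b) = 0" using True by simp
    ultimately show ?thesis by blast
  next
    case False
    then obtain a0 where a0: "a0 \<in> A" "f a0 b \<noteq> 0" by blast
    let ?A = "A - {a0}"
    define f' where "f' a b' = f a b' - f a b / f a0 b * f a0 b'" for a b'
    have "finite ?A" "card B < card ?A" using insert a0 by auto
    then obtain c where c: "\<exists>a\<in>?A. c a \<noteq> 0" "\<forall>b\<in>B. (\<Sum>a\<in>?A. c a * f' a b) = 0"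
      using insert.IH[of ?A f'] by blast
    define c' where "c' = c(a0 := - (\<Sum>a\<in>?A. c a * (f a b / f a0 b)))"
    have "(\<Sum>a\<in>A. c' a * f a b') = (\<Sum>a\<in>?A. c a * f' a b')" for b'
    proof -
      have "(\<Sum>a\<in>A. c' a * f a b') = c' a0 * f a0 b' + (\<Sum>a\<in>?A. c' a * f a b')"
        using insert.prems a0 by (intro sum.remove) auto
      also have "(\<Sum>a\<in>?A. c' a * f a b') = (\<Sum>a\<in>?A. c a * f a b')"
        by (intro sum.cong) (auto simp: c'_def)
      also have "c' a0 * f a0 b' = (\<Sum>a\<in>?A. - (c a * (f a b / f a0 b) * f a0 b'))"
        by (simp add: c'_def sum_distrib_right sum_negf)
      finally show ?thesis
        unfolding f'_def by (simp add: sum.distrib[symmetric] algebra_simps)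
    qed
    moreover have "f' a b = 0" for a using a0 by (simp add: f'_def)
    ultimately have "\<forall>b'\<in>insert b B. (\<Sum>a\<in>A. c' a * f a b') = 0" using c(2) by simp
    moreover have "\<exists>a\<in>A. c' a \<noteq> 0" using c(1) by (auto simp: c'_def)
    ultimately show ?thesis by blast
  qed
qed

fun mon :: "(nat \<Rightarrow> 'a::comm_ring_1) \<Rightarrow> nat \<Rightarrow> nat list \<Rightarrow> 'a" where
  "mon f k [] = 1"
| "mon f k (e # es) = f k ^ e * mon f (Suc k) es"

lemma prime_ideal_power:
  assumes "prime_ideal P" "a ^ n \<in> P"
  shows "a \<in> P"
  using assms(2) by (induction n) (use assms(1) in \<open>auto simp: prime_ideal_def\<close>)

text \<open>The lowest term, in the lexicographic order, of a polynomial relation between elements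
  \<open>f i\<close> separating the members of a chain of primes cannot be cancelled.\<close>

lemma chain_of_primes_independent:
  fixes P :: "nat \<Rightarrow> ('v, 'k::field) mpoly set"
  assumes prime: "\<And>i. i \<le> n \<Longrightarrow> prime_ideal (P i)"
    and sub: "\<And>i. i < n \<Longrightarrow> P i \<subseteq> P (Suc i)"
    and f: "\<And>i. i < n \<Longrightarrow> f i \<in> P (Suc i)" "\<And>i. i < n \<Longrightarrow> f i \<notin> P i"
    and "k + j = n" "finite X" "X \<noteq> {}" "\<And>e. e \<in> X \<Longrightarrow> length e = j" "\<And>e. e \<in> X \<Longrightarrow> c e \<noteq> 0"
  shows "(\<Sum>e\<in>X. single 0 (c e) * mon f k e) \<notin> P k"
  using assms(5-)
proof (induction j arbitrary: k X c)
  case 0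
  then have X: "X = {[]}" by auto
  have P: "is_ideal (P k)" "1 \<notin> P k" using prime[of k] 0 by (auto simp: prime_ideal_def)
  show ?case
  proof
    assume "(\<Sum>e\<in>X. single 0 (c e) * mon f k e) \<in> P k"
    then have "single 0 (c []) \<in> P k" by (simp add: X)
    then have "single 0 (1 / c []) * single 0 (c []) \<in> P k" by (rule ideal_mult[OF P(1)])
    moreover have "c [] \<noteq> 0" using 0 X by simp
    ultimately show False using P(2) by (simp add: mult_single)
  qed
next
  case (Suc j)
  have k: "k < n" using Suc.prems(1) by simp
  have Pk: "prime_ideal (P k)" and P': "is_ideal (P (Suc k))"
    using prime[of k] prime[of "Suc k"] k by (auto simp: prime_ideal_def)
  \<comment> \<open>\<open>h\<close> is the lowest exponent of \<open>f k\<close>. As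
    \<open>f k\<close> is outside the prime \<open>P k\<close>, its \<open>h\<close>-th power can be
    cancelled; the terms with a higher exponent keep a factor \<open>f k\<close>, which lies in
    \<open>P (Suc k)\<close>. The terms with exponent \<open>h\<close> thus give a relation modulo
    \<open>P (Suc k)\<close> with one element fewer.\<close>
  define h where "h = Min (hd ` X)"
  have "h \<in> hd ` X" unfolding h_def using Suc.prems by (intro Min_in) auto
  have hmin: "h \<le> hd e" if "e \<in> X" for e unfolding h_def using Suc.prems that by (intro Min_le) auto
  have e_eq: "e = hd e # tl e" if "e \<in> X" for e using Suc.prems(4)[OF that] by (cases e) auto
  show ?case
  proof
    assume in_P: "(\<Sum>e\<in>X. single 0 (c e) * mon f k e) \<in> P k"
    define T where "T e = single 0 (c e) * (f k ^ (hd e - h) * mon f (Suc k) (tl e))" for e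
    have "single 0 (c e) * mon f k e = f k ^ h * T e" if "e \<in> X" for e
    proof -
      have "mon f k e = f k ^ hd e * mon f (Suc k) (tl e)" by (subst e_eq[OF that]) simp
      also have "f k ^ hd e = f k ^ h * f k ^ (hd e - h)" using hmin[OF that] by (simp flip: power_add)
      finally show ?thesis by (simp add: T_def mult_ac)
    qed
    then have "(\<Sum>e\<in>X. single 0 (c e) * mon f k e) = f k ^ h * (\<Sum>e\<in>X. T e)"
      by (simp add: sum_distrib_left)
    then have "f k ^ h \<in> P k \<or> (\<Sum>e\<in>X. T e) \<in> P k"
      using in_P Pk by (auto simp: prime_ideal_def)
    then have "(\<Sum>e\<in>X. T e) \<in> P (Suc k)"
      using prime_ideal_power[OF Pk] f(2)[OF k] sub[OF k] by blast
    moreover have "(\<Sum>e\<in>{e\<in>X. hd e \<noteq> h}. T e) \<in> P (Suc k)"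
    proof (rule ideal_sum[OF P'])
      fix e assume e: "e \<in> {e\<in>X. hd e \<noteq> h}"
      then have "h < hd e" using hmin[of e] by auto
      then have "f k ^ (hd e - h) = f k ^ (hd e - h - 1) * f k"
        by (metis Suc_diff_1 power_Suc2 zero_less_diff)
      then have "T e = (single 0 (c e) * f k ^ (hd e - h - 1) * mon f (Suc k) (tl e)) * f k"
        by (simp add: T_def mult_ac)
      then show "T e \<in> P (Suc k)" using ideal_mult[OF P' f(1)[OF k]] by simp
    qed
    moreover have "(\<Sum>e\<in>X. T e) = (\<Sum>e\<in>{e\<in>X. hd e = h}. T e) + (\<Sum>e\<in>{e\<in>X. hd e \<noteq> h}. T e)"
    proof -
      have "X = {e\<in>X. hd e = h} \<union> {e\<in>X. hd e \<noteq> h}" by auto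
      then show ?thesis using Suc.prems(2) by (subst sum.union_disjoint[symmetric]) auto
    qed
    ultimately have low: "(\<Sum>e\<in>{e\<in>X. hd e = h}. T e) \<in> P (Suc k)"
      using ideal_diff[OF P', of "\<Sum>e\<in>X. T e" "\<Sum>e\<in>{e\<in>X. hd e \<noteq> h}. T e"] by simp
    define X' where "X' = {e. h # e \<in> X}"
    have img: "{e\<in>X. hd e = h} = (\<lambda>e. h # e) ` X'"
    proof
      show "{e\<in>X. hd e = h} \<subseteq> (\<lambda>e. h # e) ` X'"
      proof
        fix e assume "e \<in> {e\<in>X. hd e = h}"
        then have "e = h # tl e" "e \<in> X" using e_eq[of e] by auto
        then show "e \<in> (\<lambda>e. h # e) ` X'" unfolding X'_def by (metis image_eqI mem_Collect_eq)
      qed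
    qed (auto simp: X'_def)
    have "(\<Sum>e\<in>{e\<in>X. hd e = h}. T e) = (\<Sum>e\<in>X'. single 0 (c (h # e)) * mon f (Suc k) e)"
      unfolding img by (subst sum.reindex) (auto simp: inj_on_def T_def)
    moreover have "(\<Sum>e\<in>X'. single 0 (c (h # e)) * mon f (Suc k) e) \<notin> P (Suc k)"
    proof (rule Suc.IH)
      have "finite ((\<lambda>e. h # e) ` X')" using Suc.prems(2) unfolding img[symmetric] by simp
      then show "finite X'" by (rule finite_imageD) (simp add: inj_on_def)
      show "X' \<noteq> {}" using \<open>h \<in> hd ` X\<close> img by auto
      show "length e = j" if "e \<in> X'" for e using Suc.prems(4) that by (fastforce simp: X'_def)
    qed (use Suc.prems in \<open>auto simp: X'_def\<close>)
    ultimately show False using low by simp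
  qed
qed

definition expts_le :: "('v, 'k::field) mpoly \<Rightarrow> nat \<Rightarrow> bool" where
  "expts_le p d \<longleftrightarrow> (\<forall>m\<in>keys p. \<forall>v. lookup m v \<le> d)"

lemma expts_le_mult:
  assumes "expts_le p d" "expts_le q e"
  shows "expts_le (p * q) (d + e)"
  unfolding expts_le_def
proof (intro ballI allI)
  fix m v assume "m \<in> keys (p * q)"
  then obtain a b where "m = a + b" "a \<in> keys p" "b \<in> keys q" using keys_mult[of p q] by blast
  then show "lookup m v \<le> d + e" using assms by (simp add: expts_le_def lookup_add add_mono)
qed

lemma expts_le_1: "expts_le 1 0"
  by (simp add: expts_le_def)

lemma expts_le_power: "expts_le p d \<Longrightarrow> expts_le (p ^ n) (d * n)"
  by (induction n) (use expts_le_mult expts_le_1 in \<open>auto simp: add.commute\<close>)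

lemma expts_le_mon:
  assumes "\<And>i. i < k + length es \<Longrightarrow> expts_le (f i) d"
  shows "expts_le (mon f k es) (d * sum_list es)"
  using assms
proof (induction es arbitrary: k)
  case (Cons e es)
  have "expts_le (mon f (Suc k) es) (d * sum_list es)" using Cons by simp
  moreover have "expts_le (f k ^ e) (d * e)" using Cons.prems by (intro expts_le_power) simp
  ultimately show ?case using expts_le_mult by (fastforce simp: distrib_left)
qed (simp add: expts_le_1)

lemma card_bounded_expts:
  fixes C :: "('v::finite) set"
  shows "finite {m :: 'v \<Rightarrow>\<^sub>0 nat. keys m \<inter> C = {} \<and> (\<forall>v. lookup m v \<le> d)}"
    and "card {m :: 'v \<Rightarrow>\<^sub>0 nat. keys m \<inter> C = {} \<and> (\<forall>v. lookup m v \<le> d)} \<le> Suc d ^ card (- C)"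
proof -
  let ?B = "{m :: 'v \<Rightarrow>\<^sub>0 nat. keys m \<inter> C = {} \<and> (\<forall>v. lookup m v \<le> d)}"
  let ?h = "\<lambda>m. restrict (lookup m) (- C)"
  have inj: "inj_on ?h ?B"
  proof (rule inj_onI)
    fix m n assume mn: "m \<in> ?B" "n \<in> ?B" "?h m = ?h n"
    show "m = n"
    proof (rule poly_mapping_eqI)
      fix v show "lookup m v = lookup n v"
      proof (cases "v \<in> C")
        case True
        then have "v \<notin> keys m" "v \<notin> keys n" using mn by auto
        then show ?thesis by (simp add: in_keys_iff)
      next
        case False
        then show ?thesis using fun_cong[OF mn(3), of v] by simp
      qed
    qed
  qed
  have sub: "?h ` ?B \<subseteq> (- C) \<rightarrow>\<^sub>E {..d}" by auto
  have fin: "finite ((- C) \<rightarrow>\<^sub>E {..d})" by (intro finite_PiE) auto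
  show "finite ?B" using finite_imageD[OF finite_subset[OF sub fin] inj] .
  have "card ?B = card (?h ` ?B)" using card_image[OF inj] by simp
  also have "\<dots> \<le> card ((- C) \<rightarrow>\<^sub>E {..d})" by (rule card_mono[OF fin sub])
  also have "\<dots> = Suc d ^ card (- C)" by (simp add: card_PiE)
  finally show "card ?B \<le> Suc d ^ card (- C)" .
qed

lemma sum_list_le: "(\<And>x. x \<in> set es \<Longrightarrow> x \<le> T) \<Longrightarrow> sum_list es \<le> length es * (T :: nat)"
  by (induction es) (auto intro: add_mono)

text \<open>\<open>N\<close> variables survive modulo \<open>P 0\<close>. A chain with
  \<open>N + 1\<close> steps yields \<open>N + 1\<close> separating elements, whose monomials with
  exponents below \<open>T\<close> number T^(N+1), while modulo \<open>P 0\<close> they lie in a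
  space spanned by at most a constant times T^N monomials. For large \<open>T\<close> this gives a
  linear relation modulo \<open>P 0\<close>, contrary to
  \<open>chain_of_primes_independent\<close>.\<close>

lemma no_long_chain_of_primes:
  fixes P :: "nat \<Rightarrow> ('v::finite, 'k::field) mpoly set"
  defines "N \<equiv> card {v. var v \<notin> P 0}"
  assumes prime: "\<And>i. i \<le> Suc N \<Longrightarrow> prime_ideal (P i)"
    and chain: "\<And>i. i \<le> N \<Longrightarrow> P i \<subset> P (Suc i)"
  shows False
proof -
  let ?C = "{v. var v \<in> P 0}"
  have N: "N = card (- ?C)" unfolding N_def by (intro arg_cong[of _ _ card]) auto
  have "\<forall>i. \<exists>g. i \<le> N \<longrightarrow> g \<in> P (Suc i) \<and> g \<notin> P i" using chain by blast
  then obtain f where f: "\<And>i. i \<le> N \<Longrightarrow> f i \<in> P (Suc i)" "\<And>i. i \<le> N \<Longrightarrow> f i \<notin> P i" by metis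
  have "finite ((\<lambda>(m, v). lookup m v) ` ((\<Union>i\<le>N. keys (f i)) \<times> (UNIV :: 'v set)))" by simp
  then obtain d where "\<forall>k\<in>(\<lambda>(m, v). lookup m v) ` ((\<Union>i\<le>N. keys (f i)) \<times> (UNIV :: 'v set)). k \<le> d"
    by (auto simp: finite_nat_set_iff_bounded_le)
  then have d: "expts_le (f i) d" if "i \<le> N" for i
    using that unfolding expts_le_def by force
  \<comment> \<open>A product of the \<open>f i\<close> with exponents below \<open>T\<close> has
    all exponents at most \<open>D\<close>. The factor \<open>a\<close> is chosen with
    \<open>Suc D \<le> a * T\<close>, and \<open>T\<close> exceeds \<open>a ^ N\<close>, so that
    \<open>(a * T) ^ N < T ^ Suc N\<close>.\<close>
  define a where "a = d * Suc N + 1"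
  define T where "T = a ^ N + 1"
  define D where "D = d * (Suc N * T)"
  define A where "A = {es. set es \<subseteq> {..<T} \<and> length es = Suc N}"
  define B where "B = {m :: 'v \<Rightarrow>\<^sub>0 nat. keys m \<inter> ?C = {} \<and> (\<forall>v. lookup m v \<le> D)}"
  have A: "finite A" "card A = T ^ Suc N"
    unfolding A_def using finite_lists_length_eq[of "{..<T}"] card_lists_length_eq[of "{..<T}"] by auto
  have "card B \<le> Suc D ^ N" unfolding B_def N by (rule card_bounded_expts)
  also have "\<dots> \<le> (a * T) ^ N"
  proof (rule power_mono)
    have "1 \<le> T" by (simp add: T_def)
    then show "Suc D \<le> a * T" by (simp add: D_def a_def algebra_simps)
  qed simp
  also have "\<dots> < T ^ Suc N"
  proof -
    have "a ^ N * T ^ N < T * T ^ N" by (rule mult_strict_right_mono) (simp_all add: T_def)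
    then show ?thesis by (simp add: power_mult_distrib)
  qed
  finally have "card B < card A" using A by simp
  moreover have "finite B" unfolding B_def by (rule card_bounded_expts)
  ultimately obtain c where c: "\<exists>e\<in>A. c e \<noteq> 0" "\<forall>b\<in>B. (\<Sum>e\<in>A. c e * lookup (mon f 0 e) b) = 0"
    using ex_linear_dependence[OF _ A(1), of B "\<lambda>e. lookup (mon f 0 e)"] by blast
  define X where "X = {e\<in>A. c e \<noteq> 0}"
  define S where "S = (\<Sum>e\<in>X. single 0 (c e) * mon f 0 e)"
  have lookup_S: "lookup S m = (\<Sum>e\<in>A. c e * lookup (mon f 0 e) m)" for m
  proof -
    have "lookup S m = (\<Sum>e\<in>X. c e * lookup (mon f 0 e) m)"
      by (simp add: S_def lookup_sum lookup_const_mult)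
    also have "\<dots> = (\<Sum>e\<in>A. c e * lookup (mon f 0 e) m)"
      using A(1) by (intro sum.mono_neutral_left) (auto simp: X_def)
    finally show ?thesis .
  qed
  have P0: "is_ideal (P 0)" using prime[of 0] by (simp add: prime_ideal_def)
  \<comment> \<open>A term divisible by a variable of \<open>P 0\<close> lies in \<open>P 0\<close>;
    every other exponent that could occur is in \<open>B\<close>, where the coefficients vanish by
    choice of \<open>c\<close>.\<close>
  have "S \<in> P 0"
  proof (rule poly_in_ideal[OF P0])
    fix m assume m: "m \<in> keys S"
    then have "\<exists>e\<in>A. lookup (mon f 0 e) m \<noteq> 0"
      unfolding in_keys_iff lookup_S by (metis (no_types, lifting) mult_zero_right sum.neutral)
    then obtain e where e: "e \<in> A" "m \<in> keys (mon f 0 e)" by (auto simp: in_keys_iff)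
    have "expts_le (mon f 0 e) (d * sum_list e)" using e d by (intro expts_le_mon) (simp add: A_def)
    moreover have "sum_list e \<le> Suc N * T"
    proof -
      have "sum_list e \<le> length e * T"
        using e(1) by (intro sum_list_le) (auto simp: A_def)
      then show ?thesis using e(1) by (simp add: A_def)
    qed
    then have "d * sum_list e \<le> D" unfolding D_def by (intro mult_left_mono) auto
    ultimately have "\<forall>v. lookup m v \<le> D" using e(2) unfolding expts_le_def by (meson order_trans)
    moreover have "m \<notin> B" using m c(2) by (auto simp: in_keys_iff lookup_S)
    ultimately obtain v where v: "v \<in> keys m" "var v \<in> P 0" unfolding B_def by blast
    have "m = (m - expt {v}) + single v 1"
      using expt_decomp[of "{v}" m] v(1) by (simp add: expt_def add.commute)
    moreover have "single ((m - expt {v}) + single v 1) (lookup S m) \<in> P 0"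
      using v(2) unfolding var_def by (rule single_in_ideal[OF P0])
    ultimately show "single m (lookup S m) \<in> P 0" by simp
  qed
  moreover have "S \<notin> P 0"
    unfolding S_def
  proof (rule chain_of_primes_independent[of "Suc N"])
    show "P i \<subseteq> P (Suc i)" if "i < Suc N" for i using chain[of i] that by auto
    show "finite X" "X \<noteq> {}" using A(1) c(1) by (auto simp: X_def)
    show "length e = Suc N" "c e \<noteq> 0" if "e \<in> X" for e using that by (auto simp: X_def A_def)
  qed (use prime f in auto)
  ultimately show False by simp
qed

lemma krull_dim_upper:
  fixes J :: "('v::finite, 'k::field) mpoly set"
  assumes "\<And>P. prime_ideal P \<Longrightarrow> J \<subseteq> P \<Longrightarrow> card {v. var v \<notin> P} \<le> g"
  shows "krull_dim_quot J \<le> enat g"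
  unfolding krull_dim_quot_def
proof (rule Sup_least, clarify)
  fix ps :: "('v, 'k) mpoly set list"
  assume ps: "ps \<noteq> []" "sorted_wrt (\<subset>) ps" "\<forall>P\<in>set ps. prime_ideal P \<and> J \<subseteq> P"
  show "enat (length ps - 1) \<le> enat g"
  proof (rule ccontr)
    assume "\<not> enat (length ps - 1) \<le> enat g"
    then have len: "Suc (Suc g) \<le> length ps" by auto
    have in_ps: "prime_ideal (ps ! i) \<and> J \<subseteq> ps ! i" if "i \<le> Suc g" for i
      using ps(3) len that by (auto intro: nth_mem)
    have N: "card {v. var v \<notin> ps ! 0} \<le> g" using assms in_ps[of 0] by blast
    show False
    proof (rule no_long_chain_of_primes[of "\<lambda>i. ps ! i"])
      fix i assume "i \<le> card {v. var v \<notin> ps ! 0}"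
      then show "ps ! i \<subset> ps ! Suc i"
        using N len by (intro sorted_wrt_nth_less[OF ps(2)]) auto
    qed (use in_ps N in auto)
  qed
qed

section \<open>Syzygies of the cover ideal\<close>

lemma module_span_superset: "W \<subseteq> module_span W"
proof
  fix w assume "w \<in> W"
  then show "w \<in> module_span W"
    unfolding module_span_def by (intro CollectI exI[of _ "{w}"] exI[of _ "\<lambda>_. 1"]) simp
qed

lemma module_span_zero: "(\<lambda>_. 0) \<in> module_span W"
  unfolding module_span_def by (intro CollectI exI[of _ "{}"]) simp

lemma module_span_scale:
  assumes "w \<in> module_span W"
  shows "(\<lambda>i. r * w i) \<in> module_span W"
proof -
  obtain F c where F: "finite F" "F \<subseteq> W" "w = (\<lambda>i. \<Sum>x\<in>F. c x * x i)"
    using assms unfolding module_span_def by blast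
  then have "(\<lambda>i. r * w i) = (\<lambda>i. \<Sum>x\<in>F. (r * c x) * x i)"
    by (simp add: sum_distrib_left mult.assoc)
  then show ?thesis unfolding module_span_def using F(1,2)
    by (intro CollectI exI[of _ F] exI[of _ "\<lambda>x. r * c x"] conjI)
qed

lemma module_span_add:
  assumes "w \<in> module_span W" "z \<in> module_span W"
  shows "(\<lambda>i. w i + z i) \<in> module_span W"
proof -
  obtain F c where F: "finite F" "F \<subseteq> W" "w = (\<lambda>i. \<Sum>x\<in>F. c x * x i)"
    using assms(1) unfolding module_span_def by blast
  obtain G d where G: "finite G" "G \<subseteq> W" "z = (\<lambda>i. \<Sum>x\<in>G. d x * x i)"
    using assms(2) unfolding module_span_def by blast
  have "w i = (\<Sum>x\<in>F \<union> G. (if x \<in> F then c x else 0) * x i)" for i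
    unfolding F(3) using F(1) G(1) by (intro sum.mono_neutral_cong_left) auto
  moreover have "z i = (\<Sum>x\<in>F \<union> G. (if x \<in> G then d x else 0) * x i)" for i
    unfolding G(3) using F(1) G(1) by (intro sum.mono_neutral_cong_left) auto
  ultimately have "(\<lambda>i. w i + z i)
      = (\<lambda>i. \<Sum>x\<in>F \<union> G. ((if x \<in> F then c x else 0) + (if x \<in> G then d x else 0)) * x i)"
    by (simp only: distrib_right sum.distrib)
  moreover have "finite (F \<union> G)" "F \<union> G \<subseteq> W" using F G by auto
  ultimately show ?thesis unfolding module_span_def
    by (intro CollectI exI[of _ "F \<union> G"] exI conjI)
qed

lemma module_span_sum:
  assumes "\<And>a. a \<in> A \<Longrightarrow> f a \<in> module_span W"
  shows "(\<lambda>i. \<Sum>a\<in>A. f a i) \<in> module_span W"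
  using assms
proof (induction A rule: infinite_finite_induct)
  case (insert a A)
  then have "(\<lambda>i. f a i + (\<Sum>a\<in>A. f a i)) \<in> module_span W" by (intro module_span_add) auto
  then show ?case using insert.hyps by simp
qed (simp_all add: module_span_zero)

lemma linear_form_var: "linear_form (var v)" and linear_form_uminus_var: "linear_form (- var v)"
  by (simp_all add: linear_form_def var_def lookup_single when_def)

lemma linear_form_zero: "linear_form 0"
  by (simp add: linear_form_def)

lemma degree_one_expt:
  fixes k :: "'v::finite \<Rightarrow>\<^sub>0 nat"
  assumes "(\<Sum>v\<in>UNIV. lookup k v) = 1"
  obtains v where "k = single v 1"
proof -
  obtain v where "lookup k v \<noteq> 0" using assms by (metis sum.neutral zero_neq_one)
  moreover have "lookup k v + (\<Sum>u\<in>UNIV - {v}. lookup k u) = 1"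
    using assms sum.remove[of UNIV v "lookup k"] by simp
  ultimately have v: "lookup k v = 1" and "(\<Sum>u\<in>UNIV - {v}. lookup k u) = 0" by linarith+
  then have v': "lookup k u = 0" if "u \<noteq> v" for u using that by simp
  have "k = single v 1"
    by (rule poly_mapping_eqI) (auto simp: lookup_single when_def v v')
  then show thesis by (rule that)
qed

lemma monom_of_Diff_mult:
  fixes C D :: "('v::finite) set"
  shows "monom_of (D - C) * monom_of C = monom_of (C \<union> D)"
proof -
  have "C \<union> D = (D - C) \<union> C" by auto
  then show ?thesis
    unfolding monom_of_def by (simp only: prod.union_disjoint[of "D - C" C, symmetric] finite Diff_disjoint Int_commute)
qed

section \<open>Linear syzygies and the components of the cover graph\<close>

context P_matching
begin

abbreviation covers :: "'v set set" where
  "covers \<equiv> {C. min_vertex_cover E C}"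

abbreviation linear_syzygies :: "('v set \<Rightarrow> ('v, 'k::field) mpoly) set" where
  "linear_syzygies \<equiv> {w \<in> syzygies E. \<forall>C. linear_form (w C)}"

lemma two_term_syzygy:
  fixes C D :: "'v set"
  assumes "min_vertex_cover E C" "min_vertex_cover E D" "C \<noteq> D"
  shows "(\<lambda>X. if X = C then monom_of (D - C) else if X = D then - monom_of (C - D) else 0)
    \<in> (syzygies E :: ('v set \<Rightarrow> ('v, 'k::field) mpoly) set)"
proof -
  let ?z = "\<lambda>X. if X = C then monom_of (D - C) else if X = D then - monom_of (C - D) else (0 :: ('v, 'k) mpoly)"
  have "(\<Sum>X\<in>covers. ?z X * monom_of X) = (\<Sum>X\<in>{C, D}. ?z X * monom_of X)"
    using assms by (intro sum.mono_neutral_right) auto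
  also have "\<dots> = monom_of (D - C) * monom_of C - monom_of (C - D) * monom_of D"
    using assms(3) by simp
  also have "\<dots> = 0" by (simp add: monom_of_Diff_mult Un_commute)
  finally show ?thesis using assms by (auto simp: syzygies_def)
qed

lemma adjacent_if_common_multiple:
  assumes C: "min_vertex_cover E C" and D: "min_vertex_cover E D" and "C \<noteq> D"
    and eq: "expt C + single v 1 = expt D + single w (1::nat)"
  shows "cover_graph_adj E C D"
proof -
  have "D \<subseteq> insert v C"
  proof
    fix u assume "u \<in> D"
    then show "u \<in> insert v C"
      using arg_cong[OF eq, of "\<lambda>k. lookup k u"]
      by (auto simp: lookup_add lookup_expt lookup_single when_def split: if_splits)
  qed
  then have "C \<union> D \<subseteq> insert v C" by auto
  then have "card (C \<union> D) \<le> card (insert v C)" by (intro card_mono) auto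
  also have "\<dots> \<le> card C + 1" by (simp add: card_insert_if)
  finally have "card (C \<union> D) \<le> card C + 1" .
  moreover have "card C < card (C \<union> D)"
  proof (intro psubset_card_mono)
    show "C \<subset> C \<union> D"
      using card_min_vertex_cover_eq[OF C D] \<open>C \<noteq> D\<close> by (metis Un_upper1 card_subset_eq finite psubsetI subset_Un_eq sup_commute)
  qed simp
  ultimately show ?thesis using assms(1-3) by (simp add: cover_graph_adj_def)
qed

text \<open>In a fixed multidegree \<open>n\<close>, the covers contributing to a linear syzygy
  divide the monomial \<open>n\<close> with a quotient of degree one, hence are pairwise adjacent.
  They lie all in \<open>A\<close> or all outside it, so the relation splits.\<close>

lemma linear_syzygy_component:
  fixes w :: "'v set \<Rightarrow> ('v, 'k::field) mpoly"
  assumes w: "w \<in> linear_syzygies" and A: "A \<subseteq> covers"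
    and closed: "\<And>C D. C \<in> A \<Longrightarrow> cover_graph_adj E C D \<Longrightarrow> D \<in> A"
  shows "(\<Sum>C\<in>A. w C * monom_of C) = 0"
proof (rule poly_mapping_eqI)
  fix n
  let ?l = "\<lambda>C. lookup (w C * monom_of C) n"
  have total: "(\<Sum>C\<in>covers. ?l C) = 0"
  proof -
    have "(\<Sum>C\<in>covers. w C * monom_of C) = 0" using w by (simp add: syzygies_def)
    then show ?thesis by (simp flip: lookup_sum)
  qed
  have l: "\<exists>v. n = expt C + single v 1" if lC: "?l C \<noteq> 0" for C
  proof -
    have "w C * monom_of C = single (expt C) 1 * w C" by (simp add: monom_of_eq mult.commute)
    then obtain k where k: "n = expt C + k" using lC lookup_single_mult_0[of "expt C" n 1 "w C"] by metis
    then have "lookup (w C) k \<noteq> 0"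
      using lC \<open>w C * monom_of C = _\<close> lookup_single_mult[of "expt C" 1 "w C" k] by simp
    then have "(\<Sum>v\<in>UNIV. lookup k v) = 1"
      using w by (auto simp: linear_form_def in_keys_iff)
    then obtain v where "k = single v 1" by (rule degree_one_expt)
    then show ?thesis using k by blast
  qed
  have "(\<Sum>C\<in>A. ?l C) = 0"
  proof (cases "\<exists>C\<in>A. ?l C \<noteq> 0")
    case True
    then obtain C where C: "C \<in> A" "?l C \<noteq> 0" by blast
    have "?l D = 0" if D: "D \<in> covers - A" for D
    proof (rule ccontr)
      assume "?l D \<noteq> 0"
      then obtain v u where "n = expt C + single v 1" "n = expt D + single u 1" using l C(2) by metis
      then have eq: "expt C + single v 1 = expt D + single u 1" by simp
      have "min_vertex_cover E C" "min_vertex_cover E D" "C \<noteq> D" using A C(1) D by auto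
      then have "cover_graph_adj E C D" using eq by (rule adjacent_if_common_multiple)
      then show False using closed C(1) D by blast
    qed
    then have "(\<Sum>C\<in>A. ?l C) = (\<Sum>C\<in>covers. ?l C)" using A by (intro sum.mono_neutral_left) auto
    then show ?thesis using total by simp
  qed auto
  then show "lookup (\<Sum>C\<in>A. w C * monom_of C) n = lookup 0 n" by (simp add: lookup_sum)
qed

text \<open>Summing \<open>w X * monom_of X\<close> over the component of \<open>C\<close> is linear
  in \<open>w\<close> and vanishes on linear syzygies, but takes the value
  \<open>monom_of (C \<union> D)\<close> on the two-term syzygy of \<open>C\<close> with a cover
  \<open>D\<close> outside the component.\<close>

lemma connected_if_linearly_presented:
  assumes "linearly_presented_cover_ideal TYPE('k::field) E"
  shows "cover_graph_connected E"
proof (rule ccontr)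
  let ?R = "\<lambda>X Y. cover_graph_adj E X Y \<or> cover_graph_adj E Y X"
  assume "\<not> cover_graph_connected E"
  then obtain C D where C: "min_vertex_cover E C" and D: "min_vertex_cover E D" and not: "\<not> ?R\<^sup>*\<^sup>* C D"
    by (auto simp: cover_graph_connected_def)
  define A where "A = {X. min_vertex_cover E X \<and> ?R\<^sup>*\<^sup>* C X}"
  have closed: "Y \<in> A" if "X \<in> A" "cover_graph_adj E X Y" for X Y
  proof -
    have "?R\<^sup>*\<^sup>* C X" "?R X Y" using that by (auto simp: A_def)
    then have "?R\<^sup>*\<^sup>* C Y" by (rule rtranclp.rtrancl_into_rtrancl)
    then show ?thesis using that by (auto simp: A_def cover_graph_adj_def)
  qed
  have CA: "C \<in> A" and DA: "D \<notin> A" and "C \<noteq> D" using C not by (auto simp: A_def)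
  define z :: "'v set \<Rightarrow> ('v, 'k) mpoly" where
    "z = (\<lambda>X. if X = C then monom_of (D - C) else if X = D then - monom_of (C - D) else 0)"
  have "z \<in> syzygies E" unfolding z_def using C D \<open>C \<noteq> D\<close> by (rule two_term_syzygy)
  then have "z \<in> module_span linear_syzygies"
    using assms unfolding linearly_presented_cover_ideal_def by blast
  then obtain F c where F: "finite F" "F \<subseteq> linear_syzygies" "z = (\<lambda>X. \<Sum>x\<in>F. c x * x X)"
    unfolding module_span_def by blast
  have "(\<Sum>X\<in>A. z X * monom_of X) = (\<Sum>x\<in>F. c x * (\<Sum>X\<in>A. x X * monom_of X))"
    unfolding F(3) by (simp add: sum_distrib_right sum_distrib_left mult.assoc) (rule sum.swap)
  also have "\<dots> = 0"
  proof (rule sum.neutral, rule ballI)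
    fix x assume "x \<in> F"
    then have x: "x \<in> linear_syzygies" by (rule subsetD[OF F(2)])
    have "A \<subseteq> covers" by (auto simp: A_def)
    then have "(\<Sum>X\<in>A. x X * monom_of X) = 0" using closed by (rule linear_syzygy_component[OF x])
    then show "c x * (\<Sum>X\<in>A. x X * monom_of X) = 0" by simp
  qed
  finally have "(\<Sum>X\<in>A. z X * monom_of X) = 0" .
  moreover have "(\<Sum>X\<in>A. z X * monom_of X) = (\<Sum>X\<in>{C}. z X * monom_of X)"
    using CA DA by (intro sum.mono_neutral_right) (auto simp: z_def)
  moreover have "\<dots> = monom_of (C \<union> D)" by (simp add: z_def monom_of_Diff_mult)
  ultimately have "(monom_of (C \<union> D) :: ('v, 'k) mpoly) = 0" by simp
  then have "lookup (monom_of (C \<union> D) :: ('v, 'k) mpoly) (expt (C \<union> D)) = 0" by simp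
  then show False by (simp add: monom_of_eq)
qed

text \<open>The multiple of the basis vector of \<open>C\<close> that maps to the monomial
  \<open>n\<close>. The subtraction is truncated, so this reading requires
  \<open>C \<subseteq> keys n\<close>.\<close>

definition shifted_unit :: "('v \<Rightarrow>\<^sub>0 nat) \<Rightarrow> 'v set \<Rightarrow> 'v set \<Rightarrow> ('v, 'k::field) mpoly" where
  "shifted_unit n C X = (if X = C then single (n - expt C) 1 else 0)"

text \<open>For adjacent covers the two-term syzygy has single variables as entries, up to sign; the
  difference is its multiple by \<open>n\<close> divided by the least common multiple.\<close>

lemma shifted_unit_adjacent:
  assumes adj: "cover_graph_adj E C D" and sub: "C \<subseteq> keys n" "D \<subseteq> keys n"
  shows "(\<lambda>X. shifted_unit n C X - shifted_unit n D X)
    \<in> module_span (linear_syzygies :: ('v set \<Rightarrow> ('v, 'k::field) mpoly) set)"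
proof -
  have C: "min_vertex_cover E C" and D: "min_vertex_cover E D" and "C \<noteq> D"
    and card: "card (C \<union> D) = card C + 1"
    using adj by (auto simp: cover_graph_adj_def)
  have "card (D - C) = 1"
  proof -
    have "D - C = (C \<union> D) - C" by auto
    then show ?thesis using card by (simp add: card_Diff_subset)
  qed
  then obtain b where b: "D - C = {b}" by (auto simp: card_1_singleton_iff)
  have "card (C - D) = 1"
  proof -
    have "C - D = (C \<union> D) - D" by auto
    then show ?thesis using card card_min_vertex_cover_eq[OF C D] by (simp add: card_Diff_subset)
  qed
  then obtain a where a: "C - D = {a}" by (auto simp: card_1_singleton_iff)
  define z :: "'v set \<Rightarrow> ('v, 'k) mpoly" where
    "z = (\<lambda>X. if X = C then var b else if X = D then - var a else 0)"
  have monom_of_singleton: "monom_of {v} = (var v :: ('v, 'k) mpoly)" for v :: 'v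
    by (simp add: monom_of_def)
  have "z \<in> syzygies E"
    using two_term_syzygy[OF C D \<open>C \<noteq> D\<close>, where 'k = 'k]
    unfolding a b monom_of_singleton z_def .
  moreover have "linear_form (z X)" for X
    by (simp add: z_def linear_form_var linear_form_uminus_var linear_form_zero)
  ultimately have "z \<in> linear_syzygies" by simp
  then have "z \<in> module_span linear_syzygies" by (rule subsetD[OF module_span_superset])
  then have "(\<lambda>X. single (n - expt (C \<union> D)) 1 * z X) \<in> module_span linear_syzygies"
    by (rule module_span_scale)
  moreover have "single (n - expt (C \<union> D)) 1 * z X = shifted_unit n C X - shifted_unit n D X" for X
  proof -
    have shift: "n - expt (C \<union> D) + single c 1 = n - expt B"
      if "C \<union> D = insert c B" "c \<notin> B" for c and B :: "'v set"
    proof (rule poly_mapping_eqI)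
      fix v
      have "c \<in> keys n" using that sub by auto
      then have "1 \<le> lookup n c" by (auto simp: in_keys_iff)
      then show "lookup (n - expt (C \<union> D) + single c 1) v = lookup (n - expt B) v"
        using that by (auto simp: lookup_add lookup_minus lookup_expt lookup_single when_def)
    qed
    have "n - expt (C \<union> D) + single b 1 = n - expt C" "n - expt (C \<union> D) + single a 1 = n - expt D"
      using a b by (intro shift; blast)+
    then have "single (n - expt (C \<union> D)) 1 * var b = (single (n - expt C) 1 :: ('v, 'k) mpoly)"
      "single (n - expt (C \<union> D)) 1 * var a = (single (n - expt D) 1 :: ('v, 'k) mpoly)"
      by (simp_all add: var_def mult_single)
    then show ?thesis using \<open>C \<noteq> D\<close> by (simp add: z_def shifted_unit_def)
  qed
  ultimately show ?thesis by simp
qed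

lemma shifted_unit_path:
  assumes nodup: "\<not> has_duplicated_vertices E"
    and C: "min_vertex_cover E C" "C \<subseteq> keys n" and D: "min_vertex_cover E D" "D \<subseteq> keys n"
  shows "(\<lambda>X. shifted_unit n C X - shifted_unit n D X)
    \<in> module_span (linear_syzygies :: ('v set \<Rightarrow> ('v, 'k::field) mpoly) set)"
  using cover_graph_path[OF nodup C(1) D(1)]
proof (induction rule: rtranclp_induct)
  case base
  show ?case by (simp add: module_span_zero)
next
  case (step Y Z)
  then have "(\<lambda>X. shifted_unit n Y X - shifted_unit n Z X)
      \<in> module_span (linear_syzygies :: ('v set \<Rightarrow> ('v, 'k) mpoly) set)"
    using C(2) D(2) by (intro shifted_unit_adjacent) auto
  from module_span_add[OF step.IH this] show ?case by simp
qed

text \<open>Modulo linear syzygies a term can be moved to one fixed cover per multidegree. The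
  resulting normal form \<open>\<psi>\<close> depends only on the image of a vector in the ideal, so
  it is zero for a syzygy, and every syzygy is congruent to its normal form.\<close>

lemma linearly_presented_if_no_duplicates:
  assumes nodup: "\<not> has_duplicated_vertices E"
  shows "linearly_presented_cover_ideal TYPE('k::field) E"
proof -
  let ?L = "module_span (linear_syzygies :: ('v set \<Rightarrow> ('v, 'k) mpoly) set)"
  \<comment> \<open>The choice is arbitrary when no minimal cover divides the monomial
    \<open>n\<close>; this never happens for an exponent of \<open>p * monom_of C\<close>.\<close>
  define cov where "cov n = (SOME C. min_vertex_cover E C \<and> C \<subseteq> keys n)" for n :: "'v \<Rightarrow>\<^sub>0 nat"
  have cov: "min_vertex_cover E (cov n)" "cov n \<subseteq> keys n" if "min_vertex_cover E C" "C \<subseteq> keys n" for C n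
    using someI[of "\<lambda>C. min_vertex_cover E C \<and> C \<subseteq> keys n" C] that by (auto simp: cov_def)
  define \<psi> :: "('v, 'k) mpoly \<Rightarrow> 'v set \<Rightarrow> ('v, 'k) mpoly" where
    "\<psi> p X = (\<Sum>n\<in>keys p. single 0 (lookup p n) * shifted_unit n (cov n) X)" for p X
  have \<psi>_add: "\<psi> (p + q) X = \<psi> p X + \<psi> q X" for p q X
    unfolding \<psi>_def by (rule setsum_keys_plus_distrib) (simp_all add: single_add distrib_right)
  have \<psi>_0: "\<psi> 0 X = 0" for X by (simp add: \<psi>_def)
  have \<psi>_single: "\<psi> (single n c) X = single 0 c * shifted_unit n (cov n) X" for n c X
    by (simp add: \<psi>_def)
  have \<psi>_sum: "\<psi> (\<Sum>C\<in>A. f C) X = (\<Sum>C\<in>A. \<psi> (f C) X)" for A :: "'v set set" and f X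
    by (induction A rule: infinite_finite_induct) (simp_all add: \<psi>_0 \<psi>_add)
  have claim: "(\<lambda>X. (if X = C then p else 0) - \<psi> (p * monom_of C) X) \<in> ?L"
    if C: "min_vertex_cover E C" for C p
  proof (induction p rule: poly_induct)
    case zero
    show ?case by (simp add: \<psi>_0 module_span_zero cong: if_cong)
  next
    case (single k c)
    define n where "n = k + expt C"
    have Cn: "C \<subseteq> keys n" by (simp add: n_def keys_plus_nat keys_expt)
    have k: "n - expt C = k" by (simp add: n_def)
    have "(\<lambda>X. single 0 c * (shifted_unit n C X - shifted_unit n (cov n) X)) \<in> ?L"
      using C Cn cov by (intro module_span_scale shifted_unit_path[OF nodup]) blast+
    moreover have "single k c * monom_of C = single n c" by (simp add: monom_of_eq mult_single n_def)
    moreover have "(if X = C then single k c else 0) = single 0 c * shifted_unit n C X" for X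
      by (simp add: shifted_unit_def k mult_single)
    ultimately show ?case by (simp add: \<psi>_single right_diff_distrib)
  next
    case (add p q)
    have "(\<lambda>X. ((if X = C then p else 0) - \<psi> (p * monom_of C) X)
        + ((if X = C then q else 0) - \<psi> (q * monom_of C) X)) \<in> ?L"
      using add by (rule module_span_add)
    moreover have "((if X = C then p else 0) - \<psi> (p * monom_of C) X)
        + ((if X = C then q else 0) - \<psi> (q * monom_of C) X)
        = (if X = C then p + q else 0) - \<psi> ((p + q) * monom_of C) X" for X
      by (simp add: distrib_right \<psi>_add)
    ultimately show ?case by simp
  qed
  have "w \<in> ?L" if w: "w \<in> syzygies E" for w
  proof -
    have "(\<lambda>X. \<Sum>C\<in>covers. (if X = C then w C else 0) - \<psi> (w C * monom_of C) X) \<in> ?L"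
      using claim by (intro module_span_sum) blast
    moreover have "(\<Sum>C\<in>covers. (if X = C then w C else 0) - \<psi> (w C * monom_of C) X) = w X" for X
    proof -
      have "(\<Sum>C\<in>covers. \<psi> (w C * monom_of C) X) = \<psi> (\<Sum>C\<in>covers. w C * monom_of C) X"
        by (rule \<psi>_sum[symmetric])
      also have "\<dots> = 0" using w by (simp add: syzygies_def \<psi>_0)
      finally have 0: "(\<Sum>C\<in>covers. \<psi> (w C * monom_of C) X) = 0" .
      have "(\<Sum>C\<in>covers. if X = C then w C else 0) = w X"
        using w by (auto simp: syzygies_def)
      then show ?thesis using 0 by (simp only: sum_subtractf diff_zero)
    qed
    ultimately show ?thesis by simp
  qed
  then have "syzygies E \<subseteq> ?L" by (rule subsetI)
  then show ?thesis
    unfolding linearly_presented_cover_ideal_def using card_min_vertex_cover_eq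
    by (intro conjI allI impI)
qed

end

section \<open>Cohen-Macaulay graphs\<close>

context P_matching
begin

lemma ex_min_vertex_cover: "\<exists>C. min_vertex_cover E C"
  by (metis min_vertex_cover_avoiding[OF simple] no_loop insert_absorb2)

lemma krull_dim_edge_ideal_ge:
  assumes C: "min_vertex_cover E C"
  shows "enat (card (- C)) \<le> krull_dim_quot (edge_ideal E :: ('v, 'k::field) mpoly set)"
proof (rule krull_dim_lower)
  have "vertex_cover E C" using C by (simp add: min_vertex_cover_def)
  then have "keys n \<inter> C \<noteq> {}" if "n \<in> nonface E" for n
    using that unfolding nonface_def vertex_cover_def by blast
  then show "edge_ideal E \<subseteq> (var_prime C :: ('v, 'k) mpoly set)"
    unfolding var_prime_def in_edge_ideal_iff subset_iff by blast
qed

lemma card_Compl_min_vertex_cover: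
  assumes "min_vertex_cover E C"
  shows "card (- C) = card (UNIV :: 'v set) div 2"
  using card_min_vertex_cover[OF assms] card_Un_disjoint[of C "- C"] by simp

lemma krull_dim_edge_ideal_le:
  "krull_dim_quot (edge_ideal E :: ('v, 'k::field) mpoly set) \<le> enat (card (UNIV :: 'v set) div 2)"
proof (rule krull_dim_upper)
  fix Q :: "('v, 'k) mpoly set" assume Q: "prime_ideal Q" "edge_ideal E \<subseteq> Q"
  have "vertex_cover E {v. var v \<in> Q}"
    unfolding vertex_cover_iff[OF simple]
  proof (intro allI impI)
    fix a b assume ab: "{a, b} \<in> E"
    then have "a \<noteq> b" by auto
    then have "var a * var b = (monom_of {a, b} :: ('v, 'k) mpoly)" by (simp add: monom_of_def)
    also have "\<dots> \<in> edge_ideal E" using ab by (rule monom_of_in_edge_ideal) simp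
    finally have "var a * var b \<in> Q" using Q(2) by blast
    then show "a \<in> {v. var v \<in> Q} \<or> b \<in> {v. var v \<in> Q}" using Q(1) by (simp add: prime_ideal_def)
  qed
  then obtain C where C: "C \<subseteq> {v. var v \<in> Q}" "min_vertex_cover E C"
    by (rule min_vertex_cover_subset) (rule that)
  then have "card {v. var v \<notin> Q} \<le> card (- C)" by (intro card_mono) auto
  then show "card {v. var v \<notin> Q} \<le> card (UNIV :: 'v set) div 2"
    using card_Compl_min_vertex_cover[OF C(2)] by simp
qed

lemma depth_edge_ideal_le:
  "depth_quot (edge_ideal E :: ('v, 'k::field) mpoly set) \<le> enat (card (UNIV :: 'v set) div 2)"
  unfolding depth_quot_def
proof (rule Sup_least, clarify)
  fix fs :: "('v, 'k) mpoly list" assume fs: "regular_seq (edge_ideal E) fs"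
  obtain C where C: "min_vertex_cover E C" using ex_min_vertex_cover by blast
  then have cov: "vertex_cover E C" by (simp add: min_vertex_cover_def)
  have "length fs \<le> card (- C)"
  proof (rule depth_le_facet[OF _ _ fs])
    show "\<not> e \<subseteq> - C" if "e \<in> E" for e using cov that unfolding vertex_cover_def by blast
    fix v assume "v \<notin> - C"
    then have "{v, m v} \<subseteq> insert v (- C)" using min_vertex_cover_m[OF C, of v] by auto
    then show "\<exists>e\<in>E. e \<subseteq> insert v (- C)" using medge by blast
  qed
  then show "enat (length fs) \<le> enat (card (UNIV :: 'v set) div 2)"
    using card_Compl_min_vertex_cover[OF C] by simp
qed

lemma Cohen_Macaulay_if_no_duplicates:
  assumes "\<not> has_duplicated_vertices E"
  shows "Cohen_Macaulay_graph TYPE('k::field) E"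
proof -
  let ?I = "edge_ideal E :: ('v, 'k) mpoly set" and ?g = "enat (card (UNIV :: 'v set) div 2)"
  obtain fs :: "('v, 'k) mpoly list" where fs: "regular_seq ?I fs" "2 * length fs = card (UNIV :: 'v set)"
    using matching_differences_regular_seq[OF assms] .
  then have "?g = enat (length fs)" by simp
  also have "\<dots> \<le> depth_quot ?I"
    unfolding depth_quot_def using fs(1) by (intro Sup_upper CollectI exI[of _ fs]) simp
  finally have "depth_quot ?I = ?g" using depth_edge_ideal_le by (intro antisym)
  moreover obtain C where C: "min_vertex_cover E C" using ex_min_vertex_cover by blast
  have "krull_dim_quot ?I = ?g"
    using krull_dim_edge_ideal_ge[OF C, where 'k = 'k] krull_dim_edge_ideal_le
    unfolding card_Compl_min_vertex_cover[OF C] by (intro antisym)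
  ultimately show ?thesis by (simp add: Cohen_Macaulay_graph_def Cohen_Macaulay_quot_def)
qed

text \<open>The depth is at most \<open>card F + 1\<close>, while the dimension is at least half the
  number of vertices, that is \<open>card F + card X\<close>; a duplicated vertex makes
  \<open>card X\<close> at least 2.\<close>

lemma no_duplicates_if_Cohen_Macaulay:
  assumes CM: "Cohen_Macaulay_graph TYPE('k::field) E"
  shows "\<not> has_duplicated_vertices E"
proof
  let ?I = "edge_ideal E :: ('v, 'k) mpoly set"
  assume "has_duplicated_vertices E"
  then obtain t t' where t: "t \<noteq> t'" "nbhd E t = nbhd E t'"
    by (auto simp: has_duplicated_vertices_def)
  define X where "X = {v. nbhd E v = nbhd E t}"
  define Y where "Y = {v. nbhd E v = nbhd E (m t)}"
  obtain F where F: "F \<inter> (X \<union> Y) = {}" "\<And>v. v \<notin> X \<union> Y \<Longrightarrow> m v \<in> F \<longleftrightarrow> v \<notin> F"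
    "\<And>a b. a \<in> F \<union> X \<Longrightarrow> b \<in> F \<union> X \<Longrightarrow> {a, b} \<notin> E"
    "\<And>a b. a \<in> F \<union> Y \<Longrightarrow> b \<in> F \<union> Y \<Longrightarrow> {a, b} \<notin> E"
    "\<And>a b. a \<in> X \<Longrightarrow> b \<in> Y \<Longrightarrow> {a, b} \<in> E"
    "2 * (card F + card X) = card (UNIV :: 'v set)"
    by (rule independent_set_with_disconnected_link[of t, folded X_def Y_def]) (rule that)
  have "{t, t'} \<subseteq> X" using t(2) by (auto simp: X_def)
  then have "card {t, t'} \<le> card X" by (intro card_mono) auto
  then have X2: "2 \<le> card X" using t(1) by simp
  have XY: "X \<inter> Y = {}" unfolding X_def Y_def using nbhd_m_neq[of t] by auto
  have tX: "t \<in> X" and tY: "m t \<in> Y" by (auto simp: X_def Y_def)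
  have indep: "\<not> e \<subseteq> insert v F" if e: "e \<in> E" and v: "v = t \<or> v = m t" for e v
  proof
    assume sub: "e \<subseteq> insert v F"
    obtain a b where ab: "e = {a, b}" using simple_graph_edgeE[OF simple e] by blast
    then have "a \<in> insert v F" "b \<in> insert v F" using sub by auto
    then have "a \<in> F \<union> X \<and> b \<in> F \<union> X \<or> a \<in> F \<union> Y \<and> b \<in> F \<union> Y" using v tX tY by blast
    then show False using F(3)[of a b] F(4)[of a b] e ab by blast
  qed
  have "length fs \<le> Suc (card F)" if fs: "regular_seq ?I fs" for fs
  proof (rule depth_le_disconnected_link[OF _ _ tX tY _ _ F(5) XY _ fs])
    fix v assume v: "v \<notin> F \<union> X \<union> Y"
    then have "{v, m v} \<subseteq> insert v F" using F(2)[of v] by auto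
    then show "\<exists>e\<in>E. e \<subseteq> insert v F" using medge by blast
  qed (use F(1) indep in auto)
  then have "depth_quot ?I \<le> enat (Suc (card F))"
    unfolding depth_quot_def by (intro Sup_least) auto
  also have "\<dots> < enat (card (UNIV :: 'v set) div 2)" using F(6)[symmetric] X2 by simp
  also obtain C where C: "min_vertex_cover E C" using ex_min_vertex_cover by blast
  have "enat (card (UNIV :: 'v set) div 2) \<le> krull_dim_quot ?I"
    using krull_dim_edge_ideal_ge[OF C, where 'k = 'k] unfolding card_Compl_min_vertex_cover[OF C] .
  finally show False using CM by (simp add: Cohen_Macaulay_graph_def Cohen_Macaulay_quot_def)
qed

end

theorem theorem5p8:
  fixes E :: "('v::finite) set set"
  assumes "simple_graph E"
    and "no_isolated_vertices E"
    and "unmixed E"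
    and "Koenig E"
  shows "(Cohen_Macaulay_graph TYPE('k::field) E \<longleftrightarrow> linearly_presented_cover_ideal TYPE('k) E)
       \<and> (linearly_presented_cover_ideal TYPE('k) E \<longleftrightarrow> cover_graph_connected E)
       \<and> (cover_graph_connected E \<longleftrightarrow> \<not> has_duplicated_vertices E)
       \<and> (\<not> has_duplicated_vertices E \<longleftrightarrow> C4_condition E)
       \<and> (C4_condition E \<longleftrightarrow> (\<exists>!M. perfect_matching E M))"
proof -
  obtain M where M: "perfect_matching E M"
    and size: "\<And>C. min_vertex_cover E C \<Longrightarrow> 2 * card C = card (UNIV :: 'v set)"
    by (rule Koenig_perfect_matching[OF assms]) (rule that)
  obtain m where m: "\<And>v. {v, m v} \<in> E" "\<And>v. m (m v) = v"
    by (rule involution_of_perfect_matching[OF assms(1) M]) (rule that)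
  interpret P_matching E m by (rule P_matchingI[OF assms(1) size m])
  have "Cohen_Macaulay_graph TYPE('k) E \<longleftrightarrow> \<not> has_duplicated_vertices E"
    using Cohen_Macaulay_if_no_duplicates no_duplicates_if_Cohen_Macaulay by blast
  moreover have "cover_graph_connected E \<longleftrightarrow> \<not> has_duplicated_vertices E"
    using cover_graph_connectedI no_duplicates_if_connected by blast
  moreover have "linearly_presented_cover_ideal TYPE('k) E \<longleftrightarrow> \<not> has_duplicated_vertices E"
    using linearly_presented_if_no_duplicates connected_if_linearly_presented
      no_duplicates_if_connected by blast
  moreover have "C4_condition E \<longleftrightarrow> \<not> has_duplicated_vertices E"
    using C4_condition_iff[OF assms(1) size M] .
  moreover have "(\<exists>!M. perfect_matching E M) \<longleftrightarrow> \<not> has_duplicated_vertices E"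
    using unique_perfect_matching_iff[OF assms(1) size M] .
  ultimately show ?thesis by (simp only: simp_thms)
qed

end
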